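(* Let $G$ be an abelian group such that $|nG|=|G|$ for every $n\in \mathbb{N}$. For an uncountable subset $S$ of $G$, the following conditions are equivalent: (i) $S$ is potentially dense in $G$; (ii) $S$ is $\mathscr{T}$-dense in $G$ for some precompact group topology $\mathscr{T}$ on $G$; (iii) $\log\log|nG|\le |nS|$ for every $n\in \mathbb{N}$; (iv) $\log\log|G|\le \min\{|nS|:n \in \mathbb{N}\}$.
   Context: $\mathbb{N}$ is the set of positive integers. For a subset $X$ of an abelian group, $nX=\{nx:x\in X\}$. For an infinite cardinal $\kappa$, $\log\kappa=\min\{\tau\ge\omega:\kappa\le 2^\tau\}$. A subset $S$ of a group $G$ is potentially dense in $G$ if $G$ admits some Hausdorff group topology $\mathscr{T}$ such that $S$ is dense in $(G,\mathscr{T})$. A topological group is precompact if it is isomorphic (as a topological group) to a subgroup of some compact Hausdorff group (in particular it is Hausdorff); a group topology is precompact if it makes the group a precompact topological group. *)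

theory Defs
  imports
    "HOL-Analysis.Analysis"
    "HOL-Algebra.Group"
begin

unbundle cardinal_syntax

no_notation eq_closure_of (\<open>closure'_of\<index>\<close>)
no_notation elt_set_eq (infix \<open>=o\<close> 50)

section \<open>Topological groups\<close>

definition group_topology :: "('a, 'm) monoid_scheme \<Rightarrow> 'a topology \<Rightarrow> bool" where
  "group_topology G T \<longleftrightarrow>
     group G \<and> topspace T = carrier G \<and>
     continuous_map (prod_topology T T) T (\<lambda>(x, y). x \<otimes>\<^bsub>G\<^esub> y) \<and>
     continuous_map T T (\<lambda>x. inv\<^bsub>G\<^esub> x)"

definition dense_in_topology :: "'a topology \<Rightarrow> 'a set \<Rightarrow> bool" where
  "dense_in_topology T S \<longleftrightarrow> S \<subseteq> topspace T \<and> T closure_of S = topspace T"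

definition potentially_dense :: "('a, 'm) monoid_scheme \<Rightarrow> 'a set \<Rightarrow> bool" where
  "potentially_dense G S \<longleftrightarrow>
     (\<exists>T. group_topology G T \<and> Hausdorff_space T \<and> dense_in_topology T S)"

definition topological_group_iso ::
    "('a, 'm) monoid_scheme \<Rightarrow> 'a topology \<Rightarrow> ('b, 'n) monoid_scheme \<Rightarrow> 'b topology \<Rightarrow> ('a \<Rightarrow> 'b) \<Rightarrow> bool" where
  "topological_group_iso G T H U f \<longleftrightarrow> f \<in> iso G H \<and> homeomorphic_map T U f"

text \<open>
  A type cannot be quantified existentially, so the compact group \<open>K\<close> lives on the type
  \<open>'a set set\<close>. This loses no generality: in a compact Hausdorff group one may pass to the closure
  of the image of \<open>G\<close>, which has at most \<open>2^(2^|G|)\<close> points. The lemma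
  \<open>precompact_group_topologyI\<close> below proves this, for \<open>K\<close> on an arbitrary type.
\<close>

definition precompact_group_topology :: "('a, 'm) monoid_scheme \<Rightarrow> 'a topology \<Rightarrow> bool" where
  "precompact_group_topology G T \<longleftrightarrow>
     group_topology G T \<and>
     (\<exists>(K :: 'a set set monoid) U H f.
        group_topology K U \<and> compact_space U \<and> Hausdorff_space U \<and> subgroup H K \<and>
        topological_group_iso G T (K\<lparr>carrier := H\<rparr>) (subtopology U H) f)"

lemma subgroup_closure_of:
  assumes K: "group_topology K U" and H: "subgroup H K"
  shows "subgroup (U closure_of H) K"
proof -
  interpret K: group K using K by (simp add: group_topology_def)
  have top: "topspace U = carrier K" using K by (simp add: group_topology_def)
  have HC: "H \<subseteq> U closure_of H"
    using subgroup.subset[OF H] top by (simp add: closure_of_subset)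
  show ?thesis
  proof (rule K.subgroupI)
    show "U closure_of H \<subseteq> carrier K"
      using closure_of_subset_topspace top by metis
    show "U closure_of H \<noteq> {}"
      using HC subgroup.one_closed[OF H] by auto
    fix a assume a: "a \<in> U closure_of H"
    have "(\<lambda>x. inv\<^bsub>K\<^esub> x) ` (U closure_of H) \<subseteq> U closure_of ((\<lambda>x. inv\<^bsub>K\<^esub> x) ` H)"
      using K by (intro continuous_map_image_closure_subset) (simp add: group_topology_def)
    also have "\<dots> \<subseteq> U closure_of H"
      using subgroup.m_inv_closed[OF H] by (intro closure_of_mono) auto
    finally show "inv\<^bsub>K\<^esub> a \<in> U closure_of H" using a by auto
    fix b assume b: "b \<in> U closure_of H"
    have "(\<lambda>(x, y). x \<otimes>\<^bsub>K\<^esub> y) ` (prod_topology U U closure_of (H \<times> H))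
        \<subseteq> U closure_of ((\<lambda>(x, y). x \<otimes>\<^bsub>K\<^esub> y) ` (H \<times> H))"
      using K by (intro continuous_map_image_closure_subset) (simp add: group_topology_def)
    also have "\<dots> \<subseteq> U closure_of H"
      using subgroup.m_closed[OF H] by (intro closure_of_mono) auto
    finally show "a \<otimes>\<^bsub>K\<^esub> b \<in> U closure_of H"
      using a b by (auto simp: closure_of_Times image_subset_iff)
  qed
qed

lemma group_topology_subgroup:
  assumes K: "group_topology K U" and H: "subgroup H K"
  shows "group_topology (K\<lparr>carrier := H\<rparr>) (subtopology U H)"
proof -
  interpret K: group K using K by (simp add: group_topology_def)
  have top: "topspace U = carrier K" using K by (simp add: group_topology_def)
  have sub: "H \<subseteq> carrier K" by (rule subgroup.subset[OF H])
  have "continuous_map (subtopology (prod_topology U U) (H \<times> H)) (subtopology U H)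
          (\<lambda>(x, y). x \<otimes>\<^bsub>K\<^esub> y)"
    using K subgroup.m_closed[OF H]
    by (auto simp: group_topology_def continuous_map_in_subtopology
        intro!: continuous_map_from_subtopology)
  moreover have "continuous_map (subtopology U H) (subtopology U H) (\<lambda>x. inv\<^bsub>K\<^esub> x)"
    using K subgroup.m_inv_closed[OF H]
    by (auto simp: group_topology_def continuous_map_in_subtopology
        intro!: continuous_map_from_subtopology)
  then have "continuous_map (subtopology U H) (subtopology U H)
      (\<lambda>x. inv\<^bsub>K\<lparr>carrier := H\<rparr>\<^esub> x)"
    by (rule continuous_map_eq) (simp add: K.m_inv_consistent[OF H])
  ultimately show ?thesis
    using subgroup.subgroup_is_group[OF H K.group_axioms] sub top
    by (auto simp: group_topology_def subtopology_Times)
qed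

lemma transport_group_topology:
  fixes K :: "('k, 'm) monoid_scheme" and e :: "'k \<Rightarrow> 'b"
  assumes K: "group_topology K U" and inj: "inj_on e (carrier K)"
  obtains K' :: "'b monoid" and U'
  where "group_topology K' U'" "topological_group_iso K U K' U' e"
proof -
  interpret K: group K using K by (simp add: group_topology_def)
  have top: "topspace U = carrier K" using K by (simp add: group_topology_def)
  define d where "d = inv_into (carrier K) e"
  have de [simp]: "d (e x) = x" if "x \<in> carrier K" for x
    using that inj by (simp add: d_def)
  define K' :: "'b monoid" where
    "K' = \<lparr>carrier = e ` carrier K, mult = (\<lambda>x y. e (d x \<otimes>\<^bsub>K\<^esub> d y)), one = e \<one>\<^bsub>K\<^esub>\<rparr>"
  define U' where "U' = pullback_topology (e ` carrier K) d U"
  have iso: "e \<in> iso K K'"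
    using inj by (auto simp: iso_def hom_def K'_def bij_betw_def)
  have "group (K'\<lparr>one := e \<one>\<^bsub>K\<^esub>\<rparr>)" by (rule K.iso_imp_img_group[OF iso])
  then have grp: "group K'" by (simp add: K'_def)
  have top': "topspace U' = carrier K'"
    by (auto simp: U'_def topspace_pullback_topology top K'_def)
  have cd: "continuous_map U' U d"
    using continuous_map_pullback[of U U id "e ` carrier K" d] by (simp add: U'_def)
  have ce: "continuous_map U U' e"
    unfolding U'_def
  proof (rule continuous_map_pullback')
    show "continuous_map U U (d \<circ> e)"
      by (rule continuous_map_eq[of _ _ id]) (auto simp: top)
  qed (auto simp: top)
  have maps: "homeomorphic_maps U U' e d"
    using cd ce by (auto simp: homeomorphic_maps_def top top' K'_def)
  have dK: "d x \<in> carrier K" if "x \<in> carrier K'" for x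
    using that by (auto simp: K'_def)
  have "continuous_map (prod_topology U' U') U (\<lambda>z. d (fst z) \<otimes>\<^bsub>K\<^esub> d (snd z))"
  proof -
    have "continuous_map (prod_topology U' U') (prod_topology U U) (\<lambda>z. (d (fst z), d (snd z)))"
      by (intro continuous_map_pairedI continuous_map_compose[OF continuous_map_fst cd, unfolded o_def]
          continuous_map_compose[OF continuous_map_snd cd, unfolded o_def])
    moreover have "continuous_map (prod_topology U U) U (\<lambda>(x, y). x \<otimes>\<^bsub>K\<^esub> y)"
      using K by (simp add: group_topology_def)
    ultimately show ?thesis
      by (auto dest: continuous_map_compose simp: o_def)
  qed
  from continuous_map_compose[OF this ce]
  have mult: "continuous_map (prod_topology U' U') U' (\<lambda>(x, y). x \<otimes>\<^bsub>K'\<^esub> y)"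
    by (simp add: o_def K'_def case_prod_unfold)
  have "continuous_map U U (\<lambda>x. inv\<^bsub>K\<^esub> x)" using K by (simp add: group_topology_def)
  from continuous_map_compose[OF continuous_map_compose[OF cd this] ce]
  have "continuous_map U' U' (\<lambda>x. e (inv\<^bsub>K\<^esub> (d x)))" by (simp add: o_def)
  moreover have "e (inv\<^bsub>K\<^esub> (d x)) = inv\<^bsub>K'\<^esub> x" if "x \<in> topspace U'" for x
  proof -
    have ed: "e (d x) = x" using that by (auto simp: top' K'_def)
    have "e (inv\<^bsub>K\<^esub> (d x)) = inv\<^bsub>K'\<^esub> (e (d x))"
      using group_hom.hom_inv[of K K' e "d x"] iso grp dK that K.group_axioms top'
      by (simp add: group_hom_def group_hom_axioms_def iso_def)
    then show ?thesis by (simp add: ed)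
  qed
  ultimately have "continuous_map U' U' (\<lambda>x. inv\<^bsub>K'\<^esub> x)"
    by (rule continuous_map_eq)
  with grp top' mult have "group_topology K' U'" by (simp add: group_topology_def)
  moreover have "topological_group_iso K U K' U' e"
    using iso maps homeomorphic_map_maps by (auto simp: topological_group_iso_def)
  ultimately show ?thesis by (rule that)
qed

lemma precompact_group_topologyI:
  fixes G :: "('a, 'm) monoid_scheme" and K :: "('k, 'n) monoid_scheme"
  assumes G: "group_topology G T"
    and K: "group_topology K U" "compact_space U" "Hausdorff_space U" and H: "subgroup H K"
    and f: "topological_group_iso G T (K\<lparr>carrier := H\<rparr>) (subtopology U H) f"
  shows "precompact_group_topology G T"
proof -
  have top: "topspace U = carrier K" using K by (simp add: group_topology_def)
  have HK: "H \<subseteq> carrier K" by (rule subgroup.subset[OF H])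
  have fG: "f ` carrier G = H"
    using f by (simp add: topological_group_iso_def iso_def bij_betw_def)
  define C where "C = U closure_of H"
  define KC where "KC = K\<lparr>carrier := C\<rparr>"
  define UC where "UC = subtopology U C"
  have CK: "subgroup C K" unfolding C_def by (rule subgroup_closure_of[OF K(1) H])
  have HC: "H \<subseteq> C" unfolding C_def using HK top by (simp add: closure_of_subset)
  have KC: "group_topology KC UC"
    unfolding KC_def UC_def by (rule group_topology_subgroup[OF K(1) CK])
  have UC: "compact_space UC" "Hausdorff_space UC"
    unfolding UC_def C_def using K
    by (simp_all add: closedin_compact_space compact_space_subtopology Hausdorff_space_subtopology)
  have topC: "topspace UC = C" using KC by (simp add: group_topology_def KC_def)
  define e where "e x = {A. A \<subseteq> carrier G \<and> x \<in> U closure_of (f ` A)}" for x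
  have "inj_on e C"
  proof (rule inj_onI, rule ccontr)
    fix x y assume x: "x \<in> C" and y: "y \<in> C" and eq: "e x = e y" and "x \<noteq> y"
    moreover have "x \<in> topspace U" "y \<in> topspace U"
      using x y by (simp_all add: C_def in_closure_of)
    ultimately obtain V W where VW: "openin U V" "openin U W" "x \<in> V" "y \<in> W" "disjnt V W"
      using K(3) unfolding Hausdorff_space_def by metis
    define A where "A = {a \<in> carrier G. f a \<in> V}"
    have fA: "f ` A = V \<inter> H" using fG by (auto simp: A_def)
    have "x \<in> U closure_of (V \<inter> H)"
      unfolding in_closure_of
    proof (intro conjI strip)
      show "x \<in> topspace U" by fact
      fix X assume "x \<in> X \<and> openin U X"
      then have "x \<in> X \<inter> V" "openin U (X \<inter> V)" using VW by auto
      then show "\<exists>z. z \<in> V \<inter> H \<and> z \<in> X" using x unfolding C_def in_closure_of by blast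
    qed
    then have "A \<in> e x" by (simp add: e_def fA) (simp add: A_def)
    then have "A \<in> e y" using eq by simp
    then have "y \<in> U closure_of (V \<inter> H)" by (simp add: e_def fA)
    then show False using VW unfolding in_closure_of disjnt_def by blast
  qed
  then have "inj_on e (carrier KC)" by (simp add: KC_def)
  from transport_group_topology[OF KC this] obtain K' :: "'a set set monoid" and U'
    where K': "group_topology K' U'" and e: "topological_group_iso KC UC K' U' e" .
  have homeo: "homeomorphic_map UC U' e" and eiso: "e \<in> iso KC K'"
    using e by (simp_all add: topological_group_iso_def)
  have "UC homeomorphic_space U'" using homeo homeomorphic_map_imp_homeomorphic_space by blast
  then have U': "compact_space U'" "Hausdorff_space U'"
    using UC homeomorphic_compact_space homeomorphic_Hausdorff_space by blast+
  interpret e: group_hom KC K' e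
    using KC K' eiso
    by (simp add: group_topology_def group_hom_def group_hom_axioms_def iso_def)
  interpret K: group K using K by (simp add: group_topology_def)
  have "subgroup H KC"
    unfolding KC_def using K.subgroup_incl[OF H CK HC] .
  then have eH: "subgroup (e ` H) K'" by (rule e.subgroup_img_is_subgroup)
  have bij: "bij_betw e H (e ` H)"
    using \<open>inj_on e C\<close> HC inj_on_subset by (auto simp: bij_betw_def)
  have "e \<in> iso (K\<lparr>carrier := H\<rparr>) (K'\<lparr>carrier := e ` H\<rparr>)"
    using bij e.hom_mult HC by (auto simp: iso_def hom_def KC_def subset_iff)
  then have iso: "e \<circ> f \<in> iso G (K'\<lparr>carrier := e ` H\<rparr>)"
    using f by (auto simp: topological_group_iso_def intro: iso_set_trans)
  have "homeomorphic_map (subtopology UC H) (subtopology U' (e ` H)) e"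
    using homeo HC topC
    by (intro homeomorphic_map_subtopologies)
       (auto simp: homeomorphic_map_def quotient_map_def)
  moreover have "subtopology UC H = subtopology U H"
    unfolding UC_def using HC by (simp add: subtopology_subtopology Int_absorb1)
  ultimately have "homeomorphic_map T (subtopology U' (e ` H)) (e \<circ> f)"
    using f by (auto simp: topological_group_iso_def intro: homeomorphic_map_compose)
  with iso have "topological_group_iso G T (K'\<lparr>carrier := e ` H\<rparr>) (subtopology U' (e ` H)) (e \<circ> f)"
    by (simp add: topological_group_iso_def)
  then show ?thesis
    unfolding precompact_group_topology_def using G K' U' eH by blast
qed


section \<open>Cardinals\<close>

text \<open>
  Cardinal numbers are represented by cardinal orders, compared by \<open>\<le>o\<close> and identified up to
  \<open>=o\<close>; the minimum of a set of cardinals is therefore only determined up to \<open>=o\<close>.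
\<close>

definition min_card :: "'a rel set \<Rightarrow> 'a rel" where
  "min_card R = (SOME r. r \<in> R \<and> (\<forall>r'\<in>R. r \<le>o r'))"

text \<open>
  For infinite \<open>r\<close>, no \<open>\<tau>\<close> is missed by considering only cardinals on the type of \<open>r\<close>; see
  \<open>clog_least\<close> below.
\<close>

definition clog :: "'a rel \<Rightarrow> 'a rel" where
  "clog r = min_card {\<tau>. Card_order \<tau> \<and> natLeq \<le>o \<tau> \<and> r \<le>o ctwo ^c \<tau>}"

lemma min_card:
  assumes "R \<noteq> {}" "\<forall>r\<in>R. Card_order r"
  shows min_card_in: "min_card R \<in> R" and min_card_least: "r \<in> R \<Longrightarrow> min_card R \<le>o r"
proof -
  have "\<exists>r. r \<in> R \<and> (\<forall>r'\<in>R. r \<le>o r')"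
    using exists_minim_Card_order[OF assms] by blast
  from someI_ex[OF this] show "min_card R \<in> R" "r \<in> R \<Longrightarrow> min_card R \<le>o r"
    unfolding min_card_def by blast+
qed

lemma ordLeq_ctwo_cexp:
  assumes "Card_order r"
  shows "r \<le>o ctwo ^c r"
  using ordLess_ctwo_cexp[OF assms] by (rule ordLess_imp_ordLeq)

lemma clog:
  assumes "Card_order r" "natLeq \<le>o r"
  shows Card_order_clog: "Card_order (clog r)"
    and natLeq_ordLeq_clog: "natLeq \<le>o clog r"
    and ordLeq_ctwo_cexp_clog: "r \<le>o ctwo ^c clog r"
    and clog_ordLeq: "clog r \<le>o r"
proof -
  let ?R = "{\<tau>. Card_order \<tau> \<and> natLeq \<le>o \<tau> \<and> r \<le>o ctwo ^c \<tau>}"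
  have r: "r \<in> ?R" using assms ordLeq_ctwo_cexp by blast
  then have "clog r \<in> ?R" unfolding clog_def by (intro min_card_in) auto
  then show "Card_order (clog r)" "natLeq \<le>o clog r" "r \<le>o ctwo ^c clog r" by auto
  show "clog r \<le>o r" unfolding clog_def using r by (intro min_card_least) auto
qed

lemma clog_least:
  fixes r :: "'a rel" and \<tau> :: "'b rel"
  assumes r: "Card_order r" "natLeq \<le>o r"
    and \<tau>: "Card_order \<tau>" "natLeq \<le>o \<tau>" "r \<le>o ctwo ^c \<tau>"
  shows "clog r \<le>o \<tau>"
proof (cases "r \<le>o \<tau>")
  case True
  then show ?thesis using clog_ordLeq[OF r] ordLeq_transitive by blast
next
  case False
  moreover have "Well_order r" "Well_order \<tau>"
    using r(1) \<tau>(1) by (simp_all add: card_order_on_def)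
  ultimately have "\<tau> \<le>o r" using ordLeq_total by blast
  then have "|Field \<tau>| \<le>o |Field r|" by (rule card_of_mono2)
  then obtain g where g: "inj_on g (Field \<tau>)" "g ` Field \<tau> \<subseteq> Field r"
    unfolding card_of_ordLeq[symmetric] by blast
  have "|Field \<tau>| =o |g ` Field \<tau>|"
    using g(1) by (intro card_of_ordIsoI[of g]) (simp add: bij_betw_def)
  then have eq: "|g ` Field \<tau>| =o \<tau>"
    using card_of_Field_ordIso[OF \<tau>(1)] ordIso_symmetric ordIso_transitive by blast
  have "natLeq \<le>o |g ` Field \<tau>|"
    using \<tau>(2) eq ordIso_symmetric ordLeq_ordIso_trans by blast
  moreover have "r \<le>o ctwo ^c |g ` Field \<tau>|"
  proof -
    have "ctwo ^c \<tau> =o ctwo ^c |g ` Field \<tau>|"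
      using cexp_cong2[OF ordIso_symmetric[OF eq] Card_order_ctwo \<tau>(1)] .
    then show ?thesis using \<tau>(3) ordLeq_ordIso_trans by blast
  qed
  ultimately have "clog r \<le>o |g ` Field \<tau>|"
    unfolding clog_def by (intro min_card_least) (use card_of_Card_order in auto)
  then show ?thesis using eq ordLeq_ordIso_trans by blast
qed


section \<open>Multiples of a subset\<close>

text \<open>
  The set \<open>{nx : x \<in> X}\<close>; the group operation of a \<open>monoid\<close> record is written
  multiplicatively.
\<close>

definition multiples :: "('a, 'm) monoid_scheme \<Rightarrow> nat \<Rightarrow> 'a set \<Rightarrow> 'a set" where
  "multiples G n X = {x [^]\<^bsub>G\<^esub> n | x. x \<in> X}"

end

theory Submission
  imports Defs "HOL-Algebra.Free_Abelian_Groups"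
begin

text \<open>
  Density of \<open>S\<close> bounds \<open>|nG|\<close> by \<open>2^(2^|nS|)\<close>, because a point of a Hausdorff space is determined by
  the subsets of a dense set whose closure contains it. Conversely let \<open>|G| \<le> 2^(2^\<tau>)\<close> and
  \<open>\<tau> \<le> |nS|\<close> for all \<open>n\<close>. One finds \<open>\<tau>\<close> points of \<open>S\<close> at which characters of \<open>G\<close> can take
  approximately arbitrary prescribed values. A dense subset of size \<open>\<tau>\<close> of the power \<open>T^(2^\<tau>)\<close> of the
  circle group then prescribes the values of \<open>2^\<tau>\<close> characters which map \<open>S\<close> onto a dense subset of
  \<open>T^(2^\<tau>)\<close>. There is enough freedom left to make the resulting homomorphism from \<open>G\<close> to \<open>T^(2^\<tau>)\<close>
  injective, and it induces the required topology.
\<close>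

section \<open>Characters and their extension\<close>

text \<open>Injectivity and density compete for the same characters: a character detecting an
  element \<open>h\<close> of the subgroup generated by the chosen points cannot also take arbitrary
  values at the points which express \<open>h\<close>. Each coordinate is therefore allowed to miss
  its targets on a small set of points that depends on \<open>h\<close>. All multiples
  \<open>nS\<close> matter because a character is constrained at \<open>s\<close> as soon as a power
  of \<open>s\<close> lies in the subgroup where it is already prescribed. If no positive power up
  to exponent \<open>N\<close> does, the admissible values are dense up to \<open>pi / N\<close>,
  and excluding all these exponents at once is a single condition on the power with exponent
  \<open>N!\<close>. It can be met whenever that subgroup is smaller than \<open>nS\<close> for
  \<open>n = N!\<close>. For a countable index set this may fail at every stage; earlier values must
  then be perturbed, which is why two interpolation arguments occur. In both, values are prescribed
  up to an error only: such conditions are closed, so that compactness carries them from finitely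
  many points to all of them.\<close>

text \<open>
  Distances on the unit circle are measured by angles: the bounds then add up under multiplication
  and are divided by \<open>n\<close> on taking \<open>n\<close>-th roots.
\<close>

definition near :: "real \<Rightarrow> complex \<Rightarrow> complex \<Rightarrow> bool" where
  "near e z w \<longleftrightarrow> (\<exists>\<theta>. \<bar>\<theta>\<bar> \<le> e \<and> z = w * cis \<theta>)"

lemma near_refl: "0 \<le> e \<Longrightarrow> near e z z"
  unfolding near_def by (rule exI[of _ 0]) auto

lemma near_0_iff [simp]: "near 0 z w \<longleftrightarrow> z = w"
  by (auto simp: near_def)

lemma near_mono: "near d z w \<Longrightarrow> d \<le> e \<Longrightarrow> near e z w"
  unfolding near_def using order_trans by blast

lemma near_mult:
  assumes "near d z w" "near e z' w'"
  shows "near (d + e) (z * z') (w * w')"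
proof -
  obtain a b where "\<bar>a\<bar> \<le> d" "z = w * cis a" "\<bar>b\<bar> \<le> e" "z' = w' * cis b"
    using assms by (auto simp: near_def)
  then show ?thesis
    unfolding near_def by (intro exI[of _ "a + b"]) (auto simp flip: cis_mult)
qed

lemma near_trans:
  assumes "near d z w" "near e w v"
  shows "near (d + e) z v"
proof -
  obtain a b where "\<bar>a\<bar> \<le> d" "z = w * cis a" "\<bar>b\<bar> \<le> e" "w = v * cis b"
    using assms by (auto simp: near_def)
  then show ?thesis
    unfolding near_def by (intro exI[of _ "a + b"]) (auto simp flip: cis_mult)
qed

lemma near_inverse: "near e z w \<Longrightarrow> near e (inverse z) (inverse w)"
  unfolding near_def by (metis abs_minus_cancel inverse_mult_distrib cis_inverse)

lemma near_power: "near e z w \<Longrightarrow> near (of_nat n * e) (z ^ n) (w ^ n)"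
proof (induction n)
  case (Suc n)
  then have "near (e + of_nat n * e) (z * z ^ n) (w * w ^ n)"
    by (intro near_mult) auto
  then show ?case by (simp add: algebra_simps)
qed simp

text \<open>A chord is no longer than its arc. This is the passage from angles to the metric in
  which density is finally tested.\<close>

lemma near_dist:
  assumes "near e z w" "cmod w = 1"
  shows "dist z w \<le> e"
proof -
  obtain a where a: "\<bar>a\<bar> \<le> e" "z = w * cis a" using assms by (auto simp: near_def)
  have "z - w = w * (cis a - cis 0)" using a by (simp add: algebra_simps)
  then have "dist z w = cmod (cis a - cis 0)"
    using assms by (simp add: dist_norm norm_mult)
  also have "\<dots> \<le> \<bar>a\<bar>"
    using dist_exp_i_1[of a] abs_sin_x_le_abs_x[of "a / 2"] by (simp add: cis_conv_exp)
  finally show ?thesis using a by simp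
qed

text \<open>The set is an arc, the continuous image of a compact interval. Closedness makes an
  approximate prescription admissible in \<open>character_compactness\<close>.\<close>

lemma closed_near: "closed {z. near e z w}"
proof -
  have "{z. near e z w} = (\<lambda>\<theta>. w * cis \<theta>) ` {-e..e}"
    by (auto simp: near_def image_def abs_le_iff)
  moreover have "compact ((\<lambda>\<theta>. w * cis \<theta>) ` {-e..e})"
    by (intro compact_continuous_image continuous_intros) auto
  ultimately show ?thesis by (simp add: compact_imp_closed)
qed

lemma circle_cis:
  assumes "cmod z = 1"
  obtains \<theta> where "\<bar>\<theta>\<bar> \<le> pi" "z = cis \<theta>"
proof -
  have "z = cis (Arg z)" using assms cis_Arg[of z] by (cases "z = 0") (auto simp: sgn_div_norm)
  moreover have "\<bar>Arg z\<bar> \<le> pi" using Arg_bounded[of z] by auto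
  ultimately show ?thesis using that by blast
qed

lemma root_near:
  assumes "cmod w = 1" "cmod t = 1" "n \<noteq> 0" "near e w (t ^ n)"
  obtains z where "cmod z = 1" "z ^ n = w" "near (e / n) z t"
proof -
  obtain a where a: "\<bar>a\<bar> \<le> e" "w = t ^ n * cis a" using assms by (auto simp: near_def)
  have "near (e / n) (t * cis (a / n)) t"
    using a assms(3) unfolding near_def by (intro exI[of _ "a / n"]) (auto simp: divide_right_mono)
  moreover have "(t * cis (a / n)) ^ n = w"
    using a assms(3) by (simp add: power_mult_distrib Complex.DeMoivre)
  moreover have "cmod (t * cis (a / n)) = 1" using assms by (simp add: norm_mult)
  ultimately show ?thesis using that by blast
qed

text \<open>Two points of the circle always differ by an angle of at most \<open>pi\<close>, so the
  \<open>n\<close>-th roots of any of its points are dense up to \<open>pi / n\<close>.\<close>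

lemma root_near_pi:
  assumes "cmod w = 1" "cmod t = 1" "n \<noteq> 0"
  obtains z where "cmod z = 1" "z ^ n = w" "near (pi / n) z t"
proof -
  have "cmod (w / t ^ n) = 1" using assms by (simp add: norm_divide norm_power)
  then obtain a where "\<bar>a\<bar> \<le> pi" "w / t ^ n = cis a" by (rule circle_cis)
  moreover have "t ^ n \<noteq> 0" using assms by auto
  ultimately have "near pi w (t ^ n)"
    unfolding near_def by (intro exI[of _ a]) (auto simp: field_simps)
  with assms show ?thesis using root_near that by blast
qed

text \<open>Values off \<open>E\<close> are left unconstrained: a character of the whole group is
  literally one on each subset, and to extend means to agree on \<open>E\<close>.\<close>

definition character_on :: "('a, 'm) monoid_scheme \<Rightarrow> 'a set \<Rightarrow> ('a \<Rightarrow> complex) \<Rightarrow> bool" where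
  "character_on G E \<phi> \<longleftrightarrow>
     (\<forall>x\<in>E. cmod (\<phi> x) = 1) \<and> (\<forall>x\<in>E. \<forall>y\<in>E. \<phi> (x \<otimes>\<^bsub>G\<^esub> y) = \<phi> x * \<phi> y)"

abbreviation character :: "('a, 'm) monoid_scheme \<Rightarrow> ('a \<Rightarrow> complex) \<Rightarrow> bool" where
  "character G \<equiv> character_on G (carrier G)"

lemma character_on_mono: "character_on G E \<phi> \<Longrightarrow> D \<subseteq> E \<Longrightarrow> character_on G D \<phi>"
  by (auto simp: character_on_def)

lemma character_on_one [simp]: "character_on G E (\<lambda>_. 1)"
  by (auto simp: character_on_def)

lemma character_on_times:
  "character_on G E \<phi> \<Longrightarrow> character_on G E \<psi> \<Longrightarrow> character_on G E (\<lambda>x. \<phi> x * \<psi> x)"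
  by (auto simp: character_on_def norm_mult)

lemma character_on_inverse:
  "character_on G E \<phi> \<Longrightarrow> character_on G E (\<lambda>x. inverse (\<phi> x))"
  by (auto simp: character_on_def norm_inverse)

lemma character_on_prod:
  "(\<And>i. i \<in> I \<Longrightarrow> character_on G E (\<phi> i)) \<Longrightarrow> character_on G E (\<lambda>x. \<Prod>i\<in>I. \<phi> i x)"
  by (auto simp: character_on_def prod_norm[symmetric] prod.distrib)

lemma character_on_norm: "character_on G E \<phi> \<Longrightarrow> x \<in> E \<Longrightarrow> cmod (\<phi> x) = 1"
  by (auto simp: character_on_def)

lemma character_on_nonzero: "character_on G E \<phi> \<Longrightarrow> x \<in> E \<Longrightarrow> \<phi> x \<noteq> 0"
  using character_on_norm by fastforce

lemma character_on_mult:
  "character_on G E \<phi> \<Longrightarrow> x \<in> E \<Longrightarrow> y \<in> E \<Longrightarrow> \<phi> (x \<otimes>\<^bsub>G\<^esub> y) = \<phi> x * \<phi> y"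
  by (auto simp: character_on_def)

section \<open>Characters on subgroups\<close>

context comm_group
begin

lemma character_on_id:
  assumes "subgroup E G" "character_on G E \<phi>"
  shows "\<phi> \<one> = 1"
proof -
  have "\<one> \<in> E" using assms(1) by (rule subgroup.one_closed)
  then have "\<phi> \<one> * \<phi> \<one> = \<phi> \<one>" "\<phi> \<one> \<noteq> 0"
    using character_on_mult[OF assms(2), of \<one> \<one>] character_on_nonzero[OF assms(2)] by auto
  then show ?thesis by simp
qed

lemma character_on_inv:
  assumes E: "subgroup E G" "character_on G E \<phi>" and x: "x \<in> E"
  shows "\<phi> (inv x) = inverse (\<phi> x)"
proof -
  have "inv x \<in> E" "x \<in> carrier G" using E x by (auto simp: subgroup.m_inv_closed subgroup.mem_carrier)
  then have "\<phi> (inv x) * \<phi> x = 1"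
    using character_on_mult[OF E(2), of "inv x" x] character_on_id[OF E] x by simp
  then show ?thesis by (metis inverse_unique mult.commute)
qed

lemma character_on_pow:
  assumes E: "subgroup E G" "character_on G E \<phi>" and x: "x \<in> E"
  shows "\<phi> (x [^] (n::nat)) = \<phi> x ^ n"
proof (induction n)
  case (Suc n)
  have "x [^] n \<in> E" using E x by (metis subgroup_int_pow_closed int_pow_int)
  then show ?case using Suc character_on_mult[OF E(2), of "x [^] n" x] x by simp
qed (use character_on_id[OF E] in simp)

lemma character_on_int_pow:
  assumes E: "subgroup E G" "character_on G E \<phi>" and x: "x \<in> E"
  shows "\<phi> (x [^] (n::int)) = \<phi> x powi n"
proof (cases n rule: int_cases2)
  case (nonneg k)
  then show ?thesis using character_on_pow[OF assms, of k] by (simp add: int_pow_int)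
next
  case (nonpos k)
  have xc: "x \<in> carrier G" using E x by (auto simp: subgroup.mem_carrier)
  have "x [^] k \<in> E" using subgroup_int_pow_closed[OF E(1) x, of "int k"] by (simp add: int_pow_int)
  then have "\<phi> (inv (x [^] k)) = inverse (\<phi> x ^ k)"
    using character_on_inv[OF E] character_on_pow[OF assms, of k] by simp
  then show ?thesis using nonpos xc by (simp add: int_pow_neg int_pow_int power_int_minus)
qed

lemma character_eq_on_generate:
  assumes \<phi>: "character G \<phi>" "character G \<psi>" and A: "A \<subseteq> carrier G" "\<And>x. x \<in> A \<Longrightarrow> \<phi> x = \<psi> x"
    and x: "x \<in> generate G A"
  shows "\<phi> x = \<psi> x"
  using x
proof induction
  case one
  then show ?case using character_on_id[OF subgroup_self \<phi>(1)] character_on_id[OF subgroup_self \<phi>(2)] by simp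
next
  case (incl h)
  then show ?case using A by simp
next
  case (inv h)
  then show ?case
    using A character_on_inv[OF subgroup_self \<phi>(1)] character_on_inv[OF subgroup_self \<phi>(2)] by auto
next
  case (eng h1 h2)
  then have "h1 \<in> carrier G" "h2 \<in> carrier G" using generate_in_carrier[OF A(1)] by auto
  then show ?case using eng character_on_mult[OF \<phi>(1)] character_on_mult[OF \<phi>(2)] by simp
qed

text \<open>Two representations \<open>e \<otimes> a [^] n\<close> of one element differ by a power
  of \<open>a\<close> lying in \<open>E\<close>; \<open>compat\<close> is precisely what makes
  \<open>\<phi> e * z powi n\<close> independent of the representation.\<close>

lemma character_extend_step:
  assumes E: "subgroup E G" and \<phi>: "character_on G E \<phi>" and a: "a \<in> carrier G" and z: "cmod z = 1"
    and compat: "\<And>n::int. a [^] n \<in> E \<Longrightarrow> \<phi> (a [^] n) = z powi n"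
  obtains E' \<phi>' where "subgroup E' G" "E \<subseteq> E'" "a \<in> E'" "character_on G E' \<phi>'" "\<phi>' a = z"
    "\<And>x. x \<in> E \<Longrightarrow> \<phi>' x = \<phi> x"
proof -
  interpret E: subgroup E G by (rule E)
  have z0: "z \<noteq> 0" using z by auto
  define E' where "E' = {e \<otimes> a [^] (n::int) | e n. e \<in> E}"
  have wd: "\<phi> e * z powi m = \<phi> f * z powi n"
    if "e \<in> E" "f \<in> E" "e \<otimes> a [^] m = f \<otimes> a [^] n" for e f and m n :: int
  proof -
    have "a [^] m = a [^] (m - n) \<otimes> a [^] n" using a int_pow_mult[of a "m - n" n] by simp
    then have "(e \<otimes> a [^] (m - n)) \<otimes> a [^] n = f \<otimes> a [^] n"
      using that a by (simp add: m_assoc)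
    then have "e \<otimes> a [^] (m - n) = f" using that(1,2) a by (subst (asm) right_cancel) auto
    then have "a [^] (m - n) = inv e \<otimes> f" using that(1,2) a by (auto simp: m_assoc[symmetric])
    moreover have "inv e \<otimes> f \<in> E" using that by simp
    ultimately have "\<phi> (inv e \<otimes> f) = z powi (m - n)" using compat by metis
    then have "inverse (\<phi> e) * \<phi> f = z powi (m - n)"
      using character_on_mult[OF \<phi>, of "inv e" f] character_on_inv[OF E \<phi>] that by simp
    then show ?thesis
      using z0 character_on_nonzero[OF \<phi> that(1)] by (simp add: power_int_diff field_simps)
  qed
  define \<phi>' where "\<phi>' x = (THE w. \<exists>e n. e \<in> E \<and> x = e \<otimes> a [^] (n::int) \<and> w = \<phi> e * z powi n)" for x
  have \<phi>': "\<phi>' (e \<otimes> a [^] n) = \<phi> e * z powi n" if "e \<in> E" for e and n :: int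
    unfolding \<phi>'_def
  proof (rule the_equality)
    show "\<exists>e' m. e' \<in> E \<and> e \<otimes> a [^] n = e' \<otimes> a [^] (m::int) \<and> \<phi> e * z powi n = \<phi> e' * z powi m"
      using that by blast
    show "w = \<phi> e * z powi n"
      if "\<exists>e' m. e' \<in> E \<and> e \<otimes> a [^] n = e' \<otimes> a [^] (m::int) \<and> w = \<phi> e' * z powi m" for w
      using that wd[OF \<open>e \<in> E\<close>] by metis
  qed
  have mult: "(e \<otimes> a [^] m) \<otimes> (f \<otimes> a [^] n) = (e \<otimes> f) \<otimes> a [^] (m + n)"
    if "e \<in> E" "f \<in> E" for e f and m n :: int
    using that a by (simp add: int_pow_mult m_ac)
  have sub: "subgroup E' G"
  proof (rule subgroupI)
    show "E' \<subseteq> carrier G" using a by (auto simp: E'_def)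
    show "E' \<noteq> {}" using E.one_closed unfolding E'_def by blast
    fix x assume "x \<in> E'"
    then obtain e and n :: int where x: "e \<in> E" "x = e \<otimes> a [^] n" by (auto simp: E'_def)
    then have "inv x = inv e \<otimes> a [^] (- n)" using a by (simp add: inv_mult int_pow_neg)
    then show "inv x \<in> E'" using x(1) unfolding E'_def by blast
    fix y assume "y \<in> E'"
    then obtain f and m :: int where y: "f \<in> E" "y = f \<otimes> a [^] m" by (auto simp: E'_def)
    have "x \<otimes> y = (e \<otimes> f) \<otimes> a [^] (n + m)" using x y mult by simp
    then show "x \<otimes> y \<in> E'" using x y unfolding E'_def by blast
  qed
  have "character_on G E' \<phi>'"
    unfolding character_on_def
  proof (intro conjI ballI)
    fix x assume "x \<in> E'"
    then obtain e and n :: int where x: "e \<in> E" "x = e \<otimes> a [^] n" by (auto simp: E'_def)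
    then show "cmod (\<phi>' x) = 1"
      using \<phi>' z character_on_norm[OF \<phi>] by (simp add: norm_mult norm_power_int)
    fix y assume "y \<in> E'"
    then obtain f and m :: int where y: "f \<in> E" "y = f \<otimes> a [^] m" by (auto simp: E'_def)
    show "\<phi>' (x \<otimes> y) = \<phi>' x * \<phi>' y"
      using x y mult \<phi>' character_on_mult[OF \<phi>] z0 by (simp add: power_int_add)
  qed
  moreover have "\<phi>' a = z" using \<phi>'[OF E.one_closed, of 1] a character_on_id[OF E \<phi>] by simp
  moreover have "\<phi>' x = \<phi> x" if "x \<in> E" for x using \<phi>'[OF that, of 0] that by simp
  moreover have "E \<subseteq> E'"
  proof
    fix x assume "x \<in> E"
    then have "x = x \<otimes> a [^] (0::int)" by simp
    then show "x \<in> E'" using \<open>x \<in> E\<close> unfolding E'_def by blast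
  qed
  moreover have "a \<in> E'"
  proof -
    have "a = \<one> \<otimes> a [^] (1::int)" using a by simp
    then show ?thesis using E.one_closed unfolding E'_def by blast
  qed
  ultimately show ?thesis using sub that by blast
qed

text \<open>The exponents of the powers of \<open>a\<close> lying in \<open>E\<close> form a
  subgroup of the integers, which is zero or generated by its least positive element. Thus
  \<open>m\<close> is the order of \<open>a\<close> modulo \<open>E\<close>.\<close>

lemma int_pow_in_subgroup_cases:
  assumes E: "subgroup E G" and a: "a \<in> carrier G"
  obtains (free) "\<And>n::int. a [^] n \<in> E \<Longrightarrow> n = 0"
  | (torsion) m :: nat where "m > 0" "\<And>n::int. a [^] n \<in> E \<longleftrightarrow> int m dvd n"
proof (cases "\<exists>m::nat. m > 0 \<and> a [^] m \<in> E")
  case False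
  have "n = 0" if n: "a [^] n \<in> E" for n :: int
  proof (rule ccontr)
    assume "n \<noteq> 0"
    have "a [^] (- n) \<in> E" using n E a by (simp add: int_pow_neg subgroup.m_inv_closed)
    then have "a [^] \<bar>n\<bar> \<in> E" using n by (simp add: abs_if)
    then have "a [^] nat \<bar>n\<bar> \<in> E" by (metis abs_ge_zero int_pow_int nat_0_le)
    moreover have "nat \<bar>n\<bar> > 0" using \<open>n \<noteq> 0\<close> by simp
    ultimately show False using False by blast
  qed
  then show ?thesis by (rule free)
next
  case True
  define m :: nat where "m = (LEAST m. m > 0 \<and> a [^] m \<in> E)"
  have m: "m > 0" "a [^] m \<in> E" using LeastI_ex[OF True] by (auto simp: m_def)
  have least: "k = 0" if "k < m" "a [^] k \<in> E" for k :: nat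
    using not_less_Least[of k "\<lambda>m. m > 0 \<and> a [^] m \<in> E"] that by (auto simp: m_def)
  have mul: "a [^] (int m * q) \<in> E" for q
    using subgroup_int_pow_closed[OF E m(2), of q] int_pow_pow[OF a, of "int m" q]
    by (simp add: int_pow_int)
  show ?thesis
  proof (rule torsion[OF m(1)])
    fix n :: int
    show "a [^] n \<in> E \<longleftrightarrow> int m dvd n"
    proof
      assume n: "a [^] n \<in> E"
      have "a [^] (n mod int m) = a [^] n \<otimes> inv (a [^] (int m * (n div int m)))"
        using a by (simp add: int_pow_diff[symmetric] minus_mult_div_eq_mod)
      then have "a [^] (n mod int m) \<in> E"
        using n mul E by (simp add: subgroup.m_closed subgroup.m_inv_closed)
      moreover obtain k where k: "n mod int m = int k" "k < m"
        using m(1) by (metis nonneg_int_cases of_nat_0_less_iff of_nat_less_iff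
            pos_mod_bound pos_mod_sign)
      ultimately have "k = 0" using least by (simp add: int_pow_int)
      then show "int m dvd n" using k by (simp add: dvd_eq_mod_eq_0)
    qed (use mul in \<open>auto simp: dvd_def\<close>)
  qed
qed

end

lemma continuous_map_normed_mult:
  fixes f :: "'a \<Rightarrow> 'b::real_normed_algebra"
  shows "continuous_map X euclidean f \<Longrightarrow> continuous_map X euclidean g
    \<Longrightarrow> continuous_map X euclidean (\<lambda>x. f x * g x)"
  by (simp add: continuous_map_atin tendsto_mult)

section \<open>Extension of characters to the whole group\<close>

context comm_group
begin

text \<open>If \<open>a\<close> has finite order modulo \<open>E\<close>, the compatibility
  condition of \<open>character_extend_step\<close> reduces to one equation, at the exponent
  \<open>m\<close>.\<close>

lemma character_on_torsion_pow:
  assumes E: "subgroup E G" and \<phi>: "character_on G E \<phi>" and a: "a \<in> carrier G"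
    and m: "m > 0" "\<And>n::int. a [^] n \<in> E \<longleftrightarrow> int m dvd n" and z: "z ^ m = \<phi> (a [^] m)"
    and n: "a [^] (n::int) \<in> E"
  shows "\<phi> (a [^] n) = z powi n"
proof -
  have mE: "a [^] m \<in> E" using m(2)[of "int m"] by (simp add: int_pow_int)
  obtain q where q: "n = int m * q" using m(2) n by (auto simp: dvd_def)
  have "\<phi> (a [^] n) = \<phi> ((a [^] m) [^] q)"
    using a by (simp add: q int_pow_pow flip: int_pow_int)
  also have "\<dots> = z powi n"
    using character_on_int_pow[OF E \<phi> mE] by (simp add: q power_int_mult flip: z)
  finally show ?thesis .
qed

text \<open>The circle is divisible: a partial extension defined on a proper subgroup always admits
  a value at one further element.\<close>

theorem character_extend:
  assumes E: "subgroup E G" and \<phi>: "character_on G E \<phi>"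
  obtains \<psi> where "character G \<psi>" "\<And>x. x \<in> E \<Longrightarrow> \<psi> x = \<phi> x"
proof -
  \<comment> \<open>Partial extensions are represented by their graphs, so that a chain is bounded
    by its plain union. Closure under products and inverses makes the domain a subgroup and the
    function a character.\<close>
  define \<A> where "\<A> = {R. (\<lambda>x. (x, \<phi> x)) ` E \<subseteq> R \<and> R \<subseteq> carrier G \<times> sphere 0 1 \<and> single_valued R \<and>
    (\<forall>p\<in>R. \<forall>q\<in>R. (fst p \<otimes> fst q, snd p * snd q) \<in> R) \<and> (\<forall>p\<in>R. (inv (fst p), inverse (snd p)) \<in> R)}"
  have graph: "(\<lambda>x. (x, \<psi> x)) ` D \<in> \<A>"
    if D: "subgroup D G" "E \<subseteq> D" and \<psi>: "character_on G D \<psi>" "\<And>x. x \<in> E \<Longrightarrow> \<psi> x = \<phi> x" for D \<psi>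
    using D(2) \<psi>(2) subgroup.subset[OF D(1)] character_on_norm[OF \<psi>(1)] character_on_mult[OF \<psi>(1)]
      character_on_inv[OF D(1) \<psi>(1)] subgroup.m_closed[OF D(1)] subgroup.m_inv_closed[OF D(1)]
    unfolding \<A>_def by (auto simp: single_valued_def image_iff subset_iff)
  have "\<exists>M\<in>\<A>. \<forall>R\<in>\<A>. M \<subseteq> R \<longrightarrow> R = M"
  proof (rule subset_Zorn_nonempty)
    show "\<A> \<noteq> {}" using graph[OF E order_refl \<phi>] by auto
    fix \<C> assume \<C>: "\<C> \<noteq> {}" "subset.chain \<A> \<C>"
    have \<C>\<A>: "\<C> \<subseteq> \<A>" and chain: "\<And>R S. R \<in> \<C> \<Longrightarrow> S \<in> \<C> \<Longrightarrow> R \<subseteq> S \<or> S \<subseteq> R"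
      using \<C>(2) by (auto simp: subset_chain_def)
    have pair: "\<exists>R\<in>\<C>. p \<in> R \<and> q \<in> R" if "p \<in> \<Union>\<C>" "q \<in> \<Union>\<C>" for p q
      using that chain by (meson UnionE subsetD)
    have "single_valued (\<Union>\<C>)"
      unfolding single_valued_def
    proof (intro allI impI)
      fix x y z assume "(x, y) \<in> \<Union>\<C>" "(x, z) \<in> \<Union>\<C>"
      then obtain R where "R \<in> \<C>" "(x, y) \<in> R" "(x, z) \<in> R" using pair by blast
      moreover from this have "single_valued R" using \<C>\<A> by (auto simp: \<A>_def)
      ultimately show "y = z" by (meson single_valuedD)
    qed
    moreover have "(fst p \<otimes> fst q, snd p * snd q) \<in> \<Union>\<C>" if p: "p \<in> \<Union>\<C>" and q: "q \<in> \<Union>\<C>" for p q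
    proof -
      obtain R where R: "R \<in> \<C>" "p \<in> R" "q \<in> R" using pair[OF p q] by blast
      then have "(fst p \<otimes> fst q, snd p * snd q) \<in> R" using \<C>\<A> by (auto simp: \<A>_def)
      then show ?thesis using R by blast
    qed
    moreover have "(inv (fst p), inverse (snd p)) \<in> \<Union>\<C>" if p: "p \<in> \<Union>\<C>" for p
    proof -
      obtain R where R: "R \<in> \<C>" "p \<in> R" using p by blast
      then have "(inv (fst p), inverse (snd p)) \<in> R" using \<C>\<A> by (auto simp: \<A>_def)
      then show ?thesis using R by blast
    qed
    moreover have "(\<lambda>x. (x, \<phi> x)) ` E \<subseteq> \<Union>\<C>"
    proof -
      obtain R where R: "R \<in> \<C>" using \<C>(1) by blast
      then have "R \<in> \<A>" using \<C>\<A> by blast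
      then have "(\<lambda>x. (x, \<phi> x)) ` E \<subseteq> R" by (simp add: \<A>_def)
      then show ?thesis using R by blast
    qed
    moreover have "\<Union>\<C> \<subseteq> carrier G \<times> sphere 0 1"
    proof (rule Union_least)
      fix R assume "R \<in> \<C>"
      then have "R \<in> \<A>" using \<C>\<A> by blast
      then show "R \<subseteq> carrier G \<times> sphere 0 1" by (simp add: \<A>_def)
    qed
    ultimately show "\<Union>\<C> \<in> \<A>" unfolding \<A>_def by blast
  qed
  then obtain M where M: "M \<in> \<A>" and max: "\<And>R. R \<in> \<A> \<Longrightarrow> M \<subseteq> R \<Longrightarrow> R = M" by blast
  define D where "D = fst ` M"
  define \<psi> where "\<psi> x = (THE w. (x, w) \<in> M)" for x
  have sv: "single_valued M" and ME: "(\<lambda>x. (x, \<phi> x)) ` E \<subseteq> M" and Msub: "M \<subseteq> carrier G \<times> sphere 0 1"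
    using M by (auto simp: \<A>_def)
  have \<psi>: "\<psi> x = w" if "(x, w) \<in> M" for x w
    unfolding \<psi>_def using that sv by (auto intro!: the_equality dest: single_valuedD)
  have inM: "(x, \<psi> x) \<in> M" if "x \<in> D" for x using that \<psi> by (force simp: D_def)
  have multM: "(x \<otimes> y, \<psi> x * \<psi> y) \<in> M" if "x \<in> D" "y \<in> D" for x y
  proof -
    have "\<forall>p\<in>M. \<forall>q\<in>M. (fst p \<otimes> fst q, snd p * snd q) \<in> M" using M by (simp add: \<A>_def)
    then show ?thesis using inM[OF that(1)] inM[OF that(2)] by fastforce
  qed
  have invM: "(inv x, inverse (\<psi> x)) \<in> M" if "x \<in> D" for x
  proof -
    have "\<forall>p\<in>M. (inv (fst p), inverse (snd p)) \<in> M" using M by (simp add: \<A>_def)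
    then show ?thesis using inM[OF that] by fastforce
  qed
  have DI: "x \<in> D" if "(x, w) \<in> M" for x w using that by (force simp: D_def)
  have ED: "E \<subseteq> D" using ME DI by blast
  have \<psi>E: "\<psi> x = \<phi> x" if "x \<in> E" for x using ME that \<psi> by blast
  have D: "subgroup D G"
  proof (rule subgroupI)
    show "D \<subseteq> carrier G" using Msub by (auto simp: D_def)
    show "D \<noteq> {}" using ED subgroup.one_closed[OF E] by auto
    show "inv x \<in> D" if "x \<in> D" for x using invM[OF that] DI by blast
    show "x \<otimes> y \<in> D" if "x \<in> D" "y \<in> D" for x y using multM[OF that] DI by blast
  qed
  have char: "character_on G D \<psi>"
    unfolding character_on_def using multM \<psi> inM Msub by fastforce
  have "D = carrier G"
  proof (rule ccontr)
    assume "D \<noteq> carrier G"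
    then obtain a where a: "a \<in> carrier G" "a \<notin> D" using subgroup.subset[OF D] by blast
    \<comment> \<open>If no nontrivial power of \<open>a\<close> lies in \<open>D\<close>, every
      value is admissible and 1 is taken; otherwise divisibility provides an \<open>m\<close>-th
      root.\<close>
    obtain z where z: "cmod z = 1" "\<And>n::int. a [^] n \<in> D \<Longrightarrow> \<psi> (a [^] n) = z powi n"
    proof (rule int_pow_in_subgroup_cases[OF D a(1)])
      assume free: "\<And>n::int. a [^] n \<in> D \<Longrightarrow> n = 0"
      then show ?thesis using that[of 1] character_on_id[OF D char] by fastforce
    next
      fix m :: nat
      assume torsion: "m > 0" "\<And>n::int. a [^] n \<in> D \<longleftrightarrow> int m dvd n"
      have mD: "a [^] m \<in> D" using torsion(2)[of "int m"] by (simp add: int_pow_int)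
      obtain z where z: "cmod z = 1" "z ^ m = \<psi> (a [^] m)"
        using root_near_pi[of "\<psi> (a [^] m)" 1 m] torsion(1) character_on_norm[OF char mD] by auto
      then show ?thesis using character_on_torsion_pow[OF D char a(1) torsion] that by blast
    qed
    obtain D' \<psi>' where D': "subgroup D' G" "D \<subseteq> D'" "a \<in> D'" "character_on G D' \<psi>'"
      "\<And>x. x \<in> D \<Longrightarrow> \<psi>' x = \<psi> x"
      using character_extend_step[OF D char a(1) z] by metis
    have "(\<lambda>x. (x, \<psi>' x)) ` D' \<in> \<A>"
      using D' ED \<psi>E by (intro graph) auto
    moreover have "M \<subseteq> (\<lambda>x. (x, \<psi>' x)) ` D'"
    proof
      fix p assume p: "p \<in> M"
      obtain x w where "p = (x, w)" by fastforce
      then show "p \<in> (\<lambda>x. (x, \<psi>' x)) ` D'"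
        using p D'(2,5) DI[of x w] \<psi>[of x w] by (force simp: image_iff)
    qed
    ultimately have "(\<lambda>x. (x, \<psi>' x)) ` D' = M" by (rule max)
    then show False using a(2) D'(3) DI by blast
  qed
  with char \<psi>E show ?thesis using that by blast
qed

lemma character_extend_free:
  assumes E: "subgroup E G" and \<phi>: "character_on G E \<phi>" and a: "a \<in> carrier G"
    and free: "\<And>n::int. a [^] n \<in> E \<Longrightarrow> n = 0" and z: "cmod z = 1"
  obtains \<psi> where "character G \<psi>" "\<And>x. x \<in> E \<Longrightarrow> \<psi> x = \<phi> x" "\<psi> a = z"
proof -
  have "\<phi> (a [^] n) = z powi n" if "a [^] n \<in> E" for n :: int
    using free[OF that] character_on_id[OF E \<phi>] by simp
  then obtain D \<psi> where D: "subgroup D G" "E \<subseteq> D" "a \<in> D" "character_on G D \<psi>" "\<psi> a = z"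
    "\<And>x. x \<in> E \<Longrightarrow> \<psi> x = \<phi> x"
    using character_extend_step[OF E \<phi> a z] by metis
  obtain \<psi>' where "character G \<psi>'" "\<And>x. x \<in> D \<Longrightarrow> \<psi>' x = \<psi> x"
    using character_extend[OF D(1,4)] by metis
  then show ?thesis using that D by (metis subsetD)
qed

lemma character_extend_torsion:
  assumes E: "subgroup E G" and \<phi>: "character_on G E \<phi>" and a: "a \<in> carrier G"
    and m: "m > 0" "\<And>n::int. a [^] n \<in> E \<longleftrightarrow> int m dvd n" and z: "cmod z = 1" "z ^ m = \<phi> (a [^] m)"
  obtains \<psi> where "character G \<psi>" "\<And>x. x \<in> E \<Longrightarrow> \<psi> x = \<phi> x" "\<psi> a = z"
proof -
  obtain D \<psi> where D: "subgroup D G" "E \<subseteq> D" "a \<in> D" "character_on G D \<psi>" "\<psi> a = z"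
    "\<And>x. x \<in> E \<Longrightarrow> \<psi> x = \<phi> x"
    using character_extend_step[OF E \<phi> a z(1) character_on_torsion_pow[OF E \<phi> a m z(2)]] by metis
  obtain \<psi>' where "character G \<psi>'" "\<And>x. x \<in> D \<Longrightarrow> \<psi>' x = \<psi> x"
    using character_extend[OF D(1,4)] by metis
  then show ?thesis using that D by (metis subsetD)
qed

text \<open>
  If \<open>a\<close> has order \<open>m > N\<close> modulo \<open>E\<close>, its value is only constrained to be an \<open>m\<close>-th root of a
  given number, and these roots are dense up to \<open>pi / N\<close>.
\<close>

lemma character_extend_near:
  assumes E: "subgroup E G" and \<phi>: "character_on G E \<phi>" and a: "a \<in> carrier G"
    and N: "\<And>j::nat. 0 < j \<Longrightarrow> j \<le> N \<Longrightarrow> a [^] j \<notin> E" and t: "cmod t = 1" and e: "pi / e \<le> N" "e > 0"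
  obtains \<psi> where "character G \<psi>" "\<And>x. x \<in> E \<Longrightarrow> \<psi> x = \<phi> x" "near e (\<psi> a) t"
proof (rule int_pow_in_subgroup_cases[OF E a])
  assume free: "\<And>n::int. a [^] n \<in> E \<Longrightarrow> n = 0"
  show ?thesis
    using character_extend_free[OF E \<phi> a free t] that e(2) near_refl[of e t] by (metis less_imp_le)
next
  fix m :: nat
  assume torsion: "m > 0" "\<And>n::int. a [^] n \<in> E \<longleftrightarrow> int m dvd n"
  have mE: "a [^] m \<in> E" using torsion(2)[of "int m"] by (simp add: int_pow_int)
  then have "N < m" using N[of m] torsion(1) by (meson not_le)
  then have "pi / e \<le> real m" using e by linarith
  then have "pi / m \<le> e" using e torsion(1) by (simp add: field_simps)
  moreover obtain z where z: "cmod z = 1" "z ^ m = \<phi> (a [^] m)" "near (pi / m) z t"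
    using root_near_pi[OF character_on_norm[OF \<phi> mE] t] torsion(1) by blast
  ultimately have "near e z t" using near_mono by blast
  then show ?thesis
    using character_extend_torsion[OF E \<phi> a torsion z(1,2)] that by metis
qed

text \<open>The trivial character of \<open>E\<close> extends with any \<open>m\<close>-th root of 1
  as its value at \<open>a\<close>, where \<open>m\<close> is the order of \<open>a\<close> modulo
  \<open>E\<close>; since \<open>a \<notin> E\<close>, there is a root other than 1. If the order is
  infinite, the value -1 serves.\<close>

lemma character_separates:
  assumes E: "subgroup E G" and a: "a \<in> carrier G" "a \<notin> E"
  obtains \<psi> where "character G \<psi>" "\<And>x. x \<in> E \<Longrightarrow> \<psi> x = 1" "\<psi> a \<noteq> 1"
proof (rule int_pow_in_subgroup_cases[OF E a(1)])
  assume free: "\<And>n::int. a [^] n \<in> E \<Longrightarrow> n = 0"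
  show ?thesis
    using character_extend_free[OF E character_on_one a(1) free, of "-1"] that
    by (metis norm_minus_cancel norm_one one_neq_neg_one)
next
  fix m :: nat
  assume torsion: "m > 0" "\<And>n::int. a [^] n \<in> E \<longleftrightarrow> int m dvd n"
  have "m \<noteq> 1" using torsion(2)[of 1] a by auto
  then have m: "m > 1" using torsion(1) by simp
  have "cis (2 * pi / m) \<noteq> 1"
  proof
    assume "cis (2 * pi / m) = 1"
    then have "cos (2 * pi / m) = 1" by (simp add: complex_eq_iff)
    then obtain k :: int where "2 * pi / m = of_int k * 2 * pi" using cos_one_2pi_int by auto
    then have "1 = of_int k * real m" using m by (simp add: field_simps)
    then have "1 = k * int m" by (metis of_int_1 of_int_eq_iff of_int_mult of_int_of_nat_eq)
    then show False using m by (metis abs_of_nat less_irrefl of_nat_1 of_nat_less_iff zmult_eq_1_iff mult_minus1 neg_equal_iff_equal abs_minus abs_one)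
  qed
  moreover have "cis (2 * pi / m) ^ m = 1" using m by (simp add: Complex.DeMoivre)
  ultimately show ?thesis
    using character_extend_torsion[OF E character_on_one a(1) torsion, of "cis (2 * pi / m)"] that norm_cis by metis
qed

text \<open>On the internal direct product of \<open>E1\<close> and \<open>E2\<close>, the quotient
  of \<open>\<phi>2\<close> by \<open>\<phi>1\<close> evaluated at the \<open>E2\<close>-component
  is a character trivial on \<open>E1\<close>. An extension of it corrects \<open>\<phi>1\<close> on
  \<open>E2\<close> without changing it on \<open>E1\<close>.\<close>

lemma character_glue:
  assumes E: "subgroup E1 G" "subgroup E2 G" "E1 \<inter> E2 = {\<one>}" and \<phi>: "character G \<phi>1" "character G \<phi>2"
  obtains \<psi> where "character G \<psi>" "\<And>x. x \<in> E1 \<Longrightarrow> \<psi> x = \<phi>1 x" "\<And>x. x \<in> E2 \<Longrightarrow> \<psi> x = \<phi>2 x"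
proof -
  interpret E1: subgroup E1 G by fact
  interpret E2: subgroup E2 G by fact
  define \<xi> where "\<xi> x = \<phi>2 x * inverse (\<phi>1 x)" for x
  have \<xi>: "character G \<xi>"
    unfolding \<xi>_def using \<phi> by (intro character_on_times character_on_inverse)
  define D where "D = {x \<otimes> y | x y. x \<in> E1 \<and> y \<in> E2}"
  \<comment> \<open>Equality of the products puts \<open>y' \<otimes> inv y\<close> into both
    subgroups.\<close>
  have wd: "\<xi> y = \<xi> y'" if "x \<in> E1" "x' \<in> E1" "y \<in> E2" "y' \<in> E2" "x \<otimes> y = x' \<otimes> y'" for x x' y y'
  proof -
    have "inv x' \<otimes> x = y' \<otimes> inv y"
    proof -
      have "inv x' \<otimes> x = inv x' \<otimes> (x \<otimes> y) \<otimes> inv y" using that(1-4) by (simp add: m_assoc)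
      also have "\<dots> = y' \<otimes> inv y" using that(1-4) unfolding that(5) by (simp add: m_assoc[symmetric])
      finally show ?thesis .
    qed
    moreover have "inv x' \<otimes> x \<in> E1" "y' \<otimes> inv y \<in> E2" using that by auto
    ultimately have "y' \<otimes> inv y = \<one>" using E(3) by auto
    then have "y' = y" using that(3,4) by (metis E2.mem_carrier inv_equality inv_inv E2.m_inv_closed)
    then show ?thesis by simp
  qed
  define \<eta> where "\<eta> g = (THE w. \<exists>x\<in>E1. \<exists>y\<in>E2. g = x \<otimes> y \<and> w = \<xi> y)" for g
  have \<eta>: "\<eta> (x \<otimes> y) = \<xi> y" if "x \<in> E1" "y \<in> E2" for x y
    unfolding \<eta>_def
  proof (rule the_equality)
    show "\<exists>x'\<in>E1. \<exists>y'\<in>E2. x \<otimes> y = x' \<otimes> y' \<and> \<xi> y = \<xi> y'" using that by blast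
    show "w = \<xi> y" if "\<exists>x'\<in>E1. \<exists>y'\<in>E2. x \<otimes> y = x' \<otimes> y' \<and> w = \<xi> y'" for w
      using that wd \<open>x \<in> E1\<close> \<open>y \<in> E2\<close> by metis
  qed
  have mult: "(x \<otimes> y) \<otimes> (x' \<otimes> y') = (x \<otimes> x') \<otimes> (y \<otimes> y')"
    if "x \<in> E1" "x' \<in> E1" "y \<in> E2" "y' \<in> E2" for x x' y y'
    using that by (simp add: m_ac)
  have D: "subgroup D G"
  proof (rule subgroupI)
    show "D \<subseteq> carrier G" by (auto simp: D_def)
    show "D \<noteq> {}" using E1.one_closed E2.one_closed unfolding D_def by blast
    fix g assume "g \<in> D"
    then obtain x y where g: "x \<in> E1" "y \<in> E2" "g = x \<otimes> y" by (auto simp: D_def)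
    then have "inv g = inv x \<otimes> inv y" by (simp add: inv_mult)
    then show "inv g \<in> D" using g E1.m_inv_closed E2.m_inv_closed unfolding D_def by blast
    fix h assume "h \<in> D"
    then obtain x' y' where h: "x' \<in> E1" "y' \<in> E2" "h = x' \<otimes> y'" by (auto simp: D_def)
    then have "g \<otimes> h = (x \<otimes> x') \<otimes> (y \<otimes> y')" using g mult by simp
    then show "g \<otimes> h \<in> D" using g h E1.m_closed E2.m_closed unfolding D_def by blast
  qed
  have "character_on G D \<eta>"
    unfolding character_on_def
  proof (intro conjI ballI)
    fix g assume "g \<in> D"
    then obtain x y where g: "x \<in> E1" "y \<in> E2" "g = x \<otimes> y" by (auto simp: D_def)
    then show "cmod (\<eta> g) = 1" using \<eta> character_on_norm[OF \<xi>] by simp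
    fix h assume "h \<in> D"
    then obtain x' y' where h: "x' \<in> E1" "y' \<in> E2" "h = x' \<otimes> y'" by (auto simp: D_def)
    show "\<eta> (g \<otimes> h) = \<eta> g * \<eta> h"
      using g h mult \<eta> character_on_mult[OF \<xi>] by simp
  qed
  then obtain \<zeta> where \<zeta>: "character G \<zeta>" "\<And>g. g \<in> D \<Longrightarrow> \<zeta> g = \<eta> g"
    using character_extend[OF D] by metis
  have z1: "\<zeta> x = 1" if "x \<in> E1" for x
  proof -
    have "x = x \<otimes> \<one>" using that by simp
    then have "x \<in> D" using that E2.one_closed unfolding D_def by blast
    then show ?thesis
      using \<zeta>(2) \<eta>[OF that E2.one_closed] that character_on_id[OF subgroup_self \<xi>] by simp
  qed
  have z2: "\<zeta> x = \<xi> x" if "x \<in> E2" for x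
  proof -
    have "x = \<one> \<otimes> x" using that by simp
    then have "x \<in> D" using that E1.one_closed unfolding D_def by blast
    then show ?thesis using \<zeta>(2) \<eta>[OF E1.one_closed that] that by simp
  qed
  show ?thesis
  proof (rule that[of "\<lambda>x. \<phi>1 x * \<zeta> x"])
    show "character G (\<lambda>x. \<phi>1 x * \<zeta> x)" using \<phi> \<zeta> by (intro character_on_times)
    show "\<phi>1 x * \<zeta> x = \<phi>1 x" if "x \<in> E1" for x using z1[OF that] by simp
    show "\<phi>1 x * \<zeta> x = \<phi>2 x" if "x \<in> E2" for x
      using z2[OF that] that character_on_nonzero[OF \<phi>(1)] by (simp add: \<xi>_def)
  qed
qed

text \<open>By Tychonoff's theorem a power of the circle is compact, and multiplicativity, like each
  prescription, is a closed condition on its points; so the finite intersection property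
  suffices.\<close>

lemma character_compactness:
  assumes cl: "\<And>x V. (x, V) \<in> \<C> \<Longrightarrow> x \<in> carrier G \<and> closed V"
    and fin: "\<And>\<F>. finite \<F> \<Longrightarrow> \<F> \<subseteq> \<C> \<Longrightarrow> \<exists>\<phi>. character G \<phi> \<and> (\<forall>(x, V)\<in>\<F>. \<phi> x \<in> V)"
  obtains \<phi> where "character G \<phi>" "\<And>x V. (x, V) \<in> \<C> \<Longrightarrow> \<phi> x \<in> V"
proof -
  define X :: "('a \<Rightarrow> complex) topology" where
    "X = product_topology (\<lambda>_. top_of_set (sphere 0 1)) (carrier G)"
  have top: "topspace X = carrier G \<rightarrow>\<^sub>E sphere 0 1" by (simp add: X_def)
  have "compact_space X"
    unfolding X_def by (simp add: compact_space_product_topology compact_space_subtopology)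
  then have comp: "compactin X (topspace X)" by (simp add: compact_space_def)
  have cont: "continuous_map X euclidean (\<lambda>f. f x)" if "x \<in> carrier G" for x
    using continuous_map_product_projection[OF that, of "\<lambda>_. top_of_set (sphere 0 1) :: complex topology"]
    by (simp add: X_def continuous_map_in_subtopology)
  define A where "A p = {f \<in> topspace X. f (fst p) \<in> snd p}" for p :: "'a \<times> complex set"
  define B where "B p = {f \<in> topspace X. f (fst p \<otimes> snd p) = f (fst p) * f (snd p)}" for p
  let ?U = "A ` \<C> \<union> B ` (carrier G \<times> carrier G)"
  have "topspace X \<inter> \<Inter>?U \<noteq> {}"
  proof (rule comp[unfolded compactin_fip, THEN conjunct2, rule_format], intro conjI ballI allI impI)
    fix C assume "C \<in> ?U"
    then consider p where "p \<in> \<C>" "C = A p" | p where "p \<in> carrier G \<times> carrier G" "C = B p" by blast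
    then show "closedin X C"
    proof cases
      case 1
      then show ?thesis unfolding A_def using cl[of "fst p" "snd p"]
        by (auto intro!: closedin_continuous_map_preimage[OF cont])
    next
      case 2
      then show ?thesis unfolding B_def
        by (auto intro!: closedin_continuous_maps_eq[where Y = euclidean] continuous_map_normed_mult cont)
    qed
  next
    fix \<F> assume "finite \<F> \<and> \<F> \<subseteq> ?U"
    then have F: "finite (\<F> \<inter> A ` \<C>)" "\<F> \<subseteq> ?U" by auto
    \<comment> \<open>Only the prescriptions occurring in \<open>\<F>\<close> restrict the choice;
      the multiplicativity conditions hold for every character.\<close>
    then obtain \<D> where D: "\<D> \<subseteq> \<C>" "finite \<D>" "\<F> \<inter> A ` \<C> = A ` \<D>"
      by (meson finite_subset_image inf_le2)
    obtain \<phi> where \<phi>: "character G \<phi>" "\<forall>(x, V)\<in>\<D>. \<phi> x \<in> V" using fin[OF D(2,1)] by blast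
    define f where "f = restrict \<phi> (carrier G)"
    have f: "f \<in> topspace X" using character_on_norm[OF \<phi>(1)] by (auto simp: f_def top)
    have fA: "f \<in> A p" if "p \<in> \<D>" for p
      using that f \<phi>(2) D(1) cl[of "fst p" "snd p"] by (auto simp: A_def f_def)
    have fB: "f \<in> B p" if "p \<in> carrier G \<times> carrier G" for p
      using that f character_on_mult[OF \<phi>(1)] by (auto simp: B_def f_def)
    have "f \<in> C" if C: "C \<in> \<F>" for C
      using subsetD[OF F(2) C]
    proof (rule UnE)
      assume "C \<in> A ` \<C>"
      then have "C \<in> A ` \<D>" using C D(3) by blast
      then show ?thesis using fA by auto
    next
      assume "C \<in> B ` (carrier G \<times> carrier G)"
      then show ?thesis using fB by auto
    qed
    then have "f \<in> topspace X \<inter> \<Inter>\<F>" using f by blast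
    then show "topspace X \<inter> \<Inter>\<F> \<noteq> {}" by blast
  qed
  then obtain f where "f \<in> topspace X \<inter> \<Inter>?U" by (meson ex_in_conv)
  then have f: "f \<in> topspace X" "\<And>p. p \<in> \<C> \<Longrightarrow> f \<in> A p"
    "\<And>p. p \<in> carrier G \<times> carrier G \<Longrightarrow> f \<in> B p" by auto
  show ?thesis
  proof (rule that)
    show "character G f"
      unfolding character_on_def
    proof (intro conjI ballI)
      fix x y assume "x \<in> carrier G" "y \<in> carrier G"
      then show "f (x \<otimes> y) = f x * f y" using f(3)[of "(x, y)"] by (simp add: B_def)
    next
      fix x assume "x \<in> carrier G"
      then show "cmod (f x) = 1" using f(1) PiE_mem[of f "carrier G" "\<lambda>_. sphere 0 1" x] by (simp add: top)
    qed
    show "f x \<in> V" if "(x, V) \<in> \<C>" for x V using f(2)[OF that] by (simp add: A_def)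
  qed
qed

end

section \<open>Dense families and separation of points\<close>

text \<open>One element of the symmetric difference of \<open>\<kappa> x\<close> and
  \<open>\<kappa> y\<close> for each pair of distinct points of \<open>F\<close> is enough.\<close>

lemma finite_trace_inj:
  assumes "finite F" "inj_on \<kappa> F" "\<And>x. x \<in> F \<Longrightarrow> \<kappa> x \<subseteq> A"
  obtains W where "finite W" "W \<subseteq> A" "inj_on (\<lambda>x. \<kappa> x \<inter> W) F"
proof -
  have "\<exists>c. c \<in> (\<kappa> x - \<kappa> y) \<union> (\<kappa> y - \<kappa> x)" if "x \<in> F" "y \<in> F" "x \<noteq> y" for x y
    using that assms(2) by (auto simp: inj_on_def)
  then obtain c where c: "\<And>x y. x \<in> F \<Longrightarrow> y \<in> F \<Longrightarrow> x \<noteq> y \<Longrightarrow> c x y \<in> (\<kappa> x - \<kappa> y) \<union> (\<kappa> y - \<kappa> x)"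
    by metis
  define W where "W = {c x y | x y. x \<in> F \<and> y \<in> F \<and> x \<noteq> y}"
  have "W \<subseteq> (\<lambda>(x, y). c x y) ` (F \<times> F)" by (auto simp: W_def)
  then have "finite W" using assms(1) by (meson finite_SigmaI finite_imageI finite_subset)
  moreover have "W \<subseteq> A"
  proof
    fix w assume "w \<in> W"
    then obtain x y where "x \<in> F" "y \<in> F" "x \<noteq> y" "w = c x y" by (auto simp: W_def)
    then show "w \<in> A" using c[of x y] assms(3)[of x] assms(3)[of y] by blast
  qed
  moreover have "inj_on (\<lambda>x. \<kappa> x \<inter> W) F"
  proof (rule inj_onI, rule ccontr)
    fix x y assume xy: "x \<in> F" "y \<in> F" "\<kappa> x \<inter> W = \<kappa> y \<inter> W" "x \<noteq> y"
    then have "c x y \<in> W" by (auto simp: W_def)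
    then show False using c[of x y] xy by blast
  qed
  ultimately show ?thesis using that by blast
qed

lemma countable_ordLeq_infinite:
  assumes "countable B" "infinite A"
  shows "|B| \<le>o |A|"
proof -
  have "|B| \<le>o |UNIV :: nat set|" using assms(1) by (auto simp: countable_def card_of_ordLeq[symmetric])
  moreover have "|UNIV :: nat set| \<le>o |A|" using assms(2) infinite_iff_card_of_nat by blast
  ultimately show ?thesis by (rule ordLeq_transitive)
qed

lemma Times_ordLeq_infinite:
  assumes "|B| \<le>o |A|" "|C| \<le>o |A|" "infinite A"
  shows "|B \<times> C| \<le>o |A|"
  using assms by (intro card_of_Times_ordLeq_infinite_Field) (auto simp: Field_card_of card_of_Card_order)

lemma lists_ordLeq_infinite:
  assumes "|B| \<le>o |A|" "infinite A"
  shows "|lists B| \<le>o |A|"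
proof -
  obtain f where f: "inj_on f B" "f ` B \<subseteq> A" using assms(1) card_of_ordLeq by metis
  have "inj_on (map f) (lists B)" using f(1) by (auto intro!: inj_onI dest: map_inj_on simp: inj_on_Un inj_on_def list.inj_map_strong)
  moreover have "map f ` lists B \<subseteq> lists A" using f(2) by fastforce
  ultimately have "|lists B| \<le>o |lists A|" using card_of_ordLeq by blast
  moreover have "|lists A| =o |A|" using assms(2) by (rule card_of_lists_infinite)
  ultimately show ?thesis by (rule ordLeq_ordIso_trans)
qed

text \<open>
  The argument of Hewitt, Marczewski and Pondiczery: identify \<open>X\<close> with a family of subsets of \<open>A\<close>;
  the functions which depend only on the trace on a finite subset of \<open>A\<close> and take rational angles
  form a dense set of size \<open>|A|\<close>.
\<close>

lemma dense_circle_family: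
  fixes X :: "'x set" and A :: "'t set"
  assumes A: "infinite A" and X: "|X| \<le>o |Pow A|"
  obtains t :: "'t \<Rightarrow> 'x \<Rightarrow> complex" where "\<And>i x. cmod (t i x) = 1"
    "\<And>F v e. finite F \<Longrightarrow> F \<subseteq> X \<Longrightarrow> (\<And>x. x \<in> F \<Longrightarrow> cmod (v x) = 1) \<Longrightarrow> e > 0
      \<Longrightarrow> \<exists>i\<in>A. \<forall>x\<in>F. near e (t i x) (v x)"
proof -
  obtain \<kappa> where \<kappa>: "inj_on \<kappa> X" "\<kappa> ` X \<subseteq> Pow A" using X card_of_ordLeq by metis
  \<comment> \<open>A code consists of a finite set \<open>W\<close> and a finite table assigning
    rational angles to traces on \<open>W\<close>.\<close>
  define Q where "Q = Fpow A \<times> lists (Fpow A \<times> (UNIV :: rat set))"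
  have Fp: "|Fpow A| \<le>o |A|" using A by (simp add: card_of_Fpow_infinite ordIso_imp_ordLeq)
  have "|UNIV :: rat set| \<le>o |A|" using A by (intro countable_ordLeq_infinite) auto
  then have "|Q| \<le>o |A|"
    unfolding Q_def using A Fp by (intro Times_ordLeq_infinite lists_ordLeq_infinite)
  moreover have "Q \<noteq> {}" by (auto simp: Q_def Fpow_def)
  ultimately obtain q where q: "q ` A = Q" using card_of_ordLeq2 by metis
  \<comment> \<open>A trace missing from the table receives the value 1, which keeps all values on
    the circle.\<close>
  define t where "t i x = (case q i of (W, l) \<Rightarrow>
    (case map_of l (\<kappa> x \<inter> W) of None \<Rightarrow> 1 | Some r \<Rightarrow> cis (of_rat r)))" for i x
  show ?thesis
  proof (rule that)
    show "cmod (t i x) = 1" for i x by (auto simp: t_def split: prod.split option.split)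
    fix F v and e :: real
    assume F: "finite F" "F \<subseteq> X" and v: "\<And>x. x \<in> F \<Longrightarrow> cmod (v x) = 1" and e: "e > 0"
    obtain W where W: "finite W" "W \<subseteq> A" "inj_on (\<lambda>x. \<kappa> x \<inter> W) F"
    proof (rule finite_trace_inj[of F \<kappa> A])
      show "finite F" "inj_on \<kappa> F" using F \<kappa>(1) inj_on_subset by blast+
      show "\<kappa> x \<subseteq> A" if "x \<in> F" for x using that F(2) \<kappa>(2) by blast
    qed
    have "\<exists>r. near e (cis (of_rat r)) (v x)" if x: "x \<in> F" for x
    proof -
      obtain \<theta> where \<theta>: "v x = cis \<theta>" using circle_cis[OF v[OF x]] by metis
      obtain r where r: "\<theta> < of_rat r" "of_rat r < \<theta> + e" using of_rat_dense[of \<theta> "\<theta> + e"] e by auto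
      have "near e (cis (of_rat r)) (v x)"
        unfolding near_def \<theta> by (rule exI[of _ "of_rat r - \<theta>"]) (use r in \<open>auto simp: cis_mult\<close>)
      then show ?thesis by blast
    qed
    then obtain r where r: "\<And>x. x \<in> F \<Longrightarrow> near e (cis (of_rat (r x))) (v x)" by metis
    obtain xs where xs: "set xs = F" using F(1) finite_list by blast
    define l where "l = map (\<lambda>x. (\<kappa> x \<inter> W, r x)) xs"
    have "l \<in> lists (Fpow A \<times> UNIV)" using W by (auto simp: l_def Fpow_def)
    then have "(W, l) \<in> Q" using W by (auto simp: Q_def Fpow_def)
    then obtain i where i: "i \<in> A" "q i = (W, l)" using q by (metis imageE)
    \<comment> \<open>By the choice of \<open>W\<close> distinct points of \<open>F\<close> have
      distinct keys, so the entry found for \<open>x\<close> is its own.\<close>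
    have "map_of l (\<kappa> x \<inter> W) = Some (r x)" if "x \<in> F" for x
    proof -
      have "\<exists>r'. map_of l (\<kappa> x \<inter> W) = Some r'"
        using that xs by (auto simp: l_def map_of_eq_None_iff image_image simp flip: not_None_eq)
      then obtain r' where r': "map_of l (\<kappa> x \<inter> W) = Some r'" by blast
      then have "(\<kappa> x \<inter> W, r') \<in> set l" by (rule map_of_SomeD)
      then obtain y where "y \<in> F" "\<kappa> x \<inter> W = \<kappa> y \<inter> W" "r' = r y" using xs by (auto simp: l_def)
      then show ?thesis using W(3) that r' by (auto dest: inj_onD)
    qed
    then have "\<forall>x\<in>F. near e (t i x) (v x)" using r i by (simp add: t_def)
    then show "\<exists>i\<in>A. \<forall>x\<in>F. near e (t i x) (v x)" using i by blast
  qed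
qed

section \<open>Generated subgroups and independent subsets\<close>

context comm_group
begin

lemma generate_finite_subset:
  assumes "x \<in> generate G A"
  obtains F where "finite F" "F \<subseteq> A" "x \<in> generate G F"
proof -
  from assms have "\<exists>F. finite F \<and> F \<subseteq> A \<and> x \<in> generate G F"
  proof induction
    case one
    then show ?case by (intro exI[of _ "{}"]) (auto intro: generate.one)
  next
    case (incl h)
    then show ?case by (intro exI[of _ "{h}"]) (auto intro: generate.incl)
  next
    case (inv h)
    then show ?case by (intro exI[of _ "{h}"]) (auto intro: generate.inv)
  next
    case (eng h1 h2)
    then obtain F1 F2 where F: "finite F1" "F1 \<subseteq> A" "h1 \<in> generate G F1"
      "finite F2" "F2 \<subseteq> A" "h2 \<in> generate G F2" by blast
    then have "h1 \<in> generate G (F1 \<union> F2)" "h2 \<in> generate G (F1 \<union> F2)"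
      using mono_generate[of F1 "F1 \<union> F2"] mono_generate[of F2 "F1 \<union> F2"] by blast+
    then show ?case using F by (intro exI[of _ "F1 \<union> F2"]) (auto intro: generate.eng)
  qed
  then show ?thesis using that by blast
qed

lemma generate_insertE:
  assumes "A \<subseteq> carrier G" "b \<in> carrier G" "x \<in> generate G (insert b A)"
  obtains n :: int and e where "e \<in> generate G A" "x = b [^] n \<otimes> e"
proof -
  have gA: "subgroup (generate G A) G" using assms(1) by (rule generate_is_subgroup)
  interpret A: subgroup "generate G A" G by (rule gA)
  let ?D = "{b [^] n \<otimes> e | (n::int) e. e \<in> generate G A}"
  have "subgroup ?D G"
  proof (rule subgroupI)
    show "?D \<subseteq> carrier G" using assms(2) A.subset by auto
    show "?D \<noteq> {}" using A.one_closed by blast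
    fix x assume "x \<in> ?D"
    then obtain n :: int and e where x: "e \<in> generate G A" "x = b [^] n \<otimes> e" by blast
    have "inv x = b [^] (- n) \<otimes> inv e" using x assms(2) by (simp add: inv_mult int_pow_neg)
    then show "inv x \<in> ?D" using x A.m_inv_closed by blast
    fix y assume "y \<in> ?D"
    then obtain m :: int and f where y: "f \<in> generate G A" "y = b [^] m \<otimes> f" by blast
    have "x \<otimes> y = b [^] (n + m) \<otimes> (e \<otimes> f)" using x y assms(2) by (simp add: int_pow_mult m_ac)
    then show "x \<otimes> y \<in> ?D" using x y A.m_closed by blast
  qed
  moreover have "insert b A \<subseteq> ?D"
  proof
    fix a assume "a \<in> insert b A"
    then consider "a = b" | "a \<in> A" by blast
    then show "a \<in> ?D"
    proof cases
      case 1
      then have "a = b [^] (1::int) \<otimes> \<one>" using assms(2) by simp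
      then show ?thesis using A.one_closed by blast
    next
      case 2
      then have "a = b [^] (0::int) \<otimes> a" "a \<in> generate G A" using assms(1) by (auto intro: generate.incl)
      then show ?thesis by blast
    qed
  qed
  ultimately have "x \<in> ?D" using generate_subgroup_incl assms(3) by blast
  then show ?thesis using that by blast
qed

text \<open>Every element of the generated subgroup is the value of a word, a list of letters from
  \<open>A\<close> with signs, where \<open>False\<close> marks an inverse; there are at most
  \<open>|Y|\<close> words.\<close>

lemma card_of_generate:
  fixes Y :: "'y set"
  assumes A: "A \<subseteq> carrier G" and "|A| \<le>o |Y|" "infinite Y"
  shows "|generate G A| \<le>o |Y|"
proof -
  let ?L = "lists (A \<times> (UNIV :: bool set))"
  define val where "val = (\<lambda>l. foldr (\<lambda>(a, s) x. (if s then a else inv a) \<otimes> x) l \<one>)"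
  have val [simp]: "val [] = \<one>" "\<And>a s l. val ((a, s) # l) = (if s then a else inv a) \<otimes> val l"
    by (simp_all add: val_def)
  have closed: "val l \<in> carrier G" if "l \<in> ?L" for l
    using that A by (induction l) auto
  have app: "val (l @ l') = val l \<otimes> val l'" if "l \<in> ?L" "l' \<in> ?L" for l l'
    using that(1)
  proof (induction l)
    case (Cons p l)
    then show ?case using A closed that(2) by (cases p) (auto simp: m_assoc subset_iff)
  qed (use closed that(2) in simp)
  have "generate G A \<subseteq> val ` ?L"
  proof
    fix x assume "x \<in> generate G A"
    then show "x \<in> val ` ?L"
    proof induction
      case one
      then show ?case by (intro image_eqI[of _ _ "[]"]) auto
    next
      case (incl h)
      then show ?case using A by (intro image_eqI[of _ _ "[(h, True)]"]) auto
    next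
      case (inv h)
      then show ?case using A by (intro image_eqI[of _ _ "[(h, False)]"]) auto
    next
      case (eng h1 h2)
      then obtain l l' where l: "l \<in> ?L" "h1 = val l" "l' \<in> ?L" "h2 = val l'" by blast
      then have "h1 \<otimes> h2 = val (l @ l')" using app by simp
      moreover have "l @ l' \<in> ?L" using l by auto
      ultimately show ?case by blast
    qed
  qed
  then have "|generate G A| \<le>o |?L|" by (rule surj_imp_ordLeq)
  moreover have "|UNIV :: bool set| \<le>o |Y|" using assms(3) by (intro countable_ordLeq_infinite) auto
  then have "|?L| \<le>o |Y|" using assms by (intro lists_ordLeq_infinite Times_ordLeq_infinite)
  ultimately show ?thesis by (rule ordLeq_transitive)
qed

text \<open>The cyclic subgroups generated by the elements of \<open>B\<close> form a direct sum.
  Torsion elements are allowed, so a maximal independent set accounts for the torsion of the group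
  as well.\<close>

definition independent :: "'a set \<Rightarrow> bool" where
  "independent B \<longleftrightarrow> B \<subseteq> carrier G \<and>
     (\<forall>b\<in>B. b \<noteq> \<one> \<and> generate G {b} \<inter> generate G (B - {b}) = {\<one>})"

lemma int_pow_in_generate: "b \<in> A \<Longrightarrow> A \<subseteq> carrier G \<Longrightarrow> b [^] (n::int) \<in> generate G A"
  using subgroup_int_pow_closed[OF generate_is_subgroup] generate.incl by metis

lemma one_Int_generate: "generate G A \<inter> generate G B = {\<one>} \<longleftrightarrow> generate G A \<inter> generate G B \<subseteq> {\<one>}"
  using generate.one by auto

text \<open>Otherwise \<open>g\<close> could be added to \<open>B\<close>. The subgroup generated by
  \<open>B\<close> is thus essential: characters that detect its nontrivial elements detect all
  nontrivial elements of \<open>G\<close>.\<close>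

lemma maximal_independent_meets:
  assumes B: "independent B" and max: "\<And>C. independent C \<Longrightarrow> B \<subseteq> C \<Longrightarrow> C = B"
    and g: "g \<in> carrier G" "g \<noteq> \<one>"
  obtains n :: int where "g [^] n \<in> generate G B" "g [^] n \<noteq> \<one>"
proof -
  have Bc: "B \<subseteq> carrier G" using B by (simp add: independent_def)
  have "\<exists>n::int. g [^] n \<in> generate G B \<and> g [^] n \<noteq> \<one>"
  proof (rule ccontr)
    assume "\<not> ?thesis"
    then have no: "g [^] n = \<one>" if "g [^] n \<in> generate G B" for n :: int using that by blast
    have gB: "g \<notin> B"
    proof
      assume "g \<in> B"
      then show False using no[of 1] g generate.incl[of g B G] by simp
    qed
    have "independent (insert g B)"
      unfolding independent_def one_Int_generate
    proof (intro conjI ballI)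
      show "insert g B \<subseteq> carrier G" using g Bc by simp
      fix b assume b: "b \<in> insert g B"
      then show "b \<noteq> \<one>" using g B by (auto simp: independent_def)
      have bc: "b \<in> carrier G" using b g Bc by auto
      show "generate G {b} \<inter> generate G (insert g B - {b}) \<subseteq> {\<one>}"
      proof
        fix x assume x: "x \<in> generate G {b} \<inter> generate G (insert g B - {b})"
        then obtain m :: int where m: "x = b [^] m" using generate_pow[OF bc] by blast
        show "x \<in> {\<one>}"
        proof (cases "b = g")
          case True
          then have "insert g B - {b} = B" using gB by auto
          then show ?thesis using x m no True by auto
        next
          case False
          then have bB: "b \<in> B" using b by simp
          \<comment> \<open>A relation between an old element \<open>b\<close> and \<open>g\<close>
            puts a power of \<open>g\<close> into the subgroup generated by \<open>B\<close>; that
            power is \<open>\<one>\<close>, and what remains is a relation within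
            \<open>B\<close>.\<close>
          have "x \<in> generate G (insert g (B - {b}))" using x False by (simp add: insert_Diff_if)
          then obtain n :: int and e where e: "e \<in> generate G (B - {b})" "x = g [^] n \<otimes> e"
            using generate_insertE[of "B - {b}" g x] Bc g by (metis Diff_subset order_trans)
          have ec: "e \<in> carrier G" "e \<in> generate G B"
            using e(1) generate_in_carrier[of "B - {b}" e] mono_generate[of "B - {b}" B] Bc by auto
          have "b [^] m \<in> generate G B" using int_pow_in_generate[OF bB Bc] .
          then have "b [^] m \<otimes> inv e \<in> generate G B"
            using ec Bc generate_m_inv_closed generate.eng by metis
          moreover have "b [^] m \<otimes> inv e = g [^] n"
            using e(2) m ec g by (simp add: m_assoc)
          ultimately have "g [^] n = \<one>" using no by metis
          then have "x = e" using e(2) ec by simp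
          then have "x \<in> generate G {b} \<inter> generate G (B - {b})" using x e by simp
          then show ?thesis using B bB by (auto simp: independent_def)
        qed
      qed
    qed
    then have "insert g B = B" using max by blast
    then show False using gB by blast
  qed
  then show ?thesis using that by blast
qed

text \<open>Independence is of finite character: a relation involves finitely many elements, and
  these lie in a single member of the chain.\<close>

lemma maximal_independent_exists:
  obtains B where "independent B" "\<And>C. independent C \<Longrightarrow> B \<subseteq> C \<Longrightarrow> C = B"
proof -
  have "\<exists>M\<in>Collect independent. \<forall>X\<in>Collect independent. M \<subseteq> X \<longrightarrow> X = M"
  proof (rule subset_Zorn_nonempty)
    have "independent {}" by (simp add: independent_def)
    then show "Collect independent \<noteq> {}" by blast
    fix \<C> assume \<C>: "\<C> \<noteq> {}" "subset.chain (Collect independent) \<C>"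
    have ind: "independent B" if "B \<in> \<C>" for B using that \<C>(2) by (auto simp: subset_chain_def)
    have "independent (\<Union>\<C>)"
      unfolding independent_def one_Int_generate
    proof (intro conjI ballI)
      show "\<Union>\<C> \<subseteq> carrier G" using ind unfolding independent_def by blast
      fix b assume b: "b \<in> \<Union>\<C>"
      then show "b \<noteq> \<one>" using ind unfolding independent_def by blast
      show "generate G {b} \<inter> generate G (\<Union>\<C> - {b}) \<subseteq> {\<one>}"
      proof
        fix x assume x: "x \<in> generate G {b} \<inter> generate G (\<Union>\<C> - {b})"
        then have "x \<in> generate G (\<Union>\<C> - {b})" by blast
        then obtain F where F: "finite F" "F \<subseteq> \<Union>\<C> - {b}" "x \<in> generate G F"
          by (rule generate_finite_subset)
        then have "finite (insert b F)" "insert b F \<subseteq> \<Union>\<C>" using b by auto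
        then obtain B where B: "B \<in> \<C>" "insert b F \<subseteq> B"
          using finite_subset_Union_chain \<C> by metis
        have "x \<in> generate G (B - {b})"
          using F(2,3) B(2) mono_generate[of F "B - {b}"] by blast
        then show "x \<in> {\<one>}" using ind[OF B(1)] B(2) x by (auto simp: independent_def)
      qed
    qed
    then show "\<Union>\<C> \<in> Collect independent" by simp
  qed
  then show ?thesis using that by auto
qed

text \<open>The factor at \<open>b\<close> really contributes to \<open>x\<close>, so a character
  trivial on the other generators can detect \<open>x\<close> through it.\<close>

lemma generate_split_off:
  assumes "finite F" "F \<subseteq> carrier G" "x \<in> generate G F" "x \<noteq> \<one>"
  obtains b n e where "b \<in> F" "b [^] (n::int) \<noteq> \<one>" "e \<in> generate G (F - {b})" "x = b [^] n \<otimes> e"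
proof -
  from assms have "\<exists>b n e. b \<in> F \<and> b [^] (n::int) \<noteq> \<one> \<and> e \<in> generate G (F - {b}) \<and> x = b [^] n \<otimes> e"
  proof (induction F)
    case empty
    then show ?case by (simp add: generate_empty)
  next
    case (insert a F)
    then obtain n :: int and e where e: "e \<in> generate G F" "x = a [^] n \<otimes> e"
      using generate_insertE[of F a x] by (metis insert_subset)
    show ?case
    proof (cases "a [^] n = \<one>")
      case False
      then show ?thesis using e insert by (intro exI[of _ a] exI[of _ n] exI[of _ e]) auto
    next
      case True
      then have "x \<in> generate G F" using e generate_in_carrier[of F e] insert.prems by simp
      then obtain b m f where b: "b \<in> F" "b [^] (m::int) \<noteq> \<one>" "f \<in> generate G (F - {b})" "x = b [^] m \<otimes> f"
        using insert by blast
      then have "f \<in> generate G (insert a F - {b})"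
        using mono_generate[of "F - {b}" "insert a F - {b}"] by blast
      then show ?thesis using b by (intro exI[of _ b] exI[of _ m] exI[of _ f]) auto
    qed
  qed
  then show ?thesis using that by blast
qed

text \<open>
  For each \<open>i\<close> the sign of \<open>Re (t i b)\<close> selects a subset of a maximal independent set \<open>B\<close>; some \<open>i\<close>
  isolates a given element of \<open>B\<close> inside a given finite subset. This is why \<open>\<Lambda>\<close>-many subsets suffice
  although \<open>B\<close> may have \<open>2^|\<Lambda>|\<close> elements. The index \<open>k\<close> of the characters serves to detect \<open>b^k\<close>.
\<close>

theorem separating_characters:
  fixes \<Lambda> :: "'l set"
  assumes \<Lambda>: "infinite \<Lambda>" and card: "|carrier G| \<le>o |Pow \<Lambda>|"
  obtains \<psi> :: "'l \<Rightarrow> nat \<Rightarrow> 'a \<Rightarrow> complex" where "\<And>i k. character G (\<psi> i k)"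
    "\<And>g. g \<in> carrier G \<Longrightarrow> g \<noteq> \<one> \<Longrightarrow> \<exists>i\<in>\<Lambda>. \<exists>k. \<psi> i k g \<noteq> 1"
proof -
  obtain B where B: "independent B" and max: "\<And>C. independent C \<Longrightarrow> B \<subseteq> C \<Longrightarrow> C = B"
    using maximal_independent_exists by metis
  have Bc: "B \<subseteq> carrier G" using B by (simp add: independent_def)
  \<comment> \<open>By independence a power of \<open>b\<close> other than \<open>\<one>\<close>
    lies outside \<open>generate G (B - {b})\<close> and can be separated from it.\<close>
  have "\<exists>\<theta>. character G \<theta> \<and> (\<forall>x\<in>generate G (B - {b}). \<theta> x = 1) \<and> (b [^] k \<noteq> \<one> \<longrightarrow> \<theta> (b [^] k) \<noteq> 1)"
    if b: "b \<in> B" for b and k :: nat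
  proof (cases "b [^] k = \<one>")
    case True
    then show ?thesis by (intro exI[of _ "\<lambda>_. 1"]) auto
  next
    case False
    have bc: "b \<in> carrier G" using b Bc by auto
    have "b [^] k \<in> generate G {b}" using int_pow_in_generate[of b "{b}" "int k"] bc by (simp add: int_pow_int)
    then have "b [^] k \<notin> generate G (B - {b})" using B b False by (auto simp: independent_def)
    moreover have "subgroup (generate G (B - {b})) G" using Bc by (intro generate_is_subgroup) auto
    ultimately show ?thesis using character_separates[of "generate G (B - {b})" "b [^] k"] bc
      by (metis nat_pow_closed)
  qed
  then obtain \<theta> where \<theta>: "\<And>b k. b \<in> B \<Longrightarrow> character G (\<theta> b k)"
    "\<And>b k x. b \<in> B \<Longrightarrow> x \<in> generate G (B - {b}) \<Longrightarrow> \<theta> b k x = 1"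
    "\<And>b k. b \<in> B \<Longrightarrow> b [^] k \<noteq> \<one> \<Longrightarrow> \<theta> b k (b [^] (k::nat)) \<noteq> 1"
    by metis
  have "|B| \<le>o |Pow \<Lambda>|" using card_of_mono1[OF Bc] card ordLeq_transitive by blast
  then obtain t :: "'l \<Rightarrow> 'a \<Rightarrow> complex" where t: "\<And>F v e. finite F \<Longrightarrow> F \<subseteq> B
      \<Longrightarrow> (\<And>x. x \<in> F \<Longrightarrow> cmod (v x) = 1) \<Longrightarrow> e > 0 \<Longrightarrow> \<exists>i\<in>\<Lambda>. \<forall>x\<in>F. near e (t i x) (v x)"
    using dense_circle_family[OF \<Lambda>] by metis
  define v where "v i k b = (if Re (t i b) < 0 then \<theta> b k b else 1)" for i b and k :: nat
  have "\<exists>\<psi>. character G \<psi> \<and> (\<forall>b\<in>B. \<psi> b = v i k b)" for i and k :: nat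
  proof -
    define \<C> where "\<C> = (\<lambda>b. (b, {v i k b})) ` B"
    \<comment> \<open>Infinitely many \<open>b\<close> may be selected, so the
      \<open>\<theta> b k\<close> cannot simply be multiplied. For finitely many elements of
      \<open>B\<close> a finite product has the required values, and compactness does the
      rest.\<close>
    have "\<exists>\<psi>. character G \<psi> \<and> (\<forall>(x, V)\<in>\<F>. \<psi> x \<in> V)" if F: "finite \<F>" "\<F> \<subseteq> \<C>" for \<F>
    proof -
      obtain B' where B': "finite B'" "B' \<subseteq> B" "\<F> = (\<lambda>b. (b, {v i k b})) ` B'"
        using F unfolding \<C>_def by (meson finite_subset_image)
      define \<psi> where "\<psi> x = (\<Prod>b\<in>{b\<in>B'. Re (t i b) < 0}. \<theta> b k x)" for x
      have "character G \<psi>"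
        unfolding \<psi>_def using \<theta>(1) B'(2) by (intro character_on_prod) auto
      moreover have "\<psi> b = v i k b" if b: "b \<in> B'" for b
      proof -
        have one: "\<theta> c k b = 1" if "c \<in> B'" "c \<noteq> b" for c
          using \<theta>(2)[of c b k] that b B'(2) generate.incl[of b "B - {c}" G] by blast
        have "\<psi> b = (\<Prod>c\<in>{c\<in>B'. Re (t i c) < 0}. if c = b then \<theta> b k b else 1)"
          unfolding \<psi>_def using one by (intro prod.cong) auto
        also have "\<dots> = v i k b" using B'(1) b by (simp add: v_def prod.delta)
        finally show ?thesis .
      qed
      ultimately show ?thesis using B'(3) by auto
    qed
    moreover have "x \<in> carrier G \<and> closed V" if "(x, V) \<in> \<C>" for x V
      using that Bc by (auto simp: \<C>_def)
    ultimately obtain \<psi> where "character G \<psi>" "\<And>x V. (x, V) \<in> \<C> \<Longrightarrow> \<psi> x \<in> V"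
      using character_compactness[of \<C>] by metis
    then show ?thesis by (intro exI[of _ \<psi>]) (auto simp: \<C>_def)
  qed
  then obtain \<psi> where \<psi>: "\<And>i k. character G (\<psi> i k)" "\<And>i k b. b \<in> B \<Longrightarrow> \<psi> i k b = v i k b"
    by metis
  have sepB: "\<exists>i\<in>\<Lambda>. \<exists>k. \<psi> i k x \<noteq> 1" if x: "x \<in> generate G B" "x \<noteq> \<one>" for x
  proof -
    obtain F where F: "finite F" "F \<subseteq> B" "x \<in> generate G F"
      using generate_finite_subset[OF x(1)] by metis
    have Fc: "F \<subseteq> carrier G" using F(2) Bc by blast
    obtain b and n :: int and e where b: "b \<in> F" "b [^] n \<noteq> \<one>" "e \<in> generate G (F - {b})" "x = b [^] n \<otimes> e"
      using generate_split_off[OF F(1) Fc F(3) x(2)] by metis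
    have bB: "b \<in> B" and bc: "b \<in> carrier G" using b F Bc by auto
    \<comment> \<open>The power with a negative exponent is detected through its inverse.\<close>
    define k where "k = nat \<bar>n\<bar>"
    have "\<theta> b k (b [^] n) \<noteq> 1"
    proof (cases n rule: int_cases2)
      case (nonneg j)
      then show ?thesis using b(2) \<theta>(3)[OF bB, of k] by (simp add: k_def int_pow_int)
    next
      case (nonpos j)
      then have "b [^] k \<noteq> \<one>" using b(2) bc by (auto simp: k_def int_pow_neg int_pow_int)
      then have "\<theta> b k (b [^] k) \<noteq> 1" using \<theta>(3)[OF bB] by blast
      moreover have "\<theta> b k (b [^] n) = inverse (\<theta> b k (b [^] k))"
        using nonpos bc character_on_inv[OF subgroup_self \<theta>(1)[OF bB], of "b [^] k"]
        by (simp add: k_def int_pow_neg int_pow_int)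
      ultimately show ?thesis by simp
    qed
    moreover have "\<theta> b k e = 1"
    proof -
      have "e \<in> generate G (B - {b})" using b(3) F(2) mono_generate[of "F - {b}" "B - {b}"] by blast
      then show ?thesis using \<theta>(2)[OF bB] by blast
    qed
    moreover have "e \<in> carrier G" using b(3) Fc generate_in_carrier[of "F - {b}" e] by blast
    ultimately have ne: "\<theta> b k x \<noteq> 1"
      using b(4) bc character_on_mult[OF \<theta>(1)[OF bB], of "b [^] n" e] by simp
    \<comment> \<open>An angular error of 1 is less than \<open>pi / 2\<close>, so the real part
      keeps the sign of the target and selects \<open>b\<close> alone within
      \<open>F\<close>.\<close>
    have "\<exists>i\<in>\<Lambda>. \<forall>c\<in>F. near 1 (t i c) (if c = b then -1 else 1)"
      by (rule t[OF F(1,2)]) auto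
    then obtain i where i: "i \<in> \<Lambda>" "\<forall>c\<in>F. near 1 (t i c) (if c = b then -1 else 1)"
      by blast
    have sgn: "Re (t i c) < 0 \<longleftrightarrow> c = b" if c: "c \<in> F" for c
    proof -
      obtain \<alpha> where \<alpha>: "\<bar>\<alpha>\<bar> \<le> 1" "t i c = (if c = b then -1 else 1) * cis \<alpha>"
        using i(2) c by (auto simp: near_def)
      have "cos \<alpha> > 0" using \<alpha>(1) pi_gt3 by (intro cos_gt_zero_pi) auto
      then show ?thesis using \<alpha>(2) by auto
    qed
    have "\<psi> i k c = \<theta> b k c" if c: "c \<in> F" for c
    proof (cases "c = b")
      case True
      then show ?thesis using sgn[OF b(1)] \<psi>(2)[OF bB] by (simp add: v_def)
    next
      case False
      then have "c \<in> generate G (B - {b})" using c F(2) by (intro generate.incl) auto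
      moreover have "c \<in> B" using c F(2) by blast
      ultimately show ?thesis using sgn[OF c] False \<theta>(2)[OF bB] \<psi>(2) by (simp add: v_def)
    qed
    then have "\<psi> i k x = \<theta> b k x"
      using character_eq_on_generate[OF \<psi>(1) \<theta>(1)[OF bB] Fc _ F(3)] by blast
    then show ?thesis using i(1) ne by metis
  qed
  have "\<exists>i\<in>\<Lambda>. \<exists>k. \<psi> i k g \<noteq> 1" if g: "g \<in> carrier G" "g \<noteq> \<one>" for g
  proof -
    obtain n :: int where n: "g [^] n \<in> generate G B" "g [^] n \<noteq> \<one>"
      using maximal_independent_meets[OF B max g] by metis
    then obtain i k where ik: "i \<in> \<Lambda>" "\<psi> i k (g [^] n) \<noteq> 1" using sepB by blast
    then have "\<psi> i k g \<noteq> 1"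
      using character_on_int_pow[OF subgroup_self \<psi>(1) g(1), of i k n] by auto
    then show ?thesis using ik by blast
  qed
  with \<psi>(1) show ?thesis using that by blast
qed

end

section \<open>Interpolation by characters\<close>

context comm_group
begin

text \<open>\<open>L\<close> counts the letters of an expression of \<open>x\<close> by generators.
  It is independent of the character and of \<open>d\<close>, so a tolerance can be chosen after
  \<open>L\<close> is known.\<close>

lemma near_one_on_generate:
  assumes "x \<in> generate G F" "F \<subseteq> carrier G"
  obtains L :: nat where "\<And>\<phi> d::real. character G \<phi> \<Longrightarrow> (\<And>f. f \<in> F \<Longrightarrow> near d (\<phi> f) 1) \<Longrightarrow> near (L * d) (\<phi> x) 1"
proof -
  from assms(1) have "\<exists>L::nat. \<forall>\<phi> d::real. character G \<phi> \<longrightarrow> (\<forall>f\<in>F. near d (\<phi> f) 1) \<longrightarrow> near (L * d) (\<phi> x) 1"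
  proof induction
    case one
    then show ?case
      by (intro exI[of _ 0]) (auto simp: character_on_id[OF subgroup_self])
  next
    case (incl h)
    then show ?case by (intro exI[of _ 1]) auto
  next
    case (inv h)
    have "near d (\<phi> (inv h)) 1" if "character G \<phi>" "\<forall>f\<in>F. near d (\<phi> f) 1" for \<phi> and d :: real
      using near_inverse[of d "\<phi> h" 1] that inv assms(2) character_on_inv[OF subgroup_self that(1), of h] by auto
    then show ?case by (intro exI[of _ 1]) auto
  next
    case (eng h1 h2)
    then obtain L1 L2 :: nat where L: "\<And>\<phi> d::real. character G \<phi> \<Longrightarrow> (\<forall>f\<in>F. near d (\<phi> f) 1) \<Longrightarrow> near (L1 * d) (\<phi> h1) 1"
      "\<And>\<phi> d::real. character G \<phi> \<Longrightarrow> (\<forall>f\<in>F. near d (\<phi> f) 1) \<Longrightarrow> near (L2 * d) (\<phi> h2) 1"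
      by metis
    have "h1 \<in> carrier G" "h2 \<in> carrier G" using eng(1,2) generate_in_carrier[OF assms(2)] by auto
    then have "near (real (L1 + L2) * d) (\<phi> (h1 \<otimes> h2)) 1" if "character G \<phi>" "\<forall>f\<in>F. near d (\<phi> f) 1" for \<phi> and d :: real
      using near_mult[OF L(1)[OF that] L(2)[OF that]] character_on_mult[OF that(1), of h1 h2]
      by (simp add: distrib_right)
    then show ?case by blast
  qed
  then show ?thesis using that by blast
qed

lemma nat_pow_in_subgroup: "subgroup E G \<Longrightarrow> x \<in> E \<Longrightarrow> x [^] (n::nat) \<in> E"
  using subgroup_int_pow_closed[of E x "int n"] by (simp add: int_pow_int)

text \<open>
  In a finitely generated group, characters close to \<open>1\<close> on the generators still take approximately
  all values at all but finitely many elements: if such an element has a large exponent at a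
  generator of infinite order, a small rotation of that generator suffices.
\<close>

lemma characters_near_finite:
  assumes "finite F" "F \<subseteq> carrier G" "e > 0"
  shows "\<exists>X. finite X \<and> X \<subseteq> carrier G \<and> (\<forall>x\<in>generate G F - X. \<forall>t. cmod t = 1 \<longrightarrow>
    (\<exists>\<phi>. character G \<phi> \<and> (\<forall>f\<in>F. near e (\<phi> f) 1) \<and> near e (\<phi> x) t))"
  using assms
proof (induction F arbitrary: e)
  case empty
  then show ?case by (intro exI[of _ "{\<one>}"]) (auto simp: generate_empty)
next
  case (insert a F)
  define E where "E = generate G F"
  have Fc: "F \<subseteq> carrier G" and a: "a \<in> carrier G" using insert.prems by auto
  have E: "subgroup E G" unfolding E_def using Fc by (rule generate_is_subgroup)
  interpret E: subgroup E G by (rule E)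
  have FE: "F \<subseteq> E" unfolding E_def by (auto intro: generate.incl)
  have gen: "\<exists>(n::int) y. y \<in> E \<and> x = a [^] n \<otimes> y" if "x \<in> generate G (insert a F)" for x
    using generate_insertE[OF Fc a that] unfolding E_def by metis
  show ?case
  proof (rule int_pow_in_subgroup_cases[OF E a])
    assume free: "\<And>n::int. a [^] n \<in> E \<Longrightarrow> n = 0"
    obtain X where X: "finite X" "X \<subseteq> carrier G" "\<And>x t. x \<in> E - X \<Longrightarrow> cmod t = 1 \<Longrightarrow>
        \<exists>\<phi>. character G \<phi> \<and> (\<forall>f\<in>F. near e (\<phi> f) 1) \<and> near e (\<phi> x) t"
      using insert.IH[OF Fc insert.prems(2)] unfolding E_def by blast
    \<comment> \<open>For an exponent of absolute value above \<open>N\<close>, a rotation of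
      \<open>a\<close> by at most \<open>e\<close> suffices to reach any value at
      \<open>x\<close>.\<close>
    obtain N :: nat where N: "pi / e \<le> N" using real_arch_simple by blast
    \<comment> \<open>An exception requires a bounded exponent together with an exceptional
      component in \<open>E\<close>.\<close>
    define X' where "X' = (\<lambda>(n, x). a [^] n \<otimes> x) ` ({- int N..int N} \<times> X)"
    have "finite X'" "X' \<subseteq> carrier G" using X a by (auto simp: X'_def)
    moreover have "\<exists>\<phi>. character G \<phi> \<and> (\<forall>f\<in>insert a F. near e (\<phi> f) 1) \<and> near e (\<phi> x) t"
      if x: "x \<in> generate G (insert a F) - X'" and t: "cmod t = 1" for x t
    proof -
      obtain n :: int and y where y: "y \<in> E" "x = a [^] n \<otimes> y" using gen x by blast
      show ?thesis
      proof (cases "\<bar>n\<bar> \<le> int N")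
        case True
        then have "n \<in> {- int N..int N}" by auto
        then have "x \<in> X'" if "y \<in> X" using that unfolding X'_def y(2)
          by (intro image_eqI[of _ _ "(n, y)"]) auto
        then have "y \<notin> X" using x by blast
        then obtain \<phi> where \<phi>: "character G \<phi>" "\<forall>f\<in>F. near e (\<phi> f) 1" "near e (\<phi> y) t"
          using X(3) y(1) t by blast
        obtain \<psi> where \<psi>: "character G \<psi>" "\<And>x. x \<in> E \<Longrightarrow> \<psi> x = \<phi> x" "\<psi> a = 1"
          using character_extend_free[OF E character_on_mono[OF \<phi>(1) E.subset] a free, of 1] by auto
        have "\<psi> x = \<phi> y"
          using y a \<psi> character_on_mult[OF \<psi>(1), of "a [^] n" y] character_on_int_pow[OF subgroup_self \<psi>(1) a]
          by simp
        then show ?thesis using \<psi> \<phi> FE insert.prems(2) by (intro exI[of _ \<psi>]) (auto simp: near_refl subset_iff)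
      next
        case False
        define m where "m = nat \<bar>n\<bar>"
        have m: "m > N" "m \<noteq> 0" using False by (auto simp: m_def)
        \<comment> \<open>\<open>w\<close> absorbs the sign of \<open>n\<close>, as the root is
          taken for the positive exponent \<open>m\<close>.\<close>
        define w where "w = (if n < 0 then inverse t else t)"
        have "cmod w = 1" using t by (simp add: w_def norm_inverse)
        then obtain z where z: "cmod z = 1" "z ^ m = w" "near (pi / m) z 1"
          using root_near_pi[of w 1 m] m(2) by auto
        have zn: "z powi n = t"
          using z(2) by (auto simp: power_int_def w_def m_def power_inverse split: if_splits)
        have "pi / e \<le> real m" using N m by linarith
        then have "pi / m \<le> e" using insert.prems(2) m by (simp add: field_simps)
        then have "near e z 1" using z(3) near_mono by blast
        obtain \<psi> where \<psi>: "character G \<psi>" "\<And>x. x \<in> E \<Longrightarrow> \<psi> x = 1" "\<psi> a = z"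
          using character_extend_free[OF E character_on_one a free z(1)] by metis
        have "\<psi> x = t"
          using y a \<psi> zn character_on_mult[OF \<psi>(1), of "a [^] n" y] character_on_int_pow[OF subgroup_self \<psi>(1) a]
          by simp
        then show ?thesis using \<psi> \<open>near e z 1\<close> FE insert.prems(2)
          by (intro exI[of _ \<psi>]) (auto simp: near_refl subset_iff)
      qed
    qed
    ultimately show ?thesis by blast
  next
    fix m :: nat
    assume torsion: "m > 0" "\<And>n::int. a [^] n \<in> E \<longleftrightarrow> int m dvd n"
    have mE: "a [^] m \<in> E" using torsion(2)[of "int m"] by (simp add: int_pow_int)
    then obtain L :: nat where L: "\<And>\<phi> d::real. character G \<phi> \<Longrightarrow> (\<And>f. f \<in> F \<Longrightarrow> near d (\<phi> f) 1) \<Longrightarrow> near (L * d) (\<phi> (a [^] m)) 1"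
      using near_one_on_generate[OF _ Fc] unfolding E_def by metis
    \<comment> \<open>The tolerance is split into \<open>L * d\<close>, for the deviation from 1 at
      \<open>a [^] m\<close> that is passed on to \<open>a\<close>, and \<open>d\<close>, for the
      approximation at \<open>y\<close>.\<close>
    define d where "d = e / (1 + L)"
    have "L * d + d = (1 + L) * d" by (simp add: algebra_simps)
    also have "\<dots> = e" by (simp add: d_def)
    finally have d: "d > 0" "d \<le> e" "L * d + d = e" using insert.prems(2) by (auto simp: d_def field_simps)
    obtain X where X: "finite X" "X \<subseteq> carrier G" "\<And>x t. x \<in> E - X \<Longrightarrow> cmod t = 1 \<Longrightarrow>
        \<exists>\<phi>. character G \<phi> \<and> (\<forall>f\<in>F. near d (\<phi> f) 1) \<and> near d (\<phi> x) t"
      using insert.IH[OF Fc d(1)] unfolding E_def by blast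
    define X' where "X' = (\<lambda>(n::nat, x). a [^] n \<otimes> x) ` ({..<m} \<times> X)"
    have "finite X'" "X' \<subseteq> carrier G" using X a by (auto simp: X'_def)
    moreover have "\<exists>\<phi>. character G \<phi> \<and> (\<forall>f\<in>insert a F. near e (\<phi> f) 1) \<and> near e (\<phi> x) t"
      if x: "x \<in> generate G (insert a F) - X'" and t: "cmod t = 1" for x t
    proof -
      obtain k :: int and y' where y': "y' \<in> E" "x = a [^] k \<otimes> y'" using gen x by blast
      define n where "n = nat (k mod int m)"
      \<comment> \<open>Multiples of \<open>m\<close> in the exponent are moved into the component
        in \<open>E\<close>, which leaves only \<open>m\<close> exponents for
        \<open>a\<close>.\<close>
      define y where "y = a [^] (int m * (k div int m)) \<otimes> y'"
      have n: "n < m" "int n = k mod int m" using torsion(1) by (auto simp: n_def nat_less_iff)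
      have y: "y \<in> E" using y'(1) torsion(2) by (auto simp: y_def)
      have "k = int n + int m * (k div int m)" using n(2) by simp
      then have "a [^] k = a [^] int n \<otimes> a [^] (int m * (k div int m))"
        using int_pow_mult[OF a] by metis
      then have "a [^] k = a [^] n \<otimes> a [^] (int m * (k div int m))" by (simp only: int_pow_int)
      then have xy: "x = a [^] n \<otimes> y" using y' a by (simp add: y_def m_assoc)
      then have "y \<notin> X" using x n by (auto simp: X'_def image_iff)
      then obtain \<phi> where \<phi>: "character G \<phi>" "\<forall>f\<in>F. near d (\<phi> f) 1" "near d (\<phi> y) t"
        using X(3) y t by blast
      have "near (L * d) (\<phi> (a [^] m)) (1 ^ m)" using L[OF \<phi>(1)] \<phi>(2) by simp
      then obtain z where z: "cmod z = 1" "z ^ m = \<phi> (a [^] m)" "near (L * d / m) z 1"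
        using root_near[of "\<phi> (a [^] m)" 1 m "L * d"] torsion(1) character_on_norm[OF \<phi>(1)] a by auto
      obtain \<psi> where \<psi>: "character G \<psi>" "\<And>x. x \<in> E \<Longrightarrow> \<psi> x = \<phi> x" "\<psi> a = z"
        using character_extend_torsion[OF E character_on_mono[OF \<phi>(1) E.subset] a torsion z(1,2)] by metis
      have "near (n * (L * d / m) + d) (z ^ n * \<phi> y) (1 ^ n * t)"
        using z(3) \<phi>(3) by (intro near_mult near_power)
      \<comment> \<open>The root divides the error by \<open>m\<close>, and raising to the power
        \<open>n < m\<close> does not bring it back above \<open>L * d\<close>.\<close>
      moreover have "n * (L * d / m) + d \<le> e"
      proof -
        have "n * (L * d / m) = (n / m) * (L * d)" by simp
        also have "\<dots> \<le> 1 * (L * d)" using n(1) d(1) by (intro mult_right_mono) auto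
        finally show ?thesis using d(3) by simp
      qed
      moreover have "\<psi> x = z ^ n * \<phi> y"
        using xy y a \<psi> character_on_mult[OF \<psi>(1), of "a [^] n" y] character_on_pow[OF subgroup_self \<psi>(1) a]
        by simp
      ultimately have "near e (\<psi> x) t" using near_mono by fastforce
      moreover have "near e (\<psi> a) 1"
      proof -
        have "L * d / m \<le> L * d / 1" using torsion(1) d(1) by (intro divide_left_mono) auto
        then have "L * d / m \<le> e" using d by simp
        then show ?thesis using z(3) \<psi>(3) near_mono by blast
      qed
      moreover have "near e (\<psi> f) 1" if "f \<in> F" for f
        using \<phi>(2) \<psi>(2) that FE d(2) near_mono by (metis subsetD)
      ultimately show ?thesis using \<psi>(1) by blast
    qed
    ultimately show ?thesis by blast
  qed
qed

text \<open>If \<open>s\<close> has order greater than \<open>N\<close> modulo the subgroup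
  generated by \<open>F\<close>, its admissible values are dense up to \<open>e\<close>. Otherwise
  the order is some \<open>m \<le> N\<close>; then the value at \<open>s [^] m\<close> is brought
  close to \<open>t ^ m\<close>, and an \<open>m\<close>-th root near \<open>t\<close> is taken at
  \<open>s\<close>.\<close>

lemma element_near_all_targets:
  assumes S: "S \<subseteq> carrier G" "\<And>n::nat. n \<ge> 1 \<Longrightarrow> infinite (multiples G n S)"
    and F: "finite F" "F \<subseteq> carrier G" and e: "e > 0"
  obtains s where "s \<in> S" "\<And>t. cmod t = 1 \<Longrightarrow>
    \<exists>\<phi>. character G \<phi> \<and> (\<forall>f\<in>F. near e (\<phi> f) 1) \<and> near e (\<phi> s) t"
proof -
  define E where "E = generate G F"
  have E: "subgroup E G" unfolding E_def using F(2) by (rule generate_is_subgroup)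
  interpret E: subgroup E G by (rule E)
  have FE: "F \<subseteq> E" unfolding E_def by (auto intro: generate.incl)
  obtain X where X: "finite X" "X \<subseteq> carrier G" "\<And>x t. x \<in> E - X \<Longrightarrow> cmod t = 1 \<Longrightarrow>
      \<exists>\<phi>. character G \<phi> \<and> (\<forall>f\<in>F. near e (\<phi> f) 1) \<and> near e (\<phi> x) t"
    using characters_near_finite[OF F e] unfolding E_def by blast
  obtain N :: nat where N: "pi / e \<le> N" using real_arch_simple by blast
  \<comment> \<open>All orders up to \<open>N\<close> divide \<open>M\<close>. If
    \<open>s [^] m\<close> were exceptional, \<open>s [^] M\<close> would be one of its powers with
    exponent at most \<open>M\<close> and lie in the finite set \<open>Y\<close>; avoiding
    \<open>Y\<close> excludes all such \<open>m\<close> together.\<close>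
  define M :: nat where "M = fact N"
  define Y where "Y = (\<lambda>(i::nat, x). x [^] i) ` ({..M} \<times> X)"
  have "finite Y" using X(1) by (simp add: Y_def)
  moreover have "infinite (multiples G M S)" by (rule S(2)) (simp add: M_def)
  ultimately have "multiples G M S - Y \<noteq> {}" using infinite_imp_nonempty Diff_infinite_finite by blast
  then obtain x where "x \<in> multiples G M S - Y" by blast
  then obtain s where s: "s \<in> S" "s [^] M \<notin> Y" by (auto simp: multiples_def)
  have sc: "s \<in> carrier G" using s(1) S(1) by auto
  have "\<exists>\<phi>. character G \<phi> \<and> (\<forall>f\<in>F. near e (\<phi> f) 1) \<and> near e (\<phi> s) t" if t: "cmod t = 1" for t
  proof (cases "\<exists>j. 0 < j \<and> j \<le> N \<and> s [^] j \<in> E")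
    case False
    then obtain \<psi> where \<psi>: "character G \<psi>" "\<And>x. x \<in> E \<Longrightarrow> \<psi> x = 1" "near e (\<psi> s) t"
      using character_extend_near[OF E character_on_one sc _ t N e] by metis
    then show ?thesis using FE e by (intro exI[of _ \<psi>]) (auto simp: near_refl subset_iff)
  next
    case True
    then obtain j where j: "0 < j" "j \<le> N" "s [^] j \<in> E" by blast
    show ?thesis
    proof (rule int_pow_in_subgroup_cases[OF E sc])
      assume "\<And>n::int. s [^] n \<in> E \<Longrightarrow> n = 0"
      from this[of "int j"] show ?thesis using j by (simp add: int_pow_int)
    next
      fix m :: nat
      assume torsion: "m > 0" "\<And>n::int. s [^] n \<in> E \<longleftrightarrow> int m dvd n"
      have mE: "s [^] m \<in> E" using torsion(2)[of "int m"] by (simp add: int_pow_int)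
      have "m dvd j" using torsion(2)[of "int j"] j(3) by (simp add: int_pow_int)
      then have "m \<le> N" using j(1,2) dvd_imp_le[of m j] by linarith
      then have "m dvd M" unfolding M_def using torsion(1) by (intro dvd_fact) auto
      then obtain i where i: "M = m * i" by blast
      have "i \<le> M" using i torsion(1) by simp
      moreover have "s [^] M = (s [^] m) [^] i" using sc by (simp add: i nat_pow_pow)
      ultimately have "s [^] m \<notin> X" using s(2) by (auto simp: Y_def image_iff)
      moreover have "cmod (t ^ m) = 1" using t by (simp add: norm_power)
      ultimately obtain \<phi> where \<phi>: "character G \<phi>" "\<forall>f\<in>F. near e (\<phi> f) 1" "near e (\<phi> (s [^] m)) (t ^ m)"
        using X(3) mE by blast
      obtain z where z: "cmod z = 1" "z ^ m = \<phi> (s [^] m)" "near (e / m) z t"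
        using root_near[OF _ t _ \<phi>(3)] torsion(1) character_on_norm[OF \<phi>(1)] sc by auto
      obtain \<psi> where \<psi>: "character G \<psi>" "\<And>x. x \<in> E \<Longrightarrow> \<psi> x = \<phi> x" "\<psi> s = z"
        using character_extend_torsion[OF E character_on_mono[OF \<phi>(1) E.subset] sc torsion z(1,2)] by metis
      have "e / m \<le> e" using e torsion(1) by (simp add: field_simps)
      then have "near e (\<psi> s) t" using z(3) \<psi>(3) near_mono by blast
      then show ?thesis using \<psi> \<phi>(2) FE by (intro exI[of _ \<psi>]) auto
    qed
  qed
  then show ?thesis using s(1) that by blast
qed

end

lemma sum_half_powers_le: "(\<Sum>j\<in>{k..<n}. (1/2::real) ^ Suc j) \<le> (1/2) ^ k"
proof (cases "k \<le> n")
  case True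
  then have "(\<Sum>j\<in>{k..<n}. (1/2::real) ^ Suc j) = (1/2) ^ k - (1/2) ^ n"
    by (induction rule: dec_induct) auto
  then show ?thesis by simp
qed auto

lemma finite_has_greatest:
  assumes "finite J" "J \<noteq> {}" "J \<subseteq> Field r" "Well_order r"
  obtains p where "p \<in> J" "\<And>q. q \<in> J \<Longrightarrow> (q, p) \<in> r"
proof -
  have r: "trans r" "Refl r" "Total r"
    using assms(4) by (auto simp: well_order_on_def linear_order_on_def partial_order_on_def preorder_on_def)
  from assms(1-3) have "\<exists>p\<in>J. \<forall>q\<in>J. (q, p) \<in> r"
  proof (induction rule: finite_ne_induct)
    case (singleton x)
    then show ?case using r(2) by (auto simp: refl_on_def)
  next
    case (insert x F)
    then obtain p where p: "p \<in> F" "\<forall>q\<in>F. (q, p) \<in> r" by auto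
    show ?case
    proof (cases "(x, p) \<in> r")
      case True
      then show ?thesis using p by auto
    next
      case False
      have "x \<in> Field r" "p \<in> Field r" "x \<noteq> p" using insert p by auto
      then have px: "(p, x) \<in> r" using False r(3) by (auto simp: total_on_def)
      have "(q, x) \<in> r" if "q \<in> F" for q using p(2) that px transD[OF r(1)] by blast
      moreover have "(x, x) \<in> r" using r(2) \<open>x \<in> Field r\<close> by (auto simp: refl_on_def)
      ultimately show ?thesis by auto
    qed
  qed
  then show ?thesis using that by blast
qed

section \<open>Interpolation at infinitely many points\<close>

context comm_group
begin

lemma character_interpolation_compact:
  assumes h: "h \<in> carrier G" and s: "\<And>i. i \<in> I \<Longrightarrow> s i \<in> carrier G"
    and fin: "\<And>J. finite J \<Longrightarrow> J \<subseteq> I \<Longrightarrow>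
      \<exists>\<phi>. character G \<phi> \<and> near \<eta> (\<phi> h) w \<and> (\<forall>i\<in>J. near (\<epsilon> i) (\<phi> (s i)) (t i))"
  shows "\<exists>\<phi>. character G \<phi> \<and> near \<eta> (\<phi> h) w \<and> (\<forall>i\<in>I. near (\<epsilon> i) (\<phi> (s i)) (t i))"
proof -
  define c where "c i = (s i, {z. near (\<epsilon> i) z (t i)})" for i
  define \<C> where "\<C> = insert (h, {z. near \<eta> z w}) (c ` I)"
  have "\<exists>\<phi>. character G \<phi> \<and> (\<forall>(x, V)\<in>\<F>. \<phi> x \<in> V)" if F: "finite \<F>" "\<F> \<subseteq> \<C>" for \<F>
  proof -
    have "finite (\<F> - {(h, {z. near \<eta> z w})})" "\<F> - {(h, {z. near \<eta> z w})} \<subseteq> c ` I"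
      using F by (auto simp: \<C>_def)
    then obtain J where J: "J \<subseteq> I" "finite J" "\<F> - {(h, {z. near \<eta> z w})} = c ` J"
      by (meson finite_subset_image)
    obtain \<phi> where \<phi>: "character G \<phi>" "near \<eta> (\<phi> h) w" "\<forall>i\<in>J. near (\<epsilon> i) (\<phi> (s i)) (t i)"
      using fin[OF J(2,1)] by blast
    have "\<F> \<subseteq> insert (h, {z. near \<eta> z w}) (c ` J)" using J(3) by blast
    then have "\<forall>(x, V)\<in>\<F>. \<phi> x \<in> V" using \<phi> by (auto simp: c_def)
    then show ?thesis using \<phi>(1) by blast
  qed
  moreover have "x \<in> carrier G \<and> closed V" if "(x, V) \<in> \<C>" for x V
    using that h s closed_near by (auto simp: \<C>_def c_def)
  ultimately obtain \<phi> where "character G \<phi>" "\<And>x V. (x, V) \<in> \<C> \<Longrightarrow> \<phi> x \<in> V"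
    using character_compactness[of \<C>] by metis
  then show ?thesis by (intro exI[of _ \<phi>]) (auto simp: \<C>_def c_def)
qed

text \<open>That the value at \<open>h\<close> differs from 1 is not a closed condition and could be
  lost in a compactness argument. It is replaced by closeness to a fixed value away from 1.\<close>

lemma character_detects:
  assumes "h \<in> carrier G"
  obtains \<psi> \<eta> where "character G \<psi>" "\<eta> > 0" "\<And>z. near \<eta> z (\<psi> h) \<Longrightarrow> h \<noteq> \<one> \<Longrightarrow> z \<noteq> 1"
proof (cases "h = \<one>")
  case True
  then show ?thesis using that[of "\<lambda>_. 1" 1] by auto
next
  case False
  have "subgroup {\<one>} G" by (rule triv_subgroup)
  then obtain \<psi> where \<psi>: "character G \<psi>" "\<psi> h \<noteq> 1"
    using character_separates[of "{\<one>}" h] False assms by auto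
  \<comment> \<open>\<open>near\<close> bounds the distance from \<open>\<psi> h\<close> by
    \<open>\<eta>\<close>, whereas 1 has distance \<open>2 * \<eta>\<close> from it.\<close>
  define \<eta> where "\<eta> = dist 1 (\<psi> h) / 2"
  have "\<eta> > 0" using \<psi>(2) by (simp add: \<eta>_def)
  moreover have "z \<noteq> 1" if "near \<eta> z (\<psi> h)" for z
    using near_dist[OF that character_on_norm[OF \<psi>(1) assms]] \<open>\<eta> > 0\<close> by (auto simp: \<eta>_def)
  ultimately show ?thesis using \<psi>(1) that by blast
qed

text \<open>
  The values at \<open>s k\<close> are corrected one after the other; the \<open>k\<close>-th correction moves the earlier
  values by at most \<open>\<delta> k\<close>, and these errors are summable. The same estimate shows that the
  corrections from a late stage on preserve the value at \<open>h\<close> up to a small error.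
\<close>

lemma interpolation_sequence:
  fixes \<epsilon> :: "nat \<Rightarrow> real"
  assumes S: "S \<subseteq> carrier G" "\<And>n::nat. n \<ge> 1 \<Longrightarrow> infinite (multiples G n S)" and \<epsilon>: "\<And>k. \<epsilon> k > 0"
  obtains s :: "nat \<Rightarrow> 'a" where "range s \<subseteq> S"
    "\<And>h. h \<in> generate G (range s) \<Longrightarrow> \<exists>K. \<forall>t. (\<forall>k. cmod (t k) = 1) \<longrightarrow>
       (\<exists>\<phi>. character G \<phi> \<and> (h \<noteq> \<one> \<longrightarrow> \<phi> h \<noteq> 1) \<and> (\<forall>k\<ge>K. near (\<epsilon> k) (\<phi> (s k)) (t k)))"
proof -
  \<comment> \<open>The minimum makes the \<open>k\<close>-th correction small against every earlier
    tolerance; the powers of 1/2 make all corrections from stage \<open>k\<close> on add up to at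
    most \<open>\<epsilon> i\<close> for \<open>i \<le> k\<close>.\<close>
  define \<delta> where "\<delta> k = Min (\<epsilon> ` {..k}) * (1/2) ^ Suc k" for k
  have \<delta>: "\<delta> k > 0" for k using \<epsilon> by (simp add: \<delta>_def)
  have \<delta>_sum: "(\<Sum>j\<in>{k..<n}. \<delta> j) \<le> \<epsilon> i * (1/2) ^ k" if "i \<le> k" for i k n
  proof -
    have "(\<Sum>j\<in>{k..<n}. \<delta> j) \<le> (\<Sum>j\<in>{k..<n}. \<epsilon> i * (1/2) ^ Suc j)"
      unfolding \<delta>_def using that by (intro sum_mono mult_right_mono Min_le) auto
    also have "\<dots> = \<epsilon> i * (\<Sum>j\<in>{k..<n}. (1/2) ^ Suc j)" by (simp add: sum_distrib_left)
    also have "\<dots> \<le> \<epsilon> i * (1/2) ^ k"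
      using \<epsilon>[of i] by (intro mult_left_mono sum_half_powers_le) auto
    finally show ?thesis .
  qed
  define Q where "Q s k r \<longleftrightarrow> r \<in> S \<and> (\<forall>t. cmod t = 1 \<longrightarrow>
    (\<exists>\<phi>. character G \<phi> \<and> (\<forall>j<k. near (\<delta> k) (\<phi> (s j)) 1) \<and> near (\<delta> k) (\<phi> r) t))" for s :: "nat \<Rightarrow> 'a" and k r
  have "\<exists>s. \<forall>k. Q s k (s k)"
  proof (rule dependent_wellorder_choice)
    show "Q f x r = Q g x r" if "\<And>y. y < x \<Longrightarrow> f y = g y" for r f g x
      using that by (auto simp: Q_def)
    fix k and f :: "nat \<Rightarrow> 'a" assume f: "\<And>j. j < k \<Longrightarrow> Q f j (f j)"
    have "finite (f ` {..<k})" "f ` {..<k} \<subseteq> carrier G" using f S(1) by (auto simp: Q_def)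
    then obtain r where r: "r \<in> S" "\<And>t. cmod t = 1 \<Longrightarrow>
      \<exists>\<phi>. character G \<phi> \<and> (\<forall>x\<in>f ` {..<k}. near (\<delta> k) (\<phi> x) 1) \<and> near (\<delta> k) (\<phi> r) t"
      using element_near_all_targets[OF S _ _ \<delta>[of k]] by metis
    have "\<exists>\<phi>. character G \<phi> \<and> (\<forall>j<k. near (\<delta> k) (\<phi> (f j)) 1) \<and> near (\<delta> k) (\<phi> r) t" if "cmod t = 1" for t
      using r(2)[OF that] by blast
    then have "Q f k r" using r(1) unfolding Q_def by blast
    then show "\<exists>r. Q f k r" by blast
  qed
  then obtain s where s: "\<And>k. Q s k (s k)" by blast
  have sS: "range s \<subseteq> S" using s by (auto simp: Q_def)
  have sc: "s k \<in> carrier G" for k using sS S(1) by auto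
  have "\<exists>K. \<forall>t. (\<forall>k. cmod (t k) = 1) \<longrightarrow>
       (\<exists>\<phi>. character G \<phi> \<and> (h \<noteq> \<one> \<longrightarrow> \<phi> h \<noteq> 1) \<and> (\<forall>k\<ge>K. near (\<epsilon> k) (\<phi> (s k)) (t k)))"
    if h: "h \<in> generate G (range s)" for h
  proof -
    have hc: "h \<in> carrier G" using h generate_in_carrier sc by blast
    obtain F where F: "finite F" "F \<subseteq> range s" "h \<in> generate G F" using generate_finite_subset[OF h] by metis
    then obtain N where N: "finite N" "F = s ` N" by (meson finite_subset_image subset_UNIV)
    obtain K0 where K0: "N \<subseteq> {..<K0}" using finite_nat_bounded[OF N(1)] by blast
    have "h \<in> generate G (s ` {..<K0})" using F(3) N(2) K0 mono_generate[of F "s ` {..<K0}"] by blast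
    then obtain L :: nat where L: "\<And>\<phi> d::real. character G \<phi> \<Longrightarrow>
        (\<And>f. f \<in> s ` {..<K0} \<Longrightarrow> near d (\<phi> f) 1) \<Longrightarrow> near (L * d) (\<phi> h) 1"
      using near_one_on_generate[of h "s ` {..<K0}"] sc by blast
    obtain \<psi> \<eta> where \<psi>: "character G \<psi>" "\<eta> > 0" "\<And>z. near \<eta> z (\<psi> h) \<Longrightarrow> h \<noteq> \<one> \<Longrightarrow> z \<noteq> 1"
      using character_detects[OF hc] by metis
    have "(\<lambda>k. L * (\<epsilon> 0 * (1/2) ^ k)) \<longlonglongrightarrow> L * (\<epsilon> 0 * 0)"
      by (intro tendsto_intros LIMSEQ_power_zero) auto
    then have "eventually (\<lambda>k. L * (\<epsilon> 0 * (1/2) ^ k) < \<eta>) sequentially"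
      using \<psi>(2) by (intro order_tendstoD(2)) auto
    then obtain K1 where K1: "\<And>k. k \<ge> K1 \<Longrightarrow> L * (\<epsilon> 0 * (1/2) ^ k) < \<eta>"
      by (auto simp: eventually_sequentially)
    define K where "K = max K0 K1"
    have "\<exists>\<phi>. character G \<phi> \<and> near \<eta> (\<phi> h) (\<psi> h) \<and> (\<forall>k\<in>{K..}. near (\<epsilon> k) (\<phi> (s k)) (t k))"
      if t: "\<forall>k. cmod (t k) = 1" for t
    proof (rule character_interpolation_compact[OF hc sc])
      \<comment> \<open>The construction starts from the character \<open>\<psi>\<close> detecting
        \<open>h\<close>. Values before \<open>K\<close> merely drift away from those of
        \<open>\<psi>\<close>; each later one is first moved to its target and then drifts.\<close>
      have step: "\<exists>\<phi>. character G \<phi> \<and> (\<forall>j<K. near (\<Sum>i\<in>{K..<n}. \<delta> i) (\<phi> (s j)) (\<psi> (s j))) \<and>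
          (\<forall>k\<in>{K..<n}. near (\<Sum>i\<in>{k..<n}. \<delta> i) (\<phi> (s k)) (t k))" if "K \<le> n" for n
        using that
      proof (induction rule: dec_induct)
        case base
        then show ?case using \<psi>(1) by (intro exI[of _ \<psi>]) auto
      next
        case (step n)
        then obtain \<phi> where \<phi>: "character G \<phi>" "\<forall>j<K. near (\<Sum>i\<in>{K..<n}. \<delta> i) (\<phi> (s j)) (\<psi> (s j))"
          "\<forall>k\<in>{K..<n}. near (\<Sum>i\<in>{k..<n}. \<delta> i) (\<phi> (s k)) (t k)" by blast
        have n1: "cmod (\<phi> (s n)) = 1" using character_on_norm[OF \<phi>(1) sc] .
        then have "cmod (t n / \<phi> (s n)) = 1" using t by (simp add: norm_divide)
        then obtain \<xi> where \<xi>: "character G \<xi>" "\<And>j. j < n \<Longrightarrow> near (\<delta> n) (\<xi> (s j)) 1"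
          "near (\<delta> n) (\<xi> (s n)) (t n / \<phi> (s n))"
          using s[of n] unfolding Q_def by blast
        have mul: "near (d + \<delta> n) (\<phi> (s j) * \<xi> (s j)) v" if "j < n" "near d (\<phi> (s j)) v" for d j v
          using near_mult[OF that(2) \<xi>(2)[OF that(1)]] by simp
        have "near (0 + \<delta> n) (\<phi> (s n) * \<xi> (s n)) (\<phi> (s n) * (t n / \<phi> (s n)))"
          using \<xi>(3) by (intro near_mult) auto
        moreover have "\<phi> (s n) \<noteq> 0" using n1 by auto
        ultimately have new: "near (\<delta> n) (\<phi> (s n) * \<xi> (s n)) (t n)" by simp
        show ?case
        proof (intro exI[of _ "\<lambda>x. \<phi> x * \<xi> x"] conjI allI impI ballI)
          show "character G (\<lambda>x. \<phi> x * \<xi> x)" using \<phi>(1) \<xi>(1) by (rule character_on_times)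
          show "near (\<Sum>i\<in>{K..<Suc n}. \<delta> i) (\<phi> (s j) * \<xi> (s j)) (\<psi> (s j))" if "j < K" for j
            using mul[of j "\<Sum>i\<in>{K..<n}. \<delta> i" "\<psi> (s j)"] \<phi>(2) that step(1) by simp
          show "near (\<Sum>i\<in>{k..<Suc n}. \<delta> i) (\<phi> (s k) * \<xi> (s k)) (t k)" if "k \<in> {K..<Suc n}" for k
            using mul[of k "\<Sum>i\<in>{k..<n}. \<delta> i" "t k"] \<phi>(3) new that by (cases "k = n") auto
        qed
      qed
      fix J assume J: "finite J" "J \<subseteq> {K..}"
      obtain n where n: "J \<subseteq> {..<n}" using finite_nat_bounded[OF J(1)] by blast
      obtain \<phi> where \<phi>: "character G \<phi>" "\<forall>j<K. near (\<Sum>i\<in>{K..<max K n}. \<delta> i) (\<phi> (s j)) (\<psi> (s j))"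
        "\<forall>k\<in>{K..<max K n}. near (\<Sum>i\<in>{k..<max K n}. \<delta> i) (\<phi> (s k)) (t k)"
        using step[of "max K n"] by auto
      define \<sigma> where "\<sigma> = (\<Sum>i\<in>{K..<max K n}. \<delta> i)"
      \<comment> \<open>The quotient by \<open>\<psi>\<close> is close to 1 at the points expressing
        \<open>h\<close>, which is the form in which \<open>L\<close> applies.\<close>
      have ch: "character G (\<lambda>x. \<phi> x * inverse (\<psi> x))"
        using \<phi>(1) \<psi>(1) by (intro character_on_times character_on_inverse)
      have "near \<sigma> (\<phi> (s j) * inverse (\<psi> (s j))) 1" if "j < K" for j
      proof -
        have nz: "\<psi> (s j) \<noteq> 0" using character_on_nonzero[OF \<psi>(1) sc] .
        have "near (\<sigma> + 0) (\<phi> (s j) * inverse (\<psi> (s j))) (\<psi> (s j) * inverse (\<psi> (s j)))"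
          using \<phi>(2) that unfolding \<sigma>_def[symmetric] by (intro near_mult) auto
        then show ?thesis using nz by simp
      qed
      then have "near \<sigma> (\<phi> f * inverse (\<psi> f)) 1" if "f \<in> s ` {..<K0}" for f
        using that by (auto simp: K_def)
      then have "near (L * \<sigma>) (\<phi> h * inverse (\<psi> h)) 1" by (rule L[OF ch])
      then have "near (L * \<sigma> + 0) ((\<phi> h * inverse (\<psi> h)) * \<psi> h) (1 * \<psi> h)"
        by (intro near_mult) auto
      then have "near (L * \<sigma>) (\<phi> h) (\<psi> h)"
        using character_on_nonzero[OF \<psi>(1) hc] by (simp add: mult.assoc)
      moreover have "L * \<sigma> \<le> \<eta>"
      proof -
        have "L * \<sigma> \<le> L * (\<epsilon> 0 * (1/2) ^ K)"
          unfolding \<sigma>_def using \<delta>_sum[of 0 K] by (intro mult_left_mono) auto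
        also have "\<dots> < \<eta>" using K1[of K] by (simp add: K_def)
        finally show ?thesis by simp
      qed
      ultimately have "near \<eta> (\<phi> h) (\<psi> h)" using near_mono by blast
      moreover have "near (\<epsilon> k) (\<phi> (s k)) (t k)" if "k \<in> J" for k
      proof -
        have "(\<Sum>i\<in>{k..<max K n}. \<delta> i) \<le> \<epsilon> k * (1/2) ^ k" by (rule \<delta>_sum) simp
        also have "\<dots> \<le> \<epsilon> k" using \<epsilon>[of k] by (simp add: power_le_one mult_left_le)
        finally have "(\<Sum>i\<in>{k..<max K n}. \<delta> i) \<le> \<epsilon> k" .
        moreover have "k \<in> {K..<max K n}" using that J(2) n by auto
        ultimately show ?thesis using \<phi>(3) near_mono by blast
      qed
      ultimately show "\<exists>\<phi>. character G \<phi> \<and> near \<eta> (\<phi> h) (\<psi> h) \<and> (\<forall>i\<in>J. near (\<epsilon> i) (\<phi> (s i)) (t i))"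
        using \<phi>(1) by blast
    qed
    then have "\<exists>\<phi>. character G \<phi> \<and> (h \<noteq> \<one> \<longrightarrow> \<phi> h \<noteq> 1) \<and> (\<forall>k\<ge>K. near (\<epsilon> k) (\<phi> (s k)) (t k))"
      if "\<forall>k. cmod (t k) = 1" for t
      using that \<psi>(3) by (metis atLeast_iff)
    then show ?thesis by (intro exI[of _ K]) blast
  qed
  with sS show ?thesis using that by blast
qed

text \<open>
  For uncountable \<open>P\<close> the points chosen so far generate a subgroup of size less than \<open>|P|\<close>, so the next point can be chosen of large order modulo that subgroup and no earlier value
  has to be disturbed.
\<close>

lemma interpolation_uncountable:
  fixes P :: "'p set" and \<epsilon> :: "'p \<Rightarrow> real"
  assumes P: "\<not> countable P" and \<epsilon>: "\<And>p. p \<in> P \<Longrightarrow> \<epsilon> p > 0"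
    and S: "S \<subseteq> carrier G" "\<And>n::nat. n \<ge> 1 \<Longrightarrow> |P| \<le>o |multiples G n S|"
  obtains s :: "'p \<Rightarrow> 'a" where "s ` P \<subseteq> S"
    "\<And>h. h \<in> generate G (s ` P) \<Longrightarrow> \<exists>Z\<subseteq>P. |Z| <o |P| \<and> (\<forall>t. (\<forall>p\<in>P. cmod (t p) = 1) \<longrightarrow>
       (\<exists>\<phi>. character G \<phi> \<and> (h \<noteq> \<one> \<longrightarrow> \<phi> h \<noteq> 1) \<and> (\<forall>p\<in>P - Z. near (\<epsilon> p) (\<phi> (s p)) (t p))))"
proof -
  have infP: "infinite P" using P countable_finite by blast
  \<comment> \<open>As a cardinal, \<open>r\<close> well-orders \<open>P\<close> so that every
    proper initial segment is smaller than \<open>P\<close>.\<close>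
  define r where "r = |P|"
  have co: "Card_order r" and F [simp]: "Field r = P" by (simp_all add: r_def card_of_Card_order Field_card_of)
  have "\<not> |P| \<le>o |UNIV :: nat set|"
    using P by (auto simp: card_of_ordLeq[symmetric] countable_def)
  then have natP: "|UNIV :: nat set| <o |P|"
    using not_ordLeq_iff_ordLess[OF card_of_Well_order card_of_Well_order] by blast
  have wo: "Well_order r" unfolding r_def by (rule card_of_Well_order)
  have tr: "trans r" "Refl r" "Total r" "antisym r" and wf: "wf (r - Id)"
    using wo by (auto simp: well_order_on_def linear_order_on_def partial_order_on_def preorder_on_def)
  have small: "|underS r p| <o |P|" if "p \<in> P" for p
    using card_of_underS[OF co, of p] that by (simp add: r_def)
  define N where "N p = (SOME n::nat. pi / \<epsilon> p \<le> n)" for p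
  have N: "pi / \<epsilon> p \<le> N p" for p
    unfolding N_def using real_arch_simple by (rule someI_ex)
  \<comment> \<open>The order of the new point modulo the earlier ones is to exceed
    \<open>N p\<close>. Every positive exponent up to \<open>N p\<close> divides the factorial, so
    excluding one power excludes them all.\<close>
  define Q where "Q s p x \<longleftrightarrow> (p \<in> P \<longrightarrow> x \<in> S \<and> x [^] (fact (N p) :: nat) \<notin> generate G (s ` underS r p))"
    for s :: "'p \<Rightarrow> 'a" and p x
  have "\<exists>s. \<forall>p. Q s p (s p)"
  proof (rule dependent_wf_choice[OF wf])
    fix f g :: "'p \<Rightarrow> 'a" and p x assume "\<And>q. (q, p) \<in> r - Id \<Longrightarrow> f q = g q"
    then have "f ` underS r p = g ` underS r p" by (intro image_cong) (auto simp: underS_def)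
    then show "Q f p x = Q g p x" by (simp add: Q_def)
  next
    fix p and f :: "'p \<Rightarrow> 'a" assume f: "\<And>q. (q, p) \<in> r - Id \<Longrightarrow> Q f q (f q)"
    show "\<exists>x. Q f p x"
    proof (cases "p \<in> P")
      case True
      have "f q \<in> S" if "q \<in> underS r p" for q
      proof -
        have "q \<in> P" using that F unfolding underS_def Field_def by blast
        then show ?thesis using f[of q] that by (auto simp: Q_def underS_def)
      qed
      then have c: "f ` underS r p \<subseteq> carrier G" using S(1) by blast
      \<comment> \<open>The summand of natural numbers gives an infinite bound even over a finite
        initial segment; it stays below \<open>|P|\<close> because \<open>P\<close> is
        uncountable.\<close>
      have U: "|underS r p <+> (UNIV :: nat set)| <o |P|"
        by (rule card_of_Plus_ordLess_infinite[OF infP small[OF True] natP])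
      have "|f ` underS r p| \<le>o |underS r p <+> (UNIV :: nat set)|"
        using card_of_image card_of_Plus1 ordLeq_transitive by blast
      then have "|generate G (f ` underS r p)| \<le>o |underS r p <+> (UNIV :: nat set)|"
        by (rule card_of_generate[OF c]) simp
      then have "|generate G (f ` underS r p)| <o |P|" using U ordLeq_ordLess_trans by blast
      moreover have "|P| \<le>o |multiples G (fact (N p)) S|" by (rule S(2)) (simp add: fact_ge_1)
      ultimately have "|generate G (f ` underS r p)| <o |multiples G (fact (N p)) S|"
        using ordLess_ordLeq_trans by blast
      then have "\<not> multiples G (fact (N p)) S \<subseteq> generate G (f ` underS r p)"
        using card_of_mono1 not_ordLess_ordLeq by blast
      then show ?thesis by (auto simp: multiples_def Q_def)
    qed (simp add: Q_def)
  qed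
  then obtain s where s: "\<And>p. Q s p (s p)" by blast
  have sS: "s ` P \<subseteq> S" using s by (auto simp: Q_def)
  have sc: "s p \<in> carrier G" if "p \<in> P" for p using sS S(1) that by auto
  have "\<exists>Z\<subseteq>P. |Z| <o |P| \<and> (\<forall>t. (\<forall>p\<in>P. cmod (t p) = 1) \<longrightarrow>
       (\<exists>\<phi>. character G \<phi> \<and> (h \<noteq> \<one> \<longrightarrow> \<phi> h \<noteq> 1) \<and> (\<forall>p\<in>P - Z. near (\<epsilon> p) (\<phi> (s p)) (t p))))"
    if h: "h \<in> generate G (s ` P)" for h
  proof -
    have hc: "h \<in> carrier G" using h generate_in_carrier[of "s ` P"] sc by blast
    obtain F where F': "finite F" "F \<subseteq> s ` P" "h \<in> generate G F" using generate_finite_subset[OF h] by metis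
    then obtain M where "M \<subseteq> P" "finite M" "F = s ` M" by (meson finite_subset_image)
    then have M: "finite M" "M \<subseteq> P" "h \<in> generate G (s ` M)" using F'(3) by auto
    \<comment> \<open>This initial segment contains the points that express \<open>h\<close>. The
      character detecting \<open>h\<close> is kept unchanged on it, and targets are met only beyond
      it.\<close>
    define Z where "Z = (\<Union>q\<in>M. insert q (underS r q))"
    have ZP: "Z \<subseteq> P" using M(2) F unfolding Z_def underS_def Field_def by blast
    have Z: "|Z| <o |P|"
      unfolding Z_def using M(1,2)
    proof (induction M)
      case empty
      have "P \<noteq> {}" using infP by auto
      then show ?case by (simp add: card_of_empty4)
    next
      case (insert q M)
      have "|{q}| <o |P|" using infP by (intro finite_ordLess_infinite) (auto simp: card_of_Well_order Field_card_of)
      moreover have "|underS r q| <o |P|" using small insert.prems by simp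
      ultimately have "|{q} \<union> underS r q| <o |P|" by (rule card_of_Un_ordLess_infinite[OF infP])
      moreover have "|\<Union>q\<in>M. insert q (underS r q)| <o |P|" using insert.IH insert.prems by simp
      ultimately have "|({q} \<union> underS r q) \<union> (\<Union>q\<in>M. insert q (underS r q))| <o |P|"
        by (rule card_of_Un_ordLess_infinite[OF infP])
      then show ?case by simp
    qed
    have down: "q \<in> Z" if "p \<in> Z" "(q, p) \<in> r" for p q
      using that tr(1) unfolding Z_def underS_def by (blast dest: transD)
    have MZ: "M \<subseteq> Z" by (auto simp: Z_def)
    obtain \<psi> \<eta> where \<psi>: "character G \<psi>" "\<And>z. near \<eta> z (\<psi> h) \<Longrightarrow> h \<noteq> \<one> \<Longrightarrow> z \<noteq> 1" "\<eta> > 0"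
      using character_detects[OF hc] by metis
    have "\<exists>\<phi>. character G \<phi> \<and> near \<eta> (\<phi> h) (\<psi> h) \<and> (\<forall>p\<in>P - Z. near (\<epsilon> p) (\<phi> (s p)) (t p))"
      if t: "\<forall>p\<in>P. cmod (t p) = 1" for t
    proof (rule character_interpolation_compact[OF hc])
      show "s p \<in> carrier G" if "p \<in> P - Z" for p using sc that by blast
      \<comment> \<open>The greatest element of \<open>J\<close> is treated last: its value is
        chosen over the subgroup generated by all earlier points, so the values on \<open>Z\<close>
        and on the rest of \<open>J\<close> persist.\<close>
      have fin: "\<exists>\<phi>. character G \<phi> \<and> (\<forall>z\<in>Z. \<phi> (s z) = \<psi> (s z)) \<and> (\<forall>p\<in>J. near (\<epsilon> p) (\<phi> (s p)) (t p))"
        if "finite J" "J \<subseteq> P - Z" for J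
        using that
      proof (induction "card J" arbitrary: J)
        case 0
        then show ?case using \<psi>(1) by auto
      next
        case (Suc n)
        then have "J \<noteq> {}" "J \<subseteq> Field r" by auto
        then obtain p where p: "p \<in> J" "\<And>q. q \<in> J \<Longrightarrow> (q, p) \<in> r"
          using finite_has_greatest[OF Suc.prems(1) _ _ wo] by metis
        have pP: "p \<in> P" "p \<notin> Z" using p(1) Suc.prems(2) by auto
        have "n = card (J - {p})" using Suc.hyps(2) p(1) Suc.prems(1) by simp
        then obtain \<phi> where \<phi>: "character G \<phi>" "\<forall>z\<in>Z. \<phi> (s z) = \<psi> (s z)"
          "\<forall>q\<in>J - {p}. near (\<epsilon> q) (\<phi> (s q)) (t q)"
          using Suc.hyps(1)[of "J - {p}"] Suc.prems by auto
        define E where "E = generate G (s ` underS r p)"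
        have "underS r p \<subseteq> P" using F unfolding underS_def Field_def by blast
        then have c: "s ` underS r p \<subseteq> carrier G" using sc by blast
        have E: "subgroup E G" unfolding E_def using c by (rule generate_is_subgroup)
        have inE: "s q \<in> E" if "q \<in> underS r p" for q
          unfolding E_def using that by (intro generate.incl) auto
        have "s p [^] j \<notin> E" if j: "0 < j" "j \<le> N p" for j
        proof
          assume "s p [^] j \<in> E"
          moreover have "j dvd fact (N p)" using j by (intro dvd_fact) auto
          then obtain i where "fact (N p) = j * i" by blast
          ultimately have "s p [^] (fact (N p) :: nat) \<in> E"
            using nat_pow_in_subgroup[OF E, of "s p [^] j" i] sc[OF pP(1)] by (simp add: nat_pow_pow)
          then show False using s[of p] pP(1) by (simp add: Q_def E_def)
        qed
        then obtain \<xi> where \<xi>: "character G \<xi>" "\<And>x. x \<in> E \<Longrightarrow> \<xi> x = \<phi> x" "near (\<epsilon> p) (\<xi> (s p)) (t p)"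
          using character_extend_near[OF E character_on_mono[OF \<phi>(1) subgroup.subset[OF E]] sc[OF pP(1)] _ _ N \<epsilon>[OF pP(1)]]
            t pP(1) by metis
        have "z \<in> underS r p" if "z \<in> Z" for z
        proof -
          have "z \<noteq> p" "z \<in> P" using that pP(2) ZP by auto
          then have "(z, p) \<in> r \<or> (p, z) \<in> r" using tr(3) pP(1) by (auto simp: total_on_def)
          then show ?thesis using down[OF that, of p] pP(2) \<open>z \<noteq> p\<close> by (auto simp: underS_def)
        qed
        then have "\<forall>z\<in>Z. \<xi> (s z) = \<psi> (s z)" using \<xi>(2) inE \<phi>(2) by simp
        moreover have "near (\<epsilon> q) (\<xi> (s q)) (t q)" if "q \<in> J" for q
        proof (cases "q = p")
          case False
          then have "q \<in> underS r p" using p(2)[OF that] by (simp add: underS_def)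
          then show ?thesis using \<xi>(2) inE \<phi>(3) False that by simp
        qed (use \<xi>(3) in simp)
        ultimately show ?case using \<xi>(1) by blast
      qed
      fix J assume "finite J" "J \<subseteq> P - Z"
      then obtain \<phi> where \<phi>: "character G \<phi>" "\<forall>z\<in>Z. \<phi> (s z) = \<psi> (s z)" "\<forall>p\<in>J. near (\<epsilon> p) (\<phi> (s p)) (t p)"
        using fin by blast
      have "\<phi> h = \<psi> h"
        using \<phi>(2) MZ M sc by (intro character_eq_on_generate[OF \<phi>(1) \<psi>(1) _ _ M(3)]) auto
      then show "\<exists>\<phi>. character G \<phi> \<and> near \<eta> (\<phi> h) (\<psi> h) \<and> (\<forall>p\<in>J. near (\<epsilon> p) (\<phi> (s p)) (t p))"
        using \<phi> \<psi>(3) by (intro exI[of _ \<phi>]) (simp add: near_refl)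
    qed
    then have "\<exists>\<phi>. character G \<phi> \<and> (h \<noteq> \<one> \<longrightarrow> \<phi> h \<noteq> 1) \<and> (\<forall>p\<in>P - Z. near (\<epsilon> p) (\<phi> (s p)) (t p))"
      if "\<forall>p\<in>P. cmod (t p) = 1" for t
      using that \<psi>(2) by metis
    then show ?thesis using Z ZP by (intro exI[of _ Z] conjI allI impI) simp_all
  qed
  with sS show ?thesis using that by blast
qed

text \<open>In the countable case finitely many points may already generate a subgroup as large as
  \<open>P\<close>, so the perturbation argument takes over; \<open>Z\<close> is then a finite piece
  of an enumeration.\<close>

theorem interpolation:
  fixes P :: "'p set" and \<epsilon> :: "'p \<Rightarrow> real"
  assumes P: "infinite P" and \<epsilon>: "\<And>p. p \<in> P \<Longrightarrow> \<epsilon> p > 0"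
    and S: "S \<subseteq> carrier G" "\<And>n::nat. n \<ge> 1 \<Longrightarrow> |P| \<le>o |multiples G n S|"
  obtains s :: "'p \<Rightarrow> 'a" where "s ` P \<subseteq> S"
    "\<And>h. h \<in> generate G (s ` P) \<Longrightarrow> \<exists>Z\<subseteq>P. |Z| <o |P| \<and> (\<forall>t. (\<forall>p\<in>P. cmod (t p) = 1) \<longrightarrow>
       (\<exists>\<phi>. character G \<phi> \<and> (h \<noteq> \<one> \<longrightarrow> \<phi> h \<noteq> 1) \<and> (\<forall>p\<in>P - Z. near (\<epsilon> p) (\<phi> (s p)) (t p))))"
proof (cases "countable P")
  case False
  show ?thesis
  proof (rule interpolation_uncountable[where \<epsilon> = \<epsilon>, OF False _ S(1)])
    show "\<epsilon> p > 0" if "p \<in> P" for p using \<epsilon>[OF that] .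
    show "|P| \<le>o |multiples G n S|" if "n \<ge> 1" for n :: nat using S(2)[OF that] .
  qed (rule that)
next
  case True
  have b: "bij_betw (from_nat_into P) UNIV P" "bij_betw (to_nat_on P) P UNIV"
    using True P by (simp_all add: bij_betw_from_nat_into to_nat_on_infinite)
  have in_P: "from_nat_into P k \<in> P" for k using b(1) by (auto simp: bij_betw_def)
  have inf: "infinite (multiples G n S)" if "n \<ge> 1" for n :: nat
    using S(2)[OF that] P card_of_ordLeq_infinite by blast
  obtain s :: "nat \<Rightarrow> 'a" where s: "range s \<subseteq> S"
    "\<And>h. h \<in> generate G (range s) \<Longrightarrow> \<exists>K. \<forall>t. (\<forall>k. cmod (t k) = 1) \<longrightarrow>
       (\<exists>\<phi>. character G \<phi> \<and> (h \<noteq> \<one> \<longrightarrow> \<phi> h \<noteq> 1) \<and> (\<forall>k\<ge>K. near (\<epsilon> (from_nat_into P k)) (\<phi> (s k)) (t k)))"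
    using interpolation_sequence[OF S(1) inf, of "\<lambda>k. \<epsilon> (from_nat_into P k)"] \<epsilon> in_P by metis
  define s' where "s' p = s (to_nat_on P p)" for p
  have img: "s' ` P = range s"
    using b(2) image_comp[of s "to_nat_on P" P] by (simp add: s'_def bij_betw_def comp_def)
  show ?thesis
  proof (rule that[of s'])
    show "s' ` P \<subseteq> S" using img s(1) by simp
    fix h assume "h \<in> generate G (s' ` P)"
    then obtain K where K: "\<And>t. (\<forall>k. cmod (t k) = 1) \<Longrightarrow> \<exists>\<phi>. character G \<phi> \<and> (h \<noteq> \<one> \<longrightarrow> \<phi> h \<noteq> 1) \<and>
        (\<forall>k\<ge>K. near (\<epsilon> (from_nat_into P k)) (\<phi> (s k)) (t k))"
      using s(2) img by metis
    define Z where "Z = from_nat_into P ` {..<K}"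
    have "finite Z" by (simp add: Z_def)
    then have "|Z| <o |P|" using P by (intro finite_ordLess_infinite) (auto simp: card_of_Well_order Field_card_of)
    moreover have "Z \<subseteq> P" using in_P by (auto simp: Z_def)
    moreover have "\<exists>\<phi>. character G \<phi> \<and> (h \<noteq> \<one> \<longrightarrow> \<phi> h \<noteq> 1) \<and> (\<forall>p\<in>P - Z. near (\<epsilon> p) (\<phi> (s' p)) (t p))"
      if t: "\<forall>p\<in>P. cmod (t p) = 1" for t
    proof -
      obtain \<phi> where \<phi>: "character G \<phi>" "h \<noteq> \<one> \<longrightarrow> \<phi> h \<noteq> 1"
        "\<forall>k\<ge>K. near (\<epsilon> (from_nat_into P k)) (\<phi> (s k)) (t (from_nat_into P k))"
        using K[of "\<lambda>k. t (from_nat_into P k)"] t in_P by blast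
      have "near (\<epsilon> p) (\<phi> (s' p)) (t p)" if p: "p \<in> P - Z" for p
      proof -
        have eq: "from_nat_into P (to_nat_on P p) = p" using p True by simp
        then have "to_nat_on P p \<ge> K" using p unfolding Z_def by (metis DiffE imageI lessThan_iff not_le)
        then show ?thesis using \<phi>(3) eq by (auto simp: s'_def)
      qed
      then show ?thesis using \<phi> by blast
    qed
    ultimately show "\<exists>Z\<subseteq>P. |Z| <o |P| \<and> (\<forall>t. (\<forall>p\<in>P. cmod (t p) = 1) \<longrightarrow>
       (\<exists>\<phi>. character G \<phi> \<and> (h \<noteq> \<one> \<longrightarrow> \<phi> h \<noteq> 1) \<and> (\<forall>p\<in>P - Z. near (\<epsilon> p) (\<phi> (s' p)) (t p))))"
      by (intro exI[of _ Z] conjI allI impI) simp_all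
  qed
qed

end

section \<open>Precompact topologies\<close>

context comm_group
begin

text \<open>Evaluation embeds \<open>G\<close> into a power of the circle, and \<open>T\<close> is
  pulled back along it. A basic neighbourhood constrains finitely many coordinates, hence the finite
  sets \<open>F\<close> in the density assumption.\<close>

theorem precompact_from_characters:
  fixes X :: "'x set" and \<phi> :: "'x \<Rightarrow> 'a \<Rightarrow> complex"
  assumes \<phi>: "\<And>x. x \<in> X \<Longrightarrow> character G (\<phi> x)"
    and sep: "\<And>g. g \<in> carrier G \<Longrightarrow> (\<And>x. x \<in> X \<Longrightarrow> \<phi> x g = 1) \<Longrightarrow> g = \<one>"
    and S: "S \<subseteq> carrier G"
    and dense: "\<And>F v e. finite F \<Longrightarrow> F \<subseteq> X \<Longrightarrow> (\<And>x. x \<in> F \<Longrightarrow> cmod (v x) = 1) \<Longrightarrow> e > 0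
      \<Longrightarrow> \<exists>s\<in>S. \<forall>x\<in>F. dist (\<phi> x s) (v x) < e"
  shows "\<exists>T. precompact_group_topology G T \<and> dense_in_topology T S"
proof -
  define C :: "complex topology" where "C = top_of_set (sphere 0 1)"
  define U where "U = product_topology (\<lambda>_::'x. C) X"
  define K :: "('x \<Rightarrow> complex) monoid" where
    "K = \<lparr>carrier = X \<rightarrow>\<^sub>E sphere 0 1, mult = (\<lambda>f g. \<lambda>x\<in>X. f x * g x), one = (\<lambda>x\<in>X. 1)\<rparr>"
  define \<pi> where "\<pi> g = (\<lambda>x\<in>X. \<phi> x g)" for g
  define T where "T = pullback_topology (carrier G) \<pi> U"
  have topU: "topspace U = carrier K" by (simp add: U_def K_def C_def)
  have cnj_mult: "cnj z * z = 1" if "cmod z = 1" for z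
    using complex_norm_square[of z] that by (simp add: mult.commute)
  have inv_ex: "(\<lambda>x\<in>X. cnj (f x)) \<in> carrier K \<and> (\<lambda>x\<in>X. cnj (f x)) \<otimes>\<^bsub>K\<^esub> f = \<one>\<^bsub>K\<^esub>"
    if "f \<in> carrier K" for f
    using that by (auto simp: K_def PiE_iff fun_eq_iff restrict_def extensional_def cnj_mult)
  have grpK: "group K"
  proof (rule groupI)
    show "f \<otimes>\<^bsub>K\<^esub> g \<in> carrier K" if "f \<in> carrier K" "g \<in> carrier K" for f g
      using that by (auto simp: K_def PiE_iff norm_mult)
    show "\<one>\<^bsub>K\<^esub> \<in> carrier K" by (auto simp: K_def)
    show "f \<otimes>\<^bsub>K\<^esub> g \<otimes>\<^bsub>K\<^esub> h = f \<otimes>\<^bsub>K\<^esub> (g \<otimes>\<^bsub>K\<^esub> h)" for f g h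
      by (auto simp: K_def fun_eq_iff restrict_def)
    show "\<one>\<^bsub>K\<^esub> \<otimes>\<^bsub>K\<^esub> f = f" if "f \<in> carrier K" for f
      using that by (auto simp: K_def PiE_iff fun_eq_iff restrict_def extensional_def)
    show "\<exists>g\<in>carrier K. g \<otimes>\<^bsub>K\<^esub> f = \<one>\<^bsub>K\<^esub>" if "f \<in> carrier K" for f
      using inv_ex[OF that] by blast
  qed
  interpret K: group K by (rule grpK)
  have invK: "inv\<^bsub>K\<^esub> f = (\<lambda>x\<in>X. cnj (f x))" if "f \<in> carrier K" for f
    using inv_ex[OF that] that by (intro K.inv_equality) auto
  have proj: "continuous_map U euclidean (\<lambda>f. f x)" if "x \<in> X" for x
    using continuous_map_product_projection[OF that, of "\<lambda>_. C"]
    by (simp add: U_def C_def continuous_map_in_subtopology)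
  have topK: "group_topology K U"
    unfolding group_topology_def
  proof (intro conjI)
    have top2: "topspace (prod_topology U U) = carrier K \<times> carrier K" using topU by simp
    have "continuous_map (prod_topology U U) U (\<lambda>p. \<lambda>x\<in>X. fst p x * snd p x)"
      unfolding U_def continuous_map_componentwise
    proof (intro conjI ballI)
      fix x assume x: "x \<in> X"
      have c: "continuous_map (prod_topology U U) euclidean (\<lambda>p. fst p x * snd p x)"
        using continuous_map_compose[OF continuous_map_fst proj[OF x]]
          continuous_map_compose[OF continuous_map_snd proj[OF x]]
        by (intro continuous_map_normed_mult) (auto simp: o_def)
      have "cmod (fst p x * snd p x) = 1" if "p \<in> topspace (prod_topology U U)" for p
        using that x unfolding top2 by (auto simp: K_def norm_mult PiE_iff)
      then have "continuous_map (prod_topology U U) C (\<lambda>p. fst p x * snd p x)"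
        using c by (auto simp: C_def continuous_map_in_subtopology)
      then show "continuous_map (prod_topology (product_topology (\<lambda>_. C) X) (product_topology (\<lambda>_. C) X)) C
          (\<lambda>p. (\<lambda>x\<in>X. fst p x * snd p x) x)"
        using x by (simp add: U_def)
    qed auto
    then show "continuous_map (prod_topology U U) U (\<lambda>(f, g). f \<otimes>\<^bsub>K\<^esub> g)"
      by (simp add: K_def case_prod_unfold)
    have "continuous_map U U (\<lambda>f. \<lambda>x\<in>X. cnj (f x))"
      unfolding U_def continuous_map_componentwise
    proof (intro conjI ballI)
      fix x assume x: "x \<in> X"
      have "continuous_map U euclidean (\<lambda>f. cnj (f x))"
        using proj[OF x] by (simp add: continuous_map_atin tendsto_cnj)
      then have "continuous_map U C (\<lambda>f. cnj (f x))"
        using x by (auto simp: C_def continuous_map_in_subtopology topU K_def PiE_iff)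
      then show "continuous_map (product_topology (\<lambda>_. C) X) C (\<lambda>f. (\<lambda>x\<in>X. cnj (f x)) x)"
        using x by (simp add: U_def)
    qed auto
    then show "continuous_map U U (\<lambda>f. inv\<^bsub>K\<^esub> f)"
      by (rule continuous_map_eq) (simp add: topU invK)
  qed (use topU grpK in auto)
  have compU: "compact_space U" "Hausdorff_space U"
    by (auto simp: U_def C_def compact_space_product_topology compact_space_subtopology
        Hausdorff_space_product_topology Hausdorff_space_subtopology)
  have hom: "\<pi> \<in> hom G K"
    using character_on_norm[OF \<phi>] character_on_mult[OF \<phi>]
    by (auto simp: hom_def \<pi>_def K_def fun_eq_iff restrict_def)
  interpret \<pi>: group_hom G K \<pi>
    using hom grpK by (simp add: group_hom_def group_hom_axioms_def group_axioms)
  define H where "H = \<pi> ` carrier G"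
  have H: "subgroup H K" unfolding H_def by (rule \<pi>.img_is_subgroup)
  have inj: "inj_on \<pi> (carrier G)"
  proof (rule \<pi>.inj_on_one_iff[THEN iffD2, rule_format])
    fix g assume g: "g \<in> carrier G" "\<pi> g = \<one>\<^bsub>K\<^esub>"
    show "g = \<one>"
    proof (rule sep[OF g(1)])
      show "\<phi> x g = 1" if "x \<in> X" for x
        using fun_cong[OF g(2), of x] that by (simp add: \<pi>_def K_def)
    qed
  qed
  have \<pi>K: "\<pi> g \<in> carrier K" if "g \<in> carrier G" for g using that by (rule \<pi>.hom_closed)
  have topT: "topspace T = carrier G"
    using \<pi>K by (auto simp: T_def topspace_pullback_topology topU)
  have openT: "openin T A \<longleftrightarrow> (\<exists>V. openin U V \<and> A = \<pi> -` V \<inter> carrier G)" for A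
    by (simp add: T_def openin_pullback_topology)
  have cont\<pi>: "continuous_map T U \<pi>"
    using continuous_map_pullback[of U U id "carrier G" \<pi>] by (simp add: T_def)
  have into_T: "continuous_map Y T f" if "continuous_map Y U (\<lambda>y. \<pi> (f y))" "f ` topspace Y \<subseteq> carrier G" for Y f
    unfolding T_def using that by (intro continuous_map_pullback') (auto simp: o_def)
  have topG: "group_topology G T"
    unfolding group_topology_def
  proof (intro conjI)
    have "continuous_map (prod_topology T T) (prod_topology U U) (\<lambda>p. (\<pi> (fst p), \<pi> (snd p)))"
      by (intro continuous_map_pairedI continuous_map_compose[OF continuous_map_fst cont\<pi>, unfolded o_def]
          continuous_map_compose[OF continuous_map_snd cont\<pi>, unfolded o_def])
    then have "continuous_map (prod_topology T T) U (\<lambda>p. \<pi> (fst p) \<otimes>\<^bsub>K\<^esub> \<pi> (snd p))"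
      using topK by (auto dest: continuous_map_compose simp: group_topology_def o_def)
    then have "continuous_map (prod_topology T T) U (\<lambda>p. \<pi> (fst p \<otimes> snd p))"
      by (rule continuous_map_eq) (auto simp: topT)
    then have "continuous_map (prod_topology T T) T (\<lambda>p. fst p \<otimes> snd p)"
      by (rule into_T) (auto simp: topT)
    then show "continuous_map (prod_topology T T) T (\<lambda>(x, y). x \<otimes> y)" by (simp add: case_prod_unfold)
    have "continuous_map T U (\<lambda>g. inv\<^bsub>K\<^esub> (\<pi> g))"
      using continuous_map_compose[OF cont\<pi>, of U "m_inv K"] topK by (simp add: group_topology_def o_def)
    then have "continuous_map T U (\<lambda>g. \<pi> (inv g))"
      by (rule continuous_map_eq) (auto simp: topT)
    then show "continuous_map T T (\<lambda>g. inv g)" by (rule into_T) (auto simp: topT)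
  qed (auto simp: topT group_axioms)
  have "homeomorphic_map T (subtopology U H) \<pi>"
  proof (rule bijective_open_imp_homeomorphic_map)
    show "continuous_map T (subtopology U H) \<pi>"
      using cont\<pi> by (auto simp: continuous_map_in_subtopology topT H_def)
    show "open_map T (subtopology U H) \<pi>"
      unfolding open_map_def
    proof (intro allI impI)
      fix A assume "openin T A"
      then obtain V where V: "openin U V" "A = \<pi> -` V \<inter> carrier G" using openT by blast
      then have "\<pi> ` A = V \<inter> H" by (auto simp: H_def)
      then show "openin (subtopology U H) (\<pi> ` A)" using V(1) by (auto simp: openin_subtopology)
    qed
    show "\<pi> ` topspace T = topspace (subtopology U H)"
      using \<pi>K by (auto simp: topT H_def topU)
    show "inj_on \<pi> (topspace T)" using inj by (simp add: topT)
  qed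
  moreover have "\<pi> \<in> iso G (K\<lparr>carrier := H\<rparr>)"
    using inj \<pi>.hom_mult by (auto simp: iso_def hom_def bij_betw_def H_def)
  ultimately have "topological_group_iso G T (K\<lparr>carrier := H\<rparr>) (subtopology U H) \<pi>"
    by (simp add: topological_group_iso_def)
  then have "precompact_group_topology G T"
    by (rule precompact_group_topologyI[OF topG topK compU H])
  moreover have "dense_in_topology T S"
    unfolding dense_in_topology_def
  proof (intro conjI)
    show "S \<subseteq> topspace T" using S topT by simp
    show "T closure_of S = topspace T"
    proof (rule antisym[OF closure_of_subset_topspace], rule subsetI)
      fix g assume g: "g \<in> topspace T"
      show "g \<in> T closure_of S"
        unfolding in_closure_of
      proof (intro conjI g allI impI)
        fix A assume A: "g \<in> A \<and> openin T A"
        then obtain V where V: "openin U V" "A = \<pi> -` V \<inter> carrier G" using openT by blast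
        then have "\<pi> g \<in> V" using A by blast
        then obtain W where W: "finite {x \<in> X. W x \<noteq> topspace C}" "\<And>x. x \<in> X \<Longrightarrow> openin C (W x)"
          "\<pi> g \<in> PiE X W" "PiE X W \<subseteq> V"
          using V(1) unfolding U_def openin_product_topology_alt by meson
        define F where "F = {x \<in> X. W x \<noteq> topspace C}"
        have gW: "\<phi> x g \<in> W x" if "x \<in> X" for x using W(3) that by (auto simp: \<pi>_def PiE_iff)
        have "\<exists>d>0. \<forall>z. cmod z = 1 \<and> dist z (\<phi> x g) < d \<longrightarrow> z \<in> W x" if x: "x \<in> X" for x
        proof -
          obtain O' where O': "open O'" "W x = sphere 0 1 \<inter> O'"
            using W(2)[OF x] by (auto simp: C_def openin_open)
          then obtain d where "d > 0" "\<forall>z. dist z (\<phi> x g) < d \<longrightarrow> z \<in> O'"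
            using gW[OF x] unfolding open_dist by blast
          then show ?thesis using O'(2) by (intro exI[of _ d]) auto
        qed
        then obtain d where d: "\<And>x. x \<in> X \<Longrightarrow> d x > 0"
          "\<And>x z. x \<in> X \<Longrightarrow> cmod z = 1 \<Longrightarrow> dist z (\<phi> x g) < d x \<Longrightarrow> z \<in> W x" by metis
        have F: "finite F" "F \<subseteq> X" using W(1) by (auto simp: F_def)
        \<comment> \<open>Inserting 1 keeps the minimum defined when no coordinate is
          constrained.\<close>
        define e where "e = Min (insert 1 (d ` F))"
        have e: "e > 0" "\<And>x. x \<in> F \<Longrightarrow> e \<le> d x" using F d(1) by (auto simp: e_def)
        obtain s where s: "s \<in> S" "\<forall>x\<in>F. dist (\<phi> x s) (\<phi> x g) < e"
          using dense[OF F _ e(1), of "\<lambda>x. \<phi> x g"] F(2) character_on_norm[OF \<phi>] g topT by blast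
        have sc: "s \<in> carrier G" using s(1) S by blast
        have "\<phi> x s \<in> W x" if x: "x \<in> X" for x
        proof (cases "x \<in> F")
          case True
          then show ?thesis
            using d(2)[OF x character_on_norm[OF \<phi>[OF x] sc]] s(2) e(2)[OF True] by force
        next
          case False
          then show ?thesis using x character_on_norm[OF \<phi>[OF x] sc] by (auto simp: F_def C_def)
        qed
        then have "\<pi> s \<in> PiE X W" by (auto simp: \<pi>_def)
        then have "s \<in> A" using W(4) V(2) sc by auto
        then show "\<exists>y. y \<in> S \<and> y \<in> A" using s(1) by blast
      qed
    qed
  qed
  ultimately show ?thesis by blast
qed

text \<open>\<open>H\<close> need not be a direct summand; the maximal \<open>B\<close> serves in
  place of a complement.\<close>

lemma maximal_disjoint_subgroup:
  assumes H: "subgroup H G"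
  obtains B where "subgroup B G" "B \<inter> H = {\<one>}"
    "\<And>C. subgroup C G \<Longrightarrow> C \<inter> H = {\<one>} \<Longrightarrow> B \<subseteq> C \<Longrightarrow> C = B"
proof -
  define \<A> where "\<A> = {B. subgroup B G \<and> B \<inter> H = {\<one>}}"
  have "\<exists>M\<in>\<A>. \<forall>X\<in>\<A>. M \<subseteq> X \<longrightarrow> X = M"
  proof (rule subset_Zorn_nonempty)
    have "{\<one>} \<in> \<A>" using subgroup.one_closed[OF H] by (auto simp: \<A>_def triv_subgroup)
    then show "\<A> \<noteq> {}" by blast
    fix \<C> assume \<C>: "\<C> \<noteq> {}" "subset.chain \<A> \<C>"
    have \<C>\<A>: "subgroup B G" "B \<inter> H = {\<one>}" if "B \<in> \<C>" for B
      using that \<C>(2) by (auto simp: \<A>_def subset_chain_def)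
    obtain B0 where B0: "B0 \<in> \<C>" using \<C>(1) by blast
    have "subgroup (\<Union>\<C>) G"
    proof (rule subgroupI)
      show "\<Union>\<C> \<subseteq> carrier G"
        by (rule Union_least) (rule subgroup.subset[OF \<C>\<A>(1)])
      show "\<Union>\<C> \<noteq> {}" using B0 \<C>\<A>(2) by blast
      fix x assume x: "x \<in> \<Union>\<C>"
      then obtain B where "B \<in> \<C>" "x \<in> B" by blast
      then show "inv x \<in> \<Union>\<C>" using subgroup.m_inv_closed[OF \<C>\<A>(1)] by blast
      fix y assume y: "y \<in> \<Union>\<C>"
      have "finite {x, y}" "{x, y} \<subseteq> \<Union>\<C>" using x y by auto
      then obtain B where "B \<in> \<C>" "{x, y} \<subseteq> B"
        using finite_subset_Union_chain \<C> by metis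
      then show "x \<otimes> y \<in> \<Union>\<C>" using subgroup.m_closed[OF \<C>\<A>(1)] by blast
    qed
    moreover have "\<Union>\<C> \<inter> H = {\<one>}" using B0 \<C>\<A>(2) by blast
    ultimately show "\<Union>\<C> \<in> \<A>" by (simp add: \<A>_def)
  qed
  then obtain B where "B \<in> \<A>" and max: "\<And>C. C \<in> \<A> \<Longrightarrow> B \<subseteq> C \<Longrightarrow> C = B" by blast
  then show ?thesis by (intro that[of B]) (simp_all add: \<A>_def)
qed

text \<open>Detection takes place in \<open>B\<close> as a group of its own, and the characters
  found there extend to \<open>G\<close>.\<close>

lemma separating_characters_subgroup:
  fixes \<Lambda> :: "'l set"
  assumes B: "subgroup B G" and \<Lambda>: "infinite \<Lambda>" and card: "|B| \<le>o |Pow \<Lambda>|"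
  obtains \<psi> :: "'l \<Rightarrow> nat \<Rightarrow> 'a \<Rightarrow> complex" where "\<And>i k. character G (\<psi> i k)"
    "\<And>g. g \<in> B \<Longrightarrow> g \<noteq> \<one> \<Longrightarrow> \<exists>i\<in>\<Lambda>. \<exists>k. \<psi> i k g \<noteq> 1"
proof -
  let ?B = "G\<lparr>carrier := B\<rparr>"
  have Bc: "B \<subseteq> carrier G" using B by (rule subgroup.subset)
  have "comm_group ?B"
    using subgroup.subgroup_is_group[OF B group_axioms] Bc m_comm
    by (intro group.group_comm_groupI) auto
  then interpret B: comm_group ?B .
  obtain \<theta> :: "'l \<Rightarrow> nat \<Rightarrow> 'a \<Rightarrow> complex" where \<theta>: "\<And>i k. character ?B (\<theta> i k)"
    "\<And>g. g \<in> B \<Longrightarrow> g \<noteq> \<one> \<Longrightarrow> \<exists>i\<in>\<Lambda>. \<exists>k. \<theta> i k g \<noteq> 1"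
    using B.separating_characters[OF \<Lambda>] card by auto
  have "\<exists>\<psi>. character G \<psi> \<and> (\<forall>g\<in>B. \<psi> g = \<theta> i k g)" for i k
  proof -
    have "character_on G B (\<theta> i k)" using \<theta>(1)[of i k] by (simp add: character_on_def)
    then show ?thesis using character_extend[OF B] by metis
  qed
  then obtain \<psi> where "\<And>i k. character G (\<psi> i k)" "\<And>i k g. g \<in> B \<Longrightarrow> \<psi> i k g = \<theta> i k g" by metis
  then show ?thesis using \<theta>(2) that by metis
qed

text \<open>
  The target functions \<open>t i\<close> are repeated \<open>|A|\<close> times for each precision \<open>1 / (N + 1)\<close>, so that the
  fewer than \<open>|A|\<close> points of \<open>Z h\<close> on which a coordinate misses its target in order to detect \<open>h\<close> do
  no harm. Since \<open>B\<close> is a maximal subgroup with trivial intersection with \<open>H\<close>, a family of characters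
  separates the points of \<open>G\<close> as soon as it detects all elements of \<open>H\<close>, by characters trivial on \<open>B\<close>,
  and all elements of \<open>B\<close>.
\<close>

theorem dense_in_precompact_topology:
  fixes A :: "'t set"
  assumes A: "infinite A" and card: "|carrier G| \<le>o |Pow (Pow A)|"
    and S: "S \<subseteq> carrier G" "\<And>n::nat. n \<ge> 1 \<Longrightarrow> |A| \<le>o |multiples G n S|"
  shows "\<exists>T. precompact_group_topology G T \<and> dense_in_topology T S"
proof -
  \<comment> \<open>The components are the index of a target function, a precision and the label of
    a copy.\<close>
  define P where "P = A \<times> (UNIV :: nat set) \<times> A"
  have natA: "|UNIV :: nat set| \<le>o |A|" using A by (intro countable_ordLeq_infinite) auto
  have PA: "|P| \<le>o |A|"
    unfolding P_def using natA A by (intro Times_ordLeq_infinite card_of_mono1) auto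
  have "A \<noteq> {}" using A by auto
  then obtain a0 where a0: "a0 \<in> A" by blast
  have fib: "|A| \<le>o |{i} \<times> {N} \<times> A|" for i :: 't and N :: nat
    unfolding card_of_ordLeq[symmetric] by (intro exI[of _ "\<lambda>u. (i, N, u)"]) (auto simp: inj_on_def)
  have "|A| \<le>o |P|"
    using a0 by (intro ordLeq_transitive[OF fib[of a0 0] card_of_mono1]) (auto simp: P_def)
  then have infP: "infinite P" using A by (rule card_of_ordLeq_infinite)
  define \<epsilon> where "\<epsilon> p = 1 / (real (fst (snd p)) + 1)" for p :: "'t \<times> nat \<times> 't"
  have \<epsilon>: "\<epsilon> p > 0" for p by (simp add: \<epsilon>_def)
  have PS: "|P| \<le>o |multiples G n S|" if "n \<ge> 1" for n :: nat
    using PA S(2)[OF that] ordLeq_transitive by blast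
  obtain s where sS: "s ` P \<subseteq> S" and s: "\<And>h. h \<in> generate G (s ` P) \<Longrightarrow>
      \<exists>Z\<subseteq>P. |Z| <o |P| \<and> (\<forall>t. (\<forall>p\<in>P. cmod (t p) = 1) \<longrightarrow>
       (\<exists>\<phi>. character G \<phi> \<and> (h \<noteq> \<one> \<longrightarrow> \<phi> h \<noteq> 1) \<and> (\<forall>p\<in>P - Z. near (\<epsilon> p) (\<phi> (s p)) (t p))))"
    using interpolation[where \<epsilon> = \<epsilon>, OF infP \<epsilon> S(1) PS] by metis
  define H where "H = generate G (s ` P)"
  have sc: "s ` P \<subseteq> carrier G" using sS S(1) by blast
  have H: "subgroup H G" unfolding H_def using sc by (rule generate_is_subgroup)
  have sH: "s p \<in> H" if "p \<in> P" for p unfolding H_def using that by (intro generate.incl) auto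
  have HA: "|H| \<le>o |A|"
    unfolding H_def using card_of_image[of s P] PA ordLeq_transitive by (intro card_of_generate[OF sc _ A]) blast
  have "\<exists>Z. \<forall>h\<in>H. Z h \<subseteq> P \<and> |Z h| <o |P| \<and> (\<forall>t. (\<forall>p\<in>P. cmod (t p) = 1) \<longrightarrow>
       (\<exists>\<phi>. character G \<phi> \<and> (h \<noteq> \<one> \<longrightarrow> \<phi> h \<noteq> 1) \<and> (\<forall>p\<in>P - Z h. near (\<epsilon> p) (\<phi> (s p)) (t p))))"
    using s unfolding H_def by (intro bchoice) blast
  then obtain Z where Z: "\<And>h. h \<in> H \<Longrightarrow> |Z h| <o |P|"
      "\<And>h t. h \<in> H \<Longrightarrow> (\<forall>p\<in>P. cmod (t p) = 1) \<Longrightarrow>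
       \<exists>\<phi>. character G \<phi> \<and> (h \<noteq> \<one> \<longrightarrow> \<phi> h \<noteq> 1) \<and> (\<forall>p\<in>P - Z h. near (\<epsilon> p) (\<phi> (s p)) (t p))"
    by metis
  obtain B where B: "subgroup B G" "B \<inter> H = {\<one>}"
    and Bmax: "\<And>C. subgroup C G \<Longrightarrow> C \<inter> H = {\<one>} \<Longrightarrow> B \<subseteq> C \<Longrightarrow> C = B"
    using maximal_disjoint_subgroup[OF H] by metis
  have Bc: "B \<subseteq> carrier G" using B(1) by (rule subgroup.subset)
  have "|B| \<le>o |Pow (Pow A)|" using card_of_mono1[OF Bc] card ordLeq_transitive by blast
  then obtain \<psi> :: "'t set \<Rightarrow> nat \<Rightarrow> 'a \<Rightarrow> complex" where \<psi>: "\<And>j k. character G (\<psi> j k)"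
    "\<And>g. g \<in> B \<Longrightarrow> g \<noteq> \<one> \<Longrightarrow> \<exists>j\<in>Pow A. \<exists>k. \<psi> j k g \<noteq> 1"
    using separating_characters_subgroup[OF B(1), of "Pow A"] A by (metis finite_Pow_iff)
  \<comment> \<open>A coordinate carries two indices of a character for \<open>B\<close> and an
    element of \<open>H\<close> to be detected; with \<open>h = \<one>\<close> it serves to detect
    elements of \<open>B\<close> instead.\<close>
  define X where "X = Pow A \<times> (UNIV :: nat set) \<times> H"
  have APow: "|A| \<le>o |Pow A|" using card_of_Pow ordLess_imp_ordLeq by blast
  have "|X| \<le>o |Pow A|"
    unfolding X_def
  proof (intro Times_ordLeq_infinite)
    show "|Pow A| \<le>o |Pow A|" by (rule card_of_mono1) simp
    show "|UNIV :: nat set| \<le>o |Pow A|" "|H| \<le>o |Pow A|"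
      using natA HA APow by (blast intro: ordLeq_transitive)+
  qed (use A in simp_all)
  then obtain t :: "'t \<Rightarrow> 't set \<times> nat \<times> 'a \<Rightarrow> complex" where t: "\<And>i x. cmod (t i x) = 1"
    "\<And>F v e. finite F \<Longrightarrow> F \<subseteq> X \<Longrightarrow> (\<And>x. x \<in> F \<Longrightarrow> cmod (v x) = 1) \<Longrightarrow> e > 0
      \<Longrightarrow> \<exists>i\<in>A. \<forall>x\<in>F. near e (t i x) (v x)"
    using dense_circle_family[OF A] by metis
  \<comment> \<open>Coordinates with \<open>h \<noteq> \<one>\<close> are trivial on
    \<open>B\<close>, so that a factor from \<open>B\<close> cannot conceal
    \<open>h\<close>.\<close>
  define R where "R j k h \<phi> \<longleftrightarrow> character G \<phi> \<and> (h \<noteq> \<one> \<longrightarrow> \<phi> h \<noteq> 1) \<and>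
      (\<forall>p\<in>P - Z h. near (\<epsilon> p) (\<phi> (s p)) (t (fst p) (j, k, h))) \<and>
      (\<forall>b\<in>B. \<phi> b = (if h = \<one> then \<psi> j k b else 1))" for j k h \<phi>
  have R_ex: "\<exists>\<phi>. R j k h \<phi>" if h: "h \<in> H" for j k h
  proof -
    obtain \<xi> where \<xi>: "character G \<xi>" "h \<noteq> \<one> \<longrightarrow> \<xi> h \<noteq> 1"
      "\<forall>p\<in>P - Z h. near (\<epsilon> p) (\<xi> (s p)) (t (fst p) (j, k, h))"
      using Z(2)[OF h, of "\<lambda>p. t (fst p) (j, k, h)"] t(1) by blast
    have c: "character G (\<lambda>b. if h = \<one> then \<psi> j k b else 1)" using \<psi>(1) by (cases "h = \<one>") auto
    have HB: "H \<inter> B = {\<one>}" using B(2) by blast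
    obtain \<phi> where \<phi>: "character G \<phi>" "\<And>x. x \<in> H \<Longrightarrow> \<phi> x = \<xi> x"
      "\<And>b. b \<in> B \<Longrightarrow> \<phi> b = (if h = \<one> then \<psi> j k b else 1)"
      by (rule character_glue[OF H B(1) HB \<xi>(1) c]) blast
    then show ?thesis using \<xi> h sH by (intro exI[of _ \<phi>]) (auto simp: R_def)
  qed
  define \<phi> where "\<phi> j k h = (SOME f. R j k h f)" for j k h
  have "R j k h (\<phi> j k h)" if "h \<in> H" for j k h
    unfolding \<phi>_def using R_ex[OF that] by (rule someI_ex)
  then have \<phi>: "\<And>j k h. h \<in> H \<Longrightarrow> character G (\<phi> j k h)"
    "\<And>j k h. h \<in> H \<Longrightarrow> h \<noteq> \<one> \<Longrightarrow> \<phi> j k h h \<noteq> 1"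
    "\<And>j k h p. h \<in> H \<Longrightarrow> p \<in> P - Z h \<Longrightarrow> near (\<epsilon> p) (\<phi> j k h (s p)) (t (fst p) (j, k, h))"
    "\<And>j k h b. h \<in> H \<Longrightarrow> b \<in> B \<Longrightarrow> \<phi> j k h b = (if h = \<one> then \<psi> j k b else 1)"
    by (auto simp: R_def)
  have oneH: "\<one> \<in> H" using H by (rule subgroup.one_closed)
  show ?thesis
  proof (rule precompact_from_characters[where X = X and \<phi> = "\<lambda>(j, k, h). \<phi> j k h"])
    show "character G ((\<lambda>(j, k, h). \<phi> j k h) x)" if "x \<in> X" for x
      using that \<phi>(1) by (auto simp: X_def)
    show "S \<subseteq> carrier G" by (rule S(1))
  next
    fix g assume g: "g \<in> carrier G" and "\<And>x. x \<in> X \<Longrightarrow> (\<lambda>(j, k, h). \<phi> j k h) x g = 1"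
    then have ker: "\<phi> j k h g = 1" if "j \<subseteq> A" "h \<in> H" for j k h
      using that by (force simp: X_def)
    let ?C = "generate G (insert g B)"
    \<comment> \<open>Such a \<open>y\<close> is a power of \<open>g\<close> times an element of
      \<open>B\<close>. If it were not \<open>\<one>\<close>, the coordinate detecting
      \<open>y\<close> would be trivial on both factors.\<close>
    have "y = \<one>" if y: "y \<in> ?C" "y \<in> H" for y
    proof (rule ccontr)
      assume ne: "y \<noteq> \<one>"
      obtain n :: int and b where b: "b \<in> generate G B" "y = g [^] n \<otimes> b"
        using generate_insertE[OF Bc g y(1)] by metis
      then have bB: "b \<in> B" using generate_subgroup_incl[OF order_refl B(1)] by blast
      have "\<phi> {} 0 y (g [^] n) = 1"
        using character_on_int_pow[OF subgroup_self \<phi>(1)[OF y(2)] g] ker[of "{}" y] y(2) by simp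
      moreover have "\<phi> {} 0 y b = 1" using \<phi>(4)[OF y(2) bB] ne by simp
      ultimately have "\<phi> {} 0 y y = 1"
        using b(2) bB Bc g character_on_mult[OF \<phi>(1)[OF y(2)], of "g [^] n" b] by auto
      then show False using \<phi>(2)[OF y(2) ne] by simp
    qed
    then have "?C \<inter> H = {\<one>}" using oneH generate.one[of G "insert g B"] by blast
    moreover have "subgroup ?C G" using g Bc by (intro generate_is_subgroup) auto
    moreover have "B \<subseteq> ?C" by (auto intro: generate.incl)
    ultimately have "?C = B" using Bmax by blast
    then have gB: "g \<in> B" using generate.incl[of g "insert g B" G] by auto
    show "g = \<one>"
    proof (rule ccontr)
      assume "g \<noteq> \<one>"
      then obtain j k where "j \<subseteq> A" "\<psi> j k g \<noteq> 1" using \<psi>(2)[OF gB] by blast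
      then show False using ker[OF _ oneH, of j k] \<phi>(4)[OF oneH gB, of j k] by simp
    qed
  next
    fix F v and e :: real
    assume F: "finite F" "F \<subseteq> X" and v: "\<And>x. x \<in> F \<Longrightarrow> cmod (v x) = 1" and e: "e > 0"
    \<comment> \<open>One third is spent on the density of the targets and one on the precision of
      the copy, which leaves room for a strict inequality.\<close>
    have "\<exists>i\<in>A. \<forall>x\<in>F. near (e / 3) (t i x) (v x)"
    proof (rule t(2)[OF F])
      show "cmod (v x) = 1" if "x \<in> F" for x using v[OF that] .
    qed (use e in simp)
    then obtain i where i: "i \<in> A" "\<forall>x\<in>F. near (e / 3) (t i x) (v x)" by blast
    have "e / 3 > 0" using e by simp
    then obtain N where N: "1 / real (Suc N) < e / 3" by (rule nat_approx_posE)
    have "|\<Union>x\<in>F. Z (snd (snd x))| <o |P|"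
      using F
    proof (induction F)
      case empty
      have "P \<noteq> {}" using infP by auto
      then show ?case by (simp add: card_of_empty4)
    next
      case (insert x F)
      have "|Z (snd (snd x))| <o |P|" using insert.prems Z(1) by (auto simp: X_def)
      moreover have "|\<Union>x\<in>F. Z (snd (snd x))| <o |P|" using insert.IH insert.prems by simp
      ultimately have "|Z (snd (snd x)) \<union> (\<Union>x\<in>F. Z (snd (snd x)))| <o |P|"
        by (rule card_of_Un_ordLess_infinite[OF infP])
      then show ?case by simp
    qed
    \<comment> \<open>A fibre of fixed target and precision is as large as \<open>P\<close>, so
      finitely many of the smaller sets \<open>Z h\<close> cannot cover it.\<close>
    moreover have "|P| \<le>o |\<Union>x\<in>F. Z (snd (snd x))|" if "{i} \<times> {N} \<times> A \<subseteq> (\<Union>x\<in>F. Z (snd (snd x)))"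
      using ordLeq_transitive[OF ordLeq_transitive[OF PA fib[of i N]] card_of_mono1[OF that]] .
    ultimately have "\<not> {i} \<times> {N} \<times> A \<subseteq> (\<Union>x\<in>F. Z (snd (snd x)))"
      using not_ordLess_ordLeq by blast
    then obtain p where p: "p \<in> {i} \<times> {N} \<times> A" "p \<notin> (\<Union>x\<in>F. Z (snd (snd x)))" by blast
    then have pP: "p \<in> P" and pi: "fst p = i" and pN: "\<epsilon> p = 1 / real (Suc N)"
      using i(1) by (auto simp: P_def \<epsilon>_def)
    have "dist ((\<lambda>(j, k, h). \<phi> j k h) x (s p)) (v x) < e" if x: "x \<in> F" for x
    proof -
      obtain j k h where jkh: "x = (j, k, h)" "h \<in> H" using x F(2) by (auto simp: X_def)
      have "p \<in> P - Z h" using p(2) pP x jkh(1) by force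
      then have "near (\<epsilon> p) (\<phi> j k h (s p)) (t i x)" using \<phi>(3)[OF jkh(2)] pi jkh(1) by metis
      then have "near (\<epsilon> p + e / 3) (\<phi> j k h (s p)) (v x)" using i(2) x near_trans by blast
      then have "dist (\<phi> j k h (s p)) (v x) \<le> \<epsilon> p + e / 3" using near_dist v[OF x] by blast
      also have "\<dots> < e" using N e pN by simp
      finally show ?thesis by (simp add: jkh(1))
    qed
    then show "\<exists>s'\<in>S. \<forall>x\<in>F. dist ((\<lambda>(j, k, h). \<phi> j k h) x s') (v x) < e" using sS pP by blast
  qed
qed

end

section \<open>Cardinality of dense subsets\<close>

lemma ctwo_cexp_ordIso_Pow: "ctwo ^c r =o |Pow (Field r)|"
  using card_of_Pow_Func[of "Field r"]
  by (simp add: cexp_def ctwo_def Field_card_of ordIso_symmetric)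

lemma Pow_ordLeq_mono:
  assumes "|A| \<le>o |B|"
  shows "|Pow A| \<le>o |Pow B|"
proof -
  obtain f where "inj_on f A" "f ` A \<subseteq> B" using assms card_of_ordLeq by metis
  then have "inj_on (image f) (Pow A)" "image f ` Pow A \<subseteq> Pow B"
    by (auto intro: inj_on_image_Pow)
  then show ?thesis using card_of_ordLeq by blast
qed

lemma clog_mono:
  assumes "Card_order r" "natLeq \<le>o r" "Card_order r'" "natLeq \<le>o r'" "r \<le>o r'"
  shows "clog r \<le>o clog r'"
  using assms clog(1-3)[of r'] ordLeq_transitive by (intro clog_least) blast+

lemma ordLeq_Pow_Pow_clog_clog:
  assumes "Card_order r" "natLeq \<le>o r"
  shows "r \<le>o |Pow (Pow (Field (clog (clog r))))|"
proof -
  have c: "Card_order (clog r)" "natLeq \<le>o clog r" using clog[OF assms] by auto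
  have "clog r \<le>o |Pow (Field (clog (clog r)))|"
    using ordLeq_ctwo_cexp_clog[OF c] ctwo_cexp_ordIso_Pow ordLeq_ordIso_trans by blast
  moreover have "|Field (clog r)| =o clog r" using card_of_Field_ordIso[OF c(1)] .
  ultimately have "|Field (clog r)| \<le>o |Pow (Field (clog (clog r)))|" using ordIso_ordLeq_trans by blast
  then have "|Pow (Field (clog r))| \<le>o |Pow (Pow (Field (clog (clog r))))|" by (rule Pow_ordLeq_mono)
  moreover have "r \<le>o |Pow (Field (clog r))|"
    using ordLeq_ctwo_cexp_clog[OF assms] ctwo_cexp_ordIso_Pow ordLeq_ordIso_trans by blast
  ultimately show ?thesis by (blast intro: ordLeq_transitive)
qed

lemma clog_ordLeq_card:
  assumes r: "Card_order r" "natLeq \<le>o r" and A: "infinite A" "r \<le>o |Pow A|"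
  shows "clog r \<le>o |A|"
proof (rule clog_least[OF r card_of_Card_order])
  show "natLeq \<le>o |A|" using A(1) infinite_iff_natLeq_ordLeq by blast
  have "|Pow A| =o ctwo ^c |A|"
    using ctwo_cexp_ordIso_Pow[of "|A|"] by (simp add: Field_card_of ordIso_symmetric)
  then show "r \<le>o ctwo ^c |A|" using A(2) ordLeq_ordIso_trans by blast
qed

text \<open>If disjoint open sets \<open>V\<close> and \<open>W\<close> contain \<open>x\<close> and
  \<open>y\<close>, then the closure of \<open>V \<inter> D\<close> contains \<open>x\<close> but
  not \<open>y\<close>.\<close>

lemma Hausdorff_closure_card:
  assumes T: "Hausdorff_space T" and D: "D \<subseteq> topspace T"
  shows "|T closure_of D| \<le>o |Pow (Pow D)|"
proof -
  define e where "e x = {A. A \<subseteq> D \<and> x \<in> T closure_of A}" for x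
  have "inj_on e (T closure_of D)"
  proof (rule inj_onI, rule ccontr)
    fix x y assume x: "x \<in> T closure_of D" and y: "y \<in> T closure_of D" and eq: "e x = e y" and "x \<noteq> y"
    moreover have "x \<in> topspace T" "y \<in> topspace T" using x y by (simp_all add: in_closure_of)
    ultimately obtain V W where VW: "openin T V" "openin T W" "x \<in> V" "y \<in> W" "disjnt V W"
      using T unfolding Hausdorff_space_def by metis
    have "x \<in> T closure_of (V \<inter> D)"
      unfolding in_closure_of
    proof (intro conjI strip)
      show "x \<in> topspace T" by fact
      fix U assume "x \<in> U \<and> openin T U"
      then have "x \<in> U \<inter> V" "openin T (U \<inter> V)" using VW by auto
      then show "\<exists>z. z \<in> V \<inter> D \<and> z \<in> U" using x unfolding in_closure_of by blast
    qed
    then have "V \<inter> D \<in> e x" by (simp add: e_def)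
    then have "V \<inter> D \<in> e y" using eq by blast
    then have "y \<in> T closure_of (V \<inter> D)" by (simp add: e_def)
    then show False using VW unfolding in_closure_of disjnt_def by blast
  qed
  moreover have "e ` (T closure_of D) \<subseteq> Pow (Pow D)" by (auto simp: e_def)
  ultimately show ?thesis unfolding card_of_ordLeq[symmetric] by blast
qed

lemma precompact_group_topology_Hausdorff:
  assumes "precompact_group_topology G T"
  shows "Hausdorff_space T"
proof -
  obtain K :: "'a set set monoid" and U H f where K: "Hausdorff_space U"
    "topological_group_iso G T (K\<lparr>carrier := H\<rparr>) (subtopology U H) f"
    using assms unfolding precompact_group_topology_def by blast
  then have "T homeomorphic_space subtopology U H"
    unfolding topological_group_iso_def using homeomorphic_map_imp_homeomorphic_space by blast
  then show ?thesis
    using homeomorphic_Hausdorff_space Hausdorff_space_subtopology[OF K(1)] by blast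
qed

lemma group_topology_nat_pow_continuous:
  assumes "group_topology G T"
  shows "continuous_map T T (\<lambda>x. x [^]\<^bsub>G\<^esub> (n::nat))"
proof (induction n)
  interpret G: group G using assms by (simp add: group_topology_def)
  case 0
  then show ?case using assms by (simp add: group_topology_def)
next
  case (Suc n)
  have "continuous_map T (prod_topology T T) (\<lambda>x. (x [^]\<^bsub>G\<^esub> n, x))"
    using Suc by (simp add: continuous_map_pairedI)
  moreover have "continuous_map (prod_topology T T) T (\<lambda>(x, y). x \<otimes>\<^bsub>G\<^esub> y)"
    using assms by (simp add: group_topology_def)
  ultimately show ?case by (auto dest: continuous_map_compose simp: o_def)
qed

text \<open>Taking \<open>n\<close>-th powers is continuous and so maps a dense set onto a dense
  subset of its image.\<close>

lemma dense_multiples_card: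
  assumes T: "group_topology G T" "Hausdorff_space T" and S: "dense_in_topology T S"
  shows "|multiples G n (carrier G)| \<le>o |Pow (Pow (multiples G n S))|"
proof -
  have top: "topspace T = carrier G" using T(1) by (simp add: group_topology_def)
  let ?f = "\<lambda>x. x [^]\<^bsub>G\<^esub> n"
  have m: "multiples G n A = ?f ` A" for A by (auto simp: multiples_def)
  have c: "continuous_map T T ?f" by (rule group_topology_nat_pow_continuous[OF T(1)])
  have "?f ` (T closure_of S) \<subseteq> T closure_of (?f ` S)"
    using c by (rule continuous_map_image_closure_subset)
  then have "multiples G n (carrier G) \<subseteq> T closure_of (multiples G n S)"
    using S by (simp add: m dense_in_topology_def top)
  then have "|multiples G n (carrier G)| \<le>o |T closure_of (multiples G n S)|" by (rule card_of_mono1)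
  moreover have "multiples G n S \<subseteq> topspace T"
    using S c unfolding m dense_in_topology_def continuous_map_def by blast
  then have "|T closure_of (multiples G n S)| \<le>o |Pow (Pow (multiples G n S))|"
    by (rule Hausdorff_closure_card[OF T(2)])
  ultimately show ?thesis by (rule ordLeq_transitive)
qed

theorem corollary3p5:
  fixes G :: "('a, 'm) monoid_scheme" and S :: "'a set"
  assumes "comm_group G"
    and "\<And>n::nat. n \<ge> 1 \<Longrightarrow> |multiples G n (carrier G)| =o |carrier G|"
    and "S \<subseteq> carrier G" and "uncountable S"
  shows
    "(potentially_dense G S \<longleftrightarrow>
        (\<exists>T. precompact_group_topology G T \<and> dense_in_topology T S)) \<and>
     ((\<exists>T. precompact_group_topology G T \<and> dense_in_topology T S) \<longleftrightarrow>
        (\<forall>n::nat. n \<ge> 1 \<longrightarrow> clog (clog |multiples G n (carrier G)| ) \<le>o |multiples G n S| )) \<and>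
     ((\<forall>n::nat. n \<ge> 1 \<longrightarrow> clog (clog |multiples G n (carrier G)| ) \<le>o |multiples G n S| ) \<longleftrightarrow>
        clog (clog |carrier G| ) \<le>o min_card {|multiples G n S| | n::nat. n \<ge> 1})"
    (is "(?i \<longleftrightarrow> ?ii) \<and> (?ii \<longleftrightarrow> ?iii) \<and> (?iii \<longleftrightarrow> ?iv)")
proof -
  interpret G: comm_group G by fact
  have "infinite S" using assms(4) countable_finite by blast
  then have infG: "infinite (carrier G)" using assms(3) finite_subset by blast
  have inf_n: "infinite (multiples G n (carrier G))" if "n \<ge> 1" for n :: nat
    using card_of_ordIso_finite[OF assms(2)[OF that]] infG by blast
  have nat_le: "natLeq \<le>o |A|" if "infinite A" for A :: "'a set"
    using that infinite_iff_natLeq_ordLeq by blast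
  have card_clog: "Card_order (clog |A| )" "natLeq \<le>o clog |A|" if "infinite A" for A :: "'a set"
    using clog[OF card_of_Card_order nat_le[OF that]] by auto
  have clog2_mono: "clog (clog |A| ) \<le>o clog (clog |B| )"
    if "infinite A" "infinite B" "|A| \<le>o |B|" for A B :: "'a set"
    using card_clog that nat_le by (intro clog_mono card_of_Card_order) auto
  have i_iii: ?iii if i: ?i
  proof (intro allI impI)
    fix n :: nat assume n: "n \<ge> 1"
    obtain T where T: "group_topology G T" "Hausdorff_space T" "dense_in_topology T S"
      using i by (auto simp: potentially_dense_def)
    let ?r = "|multiples G n (carrier G)|" and ?A = "multiples G n S"
    have r: "?r \<le>o |Pow (Pow ?A)|" by (rule dense_multiples_card[OF T])
    \<comment> \<open>Logarithms range over infinite cardinals only, so \<open>|?A|\<close> has to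
      be infinite before it can bound one; if \<open>?A\<close> were finite, the infinite
      \<open>nG\<close> would embed into a finite double power set.\<close>
    then have A: "infinite ?A" using inf_n[OF n] card_of_ordLeq_infinite finite_Pow_iff by blast
    have c: "clog ?r \<le>o |Pow ?A|"
      using A r nat_le[OF inf_n[OF n]] by (intro clog_ordLeq_card card_of_Card_order) auto
    show "clog (clog ?r) \<le>o |?A|"
      by (rule clog_ordLeq_card[OF card_clog[OF inf_n[OF n]] A c])
  qed
  have ii_i: ?i if ?ii
    using that precompact_group_topology_Hausdorff
    unfolding potentially_dense_def precompact_group_topology_def by blast
  define \<tau> where "\<tau> = clog (clog |carrier G| )"
  have \<tau>: "Card_order \<tau>" "natLeq \<le>o \<tau>"
    using clog[OF card_clog[OF infG]] by (auto simp: \<tau>_def)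
  have \<tau>_field: "|Field \<tau>| =o \<tau>" by (rule card_of_Field_ordIso[OF \<tau>(1)])
  have "natLeq \<le>o |Field \<tau>|" using \<tau>(2) ordIso_symmetric[OF \<tau>_field] ordLeq_ordIso_trans by blast
  then have inf\<tau>: "infinite (Field \<tau>)" using infinite_iff_natLeq_ordLeq by blast
  have iii: "\<tau> \<le>o |multiples G n S|" if ?iii "n \<ge> 1" for n :: nat
  proof -
    \<comment> \<open>The hypothesis on \<open>|nG|\<close> merges the bounds for the various
      \<open>n\<close> into a bound by the single cardinal \<open>\<tau>\<close>.\<close>
    have "|carrier G| \<le>o |multiples G n (carrier G)|"
      using assms(2)[OF that(2)] ordIso_symmetric ordIso_imp_ordLeq by blast
    then have "\<tau> \<le>o clog (clog |multiples G n (carrier G)| )"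
      unfolding \<tau>_def by (rule clog2_mono[OF infG inf_n[OF that(2)]])
    then show ?thesis using that ordLeq_transitive by blast
  qed
  \<comment> \<open>The double logarithm is large enough for its double power set to bound
    \<open>|G|\<close>, while the assumption places it below every \<open>|nS|\<close>; so its field
    can serve as the index set.\<close>
  have iii_ii: ?ii if ?iii
  proof (rule G.dense_in_precompact_topology[OF inf\<tau> _ assms(3)])
    show "|carrier G| \<le>o |Pow (Pow (Field \<tau>))|"
      unfolding \<tau>_def by (rule ordLeq_Pow_Pow_clog_clog[OF card_of_Card_order nat_le[OF infG]])
    show "|Field \<tau>| \<le>o |multiples G n S|" if "n \<ge> 1" for n :: nat
      using iii[OF \<open>?iii\<close> that] \<tau>_field ordIso_ordLeq_trans by blast
  qed
  let ?R = "{|multiples G n S| | n::nat. n \<ge> 1}"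
  have R: "?R \<noteq> {}" "\<forall>r\<in>?R. Card_order r" by (auto simp: card_of_Card_order)
  have iii_iv: "?iii \<longleftrightarrow> ?iv"
  proof
    assume ?iii
    \<comment> \<open>A minimum of cardinals is attained, so the bound for one particular
      \<open>n\<close> is all that is required.\<close>
    moreover obtain n :: nat where "n \<ge> 1" "min_card ?R = |multiples G n S|" using min_card_in[OF R] by blast
    ultimately show ?iv using iii[of n] by (simp add: \<tau>_def)
  next
    assume iv: ?iv
    show ?iii
    proof (intro allI impI)
      fix n :: nat assume n: "n \<ge> 1"
      have "|multiples G n (carrier G)| \<le>o |carrier G|" using assms(2)[OF n] ordIso_imp_ordLeq by blast
      then have "clog (clog |multiples G n (carrier G)| ) \<le>o clog (clog |carrier G| )"
        by (rule clog2_mono[OF inf_n[OF n] infG])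
      moreover have "min_card ?R \<le>o |multiples G n S|" using n by (intro min_card_least[OF R]) blast
      ultimately show "clog (clog |multiples G n (carrier G)| ) \<le>o |multiples G n S|"
        using iv ordLeq_transitive by blast
    qed
  qed
  show ?thesis using i_iii ii_i iii_ii iii_iv by blast
qed

end
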